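(* Let $m\ge 0$ be an integer, and let $(G,\{a_1,\ldots,a_m\},b_1,b_2)$ be an $m$-rooted graph. Then either $(G,\{a_1,\ldots,a_m\},b_1,b_2)$ is feasible, or there exists an $\{a_1,\ldots,a_m,b_1,b_2\}$-collection $\mathcal{X}$ in $G$ such that (i) $|N(X)|\le m+1$ for all $X\in\mathcal{X}$, and (ii) $e(\mathcal{G}/\mathcal{X})\le (m+1)\,v(G/\mathcal{X})-m^2/2-3m/2-1$, where $\mathcal{G}=(G,\{a_1,\ldots,a_m\},b_1,b_2)$.
   Context: All graphs are finite and simple; $v(H)$ and $e(H)$ denote the numbers of vertices and edges of $H$. For $A\subseteq V(G)$, $N(A)=N_G(A)$ is the set of vertices outside $A$ adjacent to some vertex of $A$, and $N[A]=N(A)\cup A$. An $m$-rooted graph $(G,\{a_1,\ldots,a_m\},b_1,b_2)$ consists of a graph $G$ and distinct vertices $a_1,\ldots,a_m,b_1,b_2$ of $G$ ($m=0$ allowed, in which case the set of $a_i$ is empty). It is feasible if $G$ contains a $b_1$-$b_2$ path $P$ such that $\{a_1,\ldots,a_m\}$ is contained in a single component of $G-P$ (the graph obtained by deleting the vertices of $P$). For $S\subseteq V(G)$, an $S$-collection in $G$ is a family $\mathcal{X}$ of subsets of $V(G)\setminus S$ such that $N[X_1]\cap X_2=\emptyset$ for all distinct $X_1,X_2\in\mathcal{X}$. $G/\mathcal{X}$ denotes the graph obtained from $G$ by, for each $X\in\mathcal{X}$, deleting $X$ and adding edges making $N_G(X)$ a clique. For a rooted graph $\mathcal{G}=(G,\{a_1,\ldots,a_m\},b_1,b_2)$,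 $\mathcal{G}/\mathcal{X}$ denotes the graph obtained from $G/\mathcal{X}$ by adding an edge between every pair of distinct vertices of $\{a_1,\ldots,a_m,b_1,b_2\}$ except the pair $\{b_1,b_2\}$ (if not already present). *)

theory Defs
  imports Complex_Main
begin

record 'a ugraph =
  verts :: "'a set"
  edges :: "'a set set"

definition simple_graph :: "'a ugraph \<Rightarrow> bool" where
  "simple_graph G \<longleftrightarrow>
     finite (verts G) \<and> (\<forall>e\<in>edges G. e \<subseteq> verts G \<and> card e = 2)"

definition num_verts :: "'a ugraph \<Rightarrow> nat" where
  "num_verts G = card (verts G)"

definition num_edges :: "'a ugraph \<Rightarrow> nat" where
  "num_edges G = card (edges G)"

definition nbhd :: "'a ugraph \<Rightarrow> 'a set \<Rightarrow> 'a set" where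
  "nbhd G A = {v \<in> verts G - A. \<exists>u\<in>A. {u, v} \<in> edges G}"

definition closed_nbhd :: "'a ugraph \<Rightarrow> 'a set \<Rightarrow> 'a set" where
  "closed_nbhd G A = nbhd G A \<union> A"

definition delete_verts :: "'a ugraph \<Rightarrow> 'a set \<Rightarrow> 'a ugraph" where
  "delete_verts G S =
     \<lparr>verts = verts G - S, edges = {e \<in> edges G. e \<inter> S = {}}\<rparr>"

definition add_edges :: "'a ugraph \<Rightarrow> 'a set set \<Rightarrow> 'a ugraph" where
  "add_edges G F = \<lparr>verts = verts G, edges = edges G \<union> F\<rparr>"

definition all_pairs :: "'a set \<Rightarrow> 'a set set" where
  "all_pairs A = {{u, v} | u v. u \<in> A \<and> v \<in> A \<and> u \<noteq> v}"

text \<open>A path is given by its list of vertices; one-vertex paths are allowed.\<close>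

definition is_path :: "'a ugraph \<Rightarrow> 'a list \<Rightarrow> 'a \<Rightarrow> 'a \<Rightarrow> bool" where
  "is_path G p x y \<longleftrightarrow>
     p \<noteq> [] \<and> hd p = x \<and> last p = y \<and> distinct p \<and> set p \<subseteq> verts G \<and>
     (\<forall>i. Suc i < length p \<longrightarrow> {p ! i, p ! Suc i} \<in> edges G)"

text \<open>Components are represented by their vertex sets.\<close>

definition components :: "'a ugraph \<Rightarrow> 'a set set" where
  "components G = {{v. \<exists>p. is_path G p u v} | u. u \<in> verts G}"

definition rooted_graph :: "nat \<Rightarrow> 'a ugraph \<Rightarrow> 'a set \<Rightarrow> 'a \<Rightarrow> 'a \<Rightarrow> bool" where
  "rooted_graph m G A b1 b2 \<longleftrightarrow>
     simple_graph G \<and> A \<subseteq> verts G \<and> card A = m \<and>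
     b1 \<in> verts G - A \<and> b2 \<in> verts G - A \<and> b1 \<noteq> b2"

text \<open>
  For \<open>A = {}\<close> the definition asks for a path whose deletion leaves at least one
  component, i.e. a non-spanning path: a graph without vertices has no components.
\<close>

definition feasible :: "'a ugraph \<Rightarrow> 'a set \<Rightarrow> 'a \<Rightarrow> 'a \<Rightarrow> bool" where
  "feasible G A b1 b2 \<longleftrightarrow>
     (\<exists>p. is_path G p b1 b2 \<and> (\<exists>C\<in>components (delete_verts G (set p)). A \<subseteq> C))"

definition is_collection :: "'a ugraph \<Rightarrow> 'a set \<Rightarrow> 'a set set \<Rightarrow> bool" where
  "is_collection G S \<X> \<longleftrightarrow>
     (\<forall>X\<in>\<X>. X \<subseteq> verts G - S) \<and>
     (\<forall>X1\<in>\<X>. \<forall>X2\<in>\<X>. X1 \<noteq> X2 \<longrightarrow> closed_nbhd G X1 \<inter> X2 = {})"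

text \<open>
  Only meaningful for collections \<open>\<X>\<close>: then each \<open>nbhd G X\<close> avoids every member
  of \<open>\<X>\<close>, so all added edges join surviving vertices.
\<close>

definition quotient_graph :: "'a ugraph \<Rightarrow> 'a set set \<Rightarrow> 'a ugraph" where
  "quotient_graph G \<X> =
     add_edges (delete_verts G (\<Union>\<X>)) (\<Union>X\<in>\<X>. all_pairs (nbhd G X))"

definition rooted_quotient ::
    "'a ugraph \<Rightarrow> 'a set \<Rightarrow> 'a \<Rightarrow> 'a \<Rightarrow> 'a set set \<Rightarrow> 'a ugraph" where
  "rooted_quotient G A b1 b2 \<X> =
     add_edges (quotient_graph G \<X>) (all_pairs (A \<union> {b1, b2}) - {{b1, b2}})"

end

theory Submission
  imports Defs
begin

text \<open>
  Let \<open>R\<close> be the set of the \<open>h = m + 2\<close> roots, \<open>U\<close> the remaining vertices, \<open>\<alpha> \<ge> h - 1\<close>, and let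
  \<open>rho X\<close> count the edges meeting \<open>X\<close>. The core is that a rooted graph is feasible as soon as
  \<open>rho U\<close> exceeds \<open>\<alpha> |U|\<close> slightly while \<open>rho Y \<le> \<alpha> |Y|\<close> for every nonempty \<open>Y \<subseteq> U\<close> with fewer
  than \<open>h\<close> neighbours. In a minimal counterexample no set \<open>Z \<subseteq> U\<close> is good, that is, able to realise
  inside itself every pairing that replacing \<open>Z\<close> by a clique on \<open>N(Z)\<close> provides: for
  \<open>|N(Z)| < h\<close> one collapses a maximal good \<open>Z\<close>, in general one first links \<open>Z\<close> to its
  surroundings by disjoint paths. Contracting an edge must destroy the density, so
  adjacent vertices have at least about \<open>\<alpha>\<close> common neighbours, whereas the edge count gives a vertex of
  degree below \<open>2 \<alpha>\<close>. Its neighbourhood is so dense that it stays connected after the removal of two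
  vertices, and so this single vertex is good, a contradiction.

  For the theorem, collapse good sets that violate the sparsity condition one after another. If the
  result is still infeasible, the core bounds \<open>rho\<close> of the remaining nonroots.
\<close>

section \<open>Connectivity in edge sets\<close>

text \<open>The theorem uses \<alpha> = h - 1 = m + 1, but \<open>h\<close> and \<alpha> are
  separate parameters because the induction lowers \<open>h\<close> alone: a set violating sparsity
  is treated as a rooted graph on its own, smaller neighbourhood with the same \<alpha>. As long as
  h \<le> \<alpha>, a surplus of one edge over \<alpha> |U| links the roots. At h = \<alpha> + 1 a
  surplus of two is asked for, and this fits the theorem exactly: an infeasible sparse quotient has
  at most (m + 1) |U| + 1 edges meeting \<open>U\<close>, and the pairs of roots other than
  \<open>{b1, b2}\<close> number (m + 2 choose 2) - 1. With |U| = v - (m + 2) the sum is (m + 1) v -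
  (m + 1) (m + 2) / 2, the bound claimed. The obstacle is the surplus of exactly one at h = \<alpha>
  + 1, which arises inside the induction. A contraction then has one edge too few to spare, and a
  pair of roots without common neighbours in \<open>U\<close> has to make up for it; this forces the
  weighted degree count and the case analysis around a single root \<open>a\<close>.\<close>

definition graph :: "'a set set \<Rightarrow> bool" where
  "graph E \<longleftrightarrow> finite E \<and> (\<forall>e\<in>E. card e = 2)"

definition nb :: "'a set set \<Rightarrow> 'a set \<Rightarrow> 'a set" where
  "nb E X = {v. v \<notin> X \<and> (\<exists>u\<in>X. {u, v} \<in> E)}"

text \<open>Cuts instead of paths: unions, contractions and collapses are then handled by following
  one side of a cut. The empty set counts as connected, which covers the case of no roots to
  gather.\<close>

definition conn :: "'a set set \<Rightarrow> 'a set \<Rightarrow> bool" where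
  "conn E S \<longleftrightarrow> (\<forall>D. D \<subseteq> S \<longrightarrow> D \<noteq> {} \<longrightarrow> D \<noteq> S \<longrightarrow> (\<exists>d\<in>D. \<exists>s\<in>S - D. {d, s} \<in> E))"

definition rho :: "'a set set \<Rightarrow> 'a set \<Rightarrow> nat" where
  "rho E X = card {e \<in> E. e \<inter> X \<noteq> {}}"

text \<open>Two disjoint connected sets stand for the path and the component. Unlike a path they
  need no trimming when they are rerouted or uncontracted; \<open>conn_path\<close> extracts a path
  only at the very end.\<close>

definition feas :: "'a set set \<Rightarrow> 'a set \<Rightarrow> 'a set \<Rightarrow> 'a \<Rightarrow> 'a \<Rightarrow> bool" where
  "feas E V W x y \<longleftrightarrow> (\<exists>S T. S \<subseteq> V \<and> T \<subseteq> V \<and> S \<inter> T = {} \<and> conn E S \<and> conn E T \<and> x \<in> S \<and> y \<in> S \<and> W \<subseteq> T)"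

text \<open>
  The first conjunct allows \<open>Z\<close> to be disconnected: only a connected part seeing all of
  \<open>N(Z)\<close> is needed. \<open>A\<close> and \<open>B\<close> record the roots whose side is already decided.
\<close>

definition good :: "nat \<Rightarrow> 'a set set \<Rightarrow> 'a set \<Rightarrow> 'a set \<Rightarrow> 'a set \<Rightarrow> bool" where
  "good h E A B Z \<longleftrightarrow> (\<exists>D. D \<subseteq> Z \<and> D \<noteq> {} \<and> conn E D \<and> nb E Z \<subseteq> nb E D) \<and> (\<forall>x y W. x \<in> nb E Z \<longrightarrow> y \<in> nb E Z \<longrightarrow> x \<noteq> y \<longrightarrow>
     W \<subseteq> nb E Z - {x, y} \<longrightarrow> card W \<le> h - 2 \<longrightarrow> A \<inter> nb E Z \<subseteq> W \<longrightarrow> B \<inter> nb E Z \<subseteq> {x, y} \<longrightarrow>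
     feas E (Z \<union> nb E Z) W x y)"

lemma least_obtain:
  fixes m :: "'b \<Rightarrow> nat"
  assumes "P k"
  obtains x where "P x" "\<And>y. P y \<Longrightarrow> m x \<le> m y"
  using ex_has_least_nat[of P k m, OF assms] by blast

lemma greatest_obtain:
  fixes m :: "'b \<Rightarrow> nat"
  assumes "P k" "\<And>y. P y \<Longrightarrow> m y \<le> b"
  obtains x where "P x" "\<And>y. P y \<Longrightarrow> m y \<le> m x"
proof -
  have "\<forall>y. P y \<longrightarrow> m y < Suc b" using assms(2) by (simp add: less_Suc_eq_le)
  with assms(1) have "\<exists>x. P x \<and> (\<forall>y. P y \<longrightarrow> m y \<le> m x)" by (rule ex_has_greatest_nat)
  then show thesis using that by blast
qed

lemma graph_edge_ne: "graph E \<Longrightarrow> {u, v} \<in> E \<Longrightarrow> u \<noteq> v"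
  unfolding graph_def by (auto simp: card_2_iff doubleton_eq_iff)

lemma graph_edgeE:
  assumes "graph E" "e \<in> E"
  obtains u v where "e = {u, v}" "u \<noteq> v"
  using assms unfolding graph_def by (meson card_2_iff)

lemma graph_edge_at:
  assumes "graph E" "e \<in> E" "u \<in> e"
  obtains v where "e = {u, v}" "u \<noteq> v"
  using graph_edgeE[OF assms(1,2)] assms(3) by (metis doubleton_eq_iff insertE singletonD)

lemma finite_Union_graph: "graph E \<Longrightarrow> finite (\<Union>E)"
  unfolding graph_def by (metis card.infinite finite_Union zero_neq_numeral)

lemma nb_subset_Union: "nb E X \<subseteq> \<Union>E"
  unfolding nb_def by blast

lemma finite_nb: "graph E \<Longrightarrow> finite (nb E X)"
  using finite_Union_graph nb_subset_Union finite_subset by metis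

lemma nb_disj: "nb E X \<inter> X = {}"
  unfolding nb_def by blast

lemma in_nb: "v \<in> nb E X \<longleftrightarrow> v \<notin> X \<and> (\<exists>u\<in>X. {u, v} \<in> E)"
  unfolding nb_def by simp

lemma nb_sing: "graph E \<Longrightarrow> nb E {x} = {y. {x, y} \<in> E}"
  unfolding nb_def using graph_edge_ne by fastforce

lemma conn_empty [simp]: "conn E {}"
  unfolding conn_def by blast

lemma conn_sing [simp]: "conn E {x}"
  unfolding conn_def by blast

lemma connI:
  assumes "\<And>D. D \<subseteq> S \<Longrightarrow> D \<noteq> {} \<Longrightarrow> D \<noteq> S \<Longrightarrow> (\<And>d s. d \<in> D \<Longrightarrow> s \<in> S - D \<Longrightarrow> {d, s} \<notin> E) \<Longrightarrow> False"
  shows "conn E S"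
  unfolding conn_def using assms by blast

lemma connD:
  assumes "conn E S" "\<And>d s. d \<in> D \<Longrightarrow> d \<in> S \<Longrightarrow> s \<in> S - D \<Longrightarrow> {d, s} \<notin> E" "S \<inter> D \<noteq> {}"
  shows "S \<subseteq> D"
proof (rule ccontr)
  assume "\<not> S \<subseteq> D"
  then have "S \<inter> D \<noteq> S" by blast
  with assms(1,3) obtain d s where "d \<in> S \<inter> D" "s \<in> S - S \<inter> D" "{d, s} \<in> E"
    unfolding conn_def by (metis inf_le1)
  with assms(2) show False by blast
qed

lemma conn_Union:
  assumes "\<And>X. X \<in> \<C> \<Longrightarrow> conn E X" "\<And>X. X \<in> \<C> \<Longrightarrow> X \<inter> T \<noteq> {}" "conn E T"
  shows "conn E (T \<union> \<Union>\<C>)"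
proof (rule connI)
  fix D assume D: "D \<subseteq> T \<union> \<Union>\<C>" "D \<noteq> {}" "D \<noteq> T \<union> \<Union>\<C>"
    and no: "\<And>d s. d \<in> D \<Longrightarrow> s \<in> T \<union> \<Union>\<C> - D \<Longrightarrow> {d, s} \<notin> E"
  have *: "X \<subseteq> D" if "conn E X" "X \<subseteq> T \<union> \<Union>\<C>" "X \<inter> D \<noteq> {}" for X
    by (rule connD[OF that(1)]) (use no that in blast)+
  have "T \<inter> D \<noteq> {}"
  proof
    assume "T \<inter> D = {}"
    then obtain X where X: "X \<in> \<C>" "X \<inter> D \<noteq> {}" using D by blast
    then have "X \<subseteq> D" using * assms(1) by (metis Sup_upper le_supI2)
    then show False using assms(2)[OF X(1)] \<open>T \<inter> D = {}\<close> by blast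
  qed
  then have T: "T \<subseteq> D" using *[of T] assms(3) by blast
  have "X \<subseteq> D" if "X \<in> \<C>" for X
    using *[of X] assms(1,2)[OF that] that T by blast
  then show False using T D by blast
qed

lemma conn_Un: "conn E S \<Longrightarrow> conn E T \<Longrightarrow> S \<inter> T \<noteq> {} \<Longrightarrow> conn E (S \<union> T)"
  using conn_Union[of "{T}" E S] by auto

lemma conn_edge: "{x, y} \<in> E \<Longrightarrow> conn E {x, y}"
proof (rule connI)
  fix D assume e: "{x, y} \<in> E" and D: "D \<subseteq> {x, y}" "D \<noteq> {}" "D \<noteq> {x, y}"
    and no: "\<And>d s. d \<in> D \<Longrightarrow> s \<in> {x, y} - D \<Longrightarrow> {d, s} \<notin> E"
  have "x \<in> D \<and> y \<notin> D \<or> y \<in> D \<and> x \<notin> D" using D by blast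
  then show False using no[of x y] no[of y x] e by (auto simp: insert_commute)
qed

lemma conn_insert: "conn E S \<Longrightarrow> x \<in> S \<Longrightarrow> {x, y} \<in> E \<Longrightarrow> conn E (insert y S)"
proof -
  assume "conn E S" "x \<in> S" "{x, y} \<in> E"
  then have "conn E (S \<union> {x, y})" by (intro conn_Un conn_edge) auto
  moreover have "S \<union> {x, y} = insert y S" using \<open>x \<in> S\<close> by blast
  ultimately show ?thesis by simp
qed

lemma conn_Un_edge: "conn E S \<Longrightarrow> conn E T \<Longrightarrow> x \<in> S \<Longrightarrow> y \<in> T \<Longrightarrow> {x, y} \<in> E \<Longrightarrow> conn E (S \<union> T)"
proof -
  assume *: "conn E S" "conn E T" "x \<in> S" "y \<in> T" "{x, y} \<in> E"
  have "conn E (insert y S \<union> T)" by (intro conn_Un conn_insert[OF *(1,3,5)]) (use * in auto)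
  moreover have "insert y S \<union> T = S \<union> T" using *(4) by blast
  ultimately show ?thesis by simp
qed

lemma conn_attach:
  assumes "conn E Z" "Z \<noteq> {}" "K \<subseteq> Z \<union> nb E Z" shows "conn E (Z \<union> K)"
proof -
  have "\<forall>k\<in>K. \<exists>u. u \<in> Z \<and> conn E {u, k}"
  proof
    fix k assume "k \<in> K"
    then consider "k \<in> Z" | "k \<in> nb E Z" using assms(3) by blast
    then show "\<exists>u. u \<in> Z \<and> conn E {u, k}"
    proof cases
      case 1 then show ?thesis by (intro exI[of _ k]) simp
    next
      case 2 then obtain u where "u \<in> Z" "{u, k} \<in> E" by (auto simp: in_nb)
      then have "u \<in> Z \<and> conn E {u, k}" by (simp add: conn_edge)
      then show ?thesis ..
    qed
  qed
  then obtain g where "\<forall>k\<in>K. g k \<in> Z \<and> conn E {g k, k}" by (rule bchoice[THEN exE])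
  then have g: "\<And>k. k \<in> K \<Longrightarrow> g k \<in> Z \<and> conn E {g k, k}" by blast
  have "conn E (Z \<union> \<Union>((\<lambda>k. {g k, k}) ` K))"
  proof (rule conn_Union)
    fix X assume "X \<in> (\<lambda>k. {g k, k}) ` K"
    then obtain k where k: "k \<in> K" "X = {g k, k}" by blast
    show "conn E X" "X \<inter> Z \<noteq> {}" using g[OF k(1)] unfolding k(2) by simp_all
  qed (rule assms)
  moreover have "Z \<union> \<Union>((\<lambda>k. {g k, k}) ` K) = Z \<union> K"
  proof -
    have "\<And>k. k \<in> K \<Longrightarrow> g k \<in> Z" using g by simp
    then show ?thesis by auto
  qed
  ultimately show ?thesis by simp
qed

lemma conn_mono: "conn E S \<Longrightarrow> E \<subseteq> F \<Longrightarrow> conn F S"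
  unfolding conn_def by blast

lemma conn_reach:
  assumes "x \<in> S"
  obtains D where "D \<subseteq> S" "x \<in> D" "conn E D" "\<And>d s. d \<in> D \<Longrightarrow> s \<in> S - D \<Longrightarrow> {d, s} \<notin> E"
proof
  \<comment> \<open>The component of \<open>x\<close> in \<open>S\<close>, built as the union of all
    connected sets through \<open>x\<close>.\<close>
  let ?D = "\<Union>{C. C \<subseteq> S \<and> x \<in> C \<and> conn E C}"
  show "?D \<subseteq> S" by blast
  show x: "x \<in> ?D" using assms by (metis (mono_tags, lifting) CollectI UnionI conn_sing empty_subsetI insert_subset singletonI)
  have "conn E ({x} \<union> ?D)" by (rule conn_Union) auto
  then show c: "conn E ?D" using x by (simp add: insert_absorb)
  fix d s assume d: "d \<in> ?D" and s: "s \<in> S - ?D"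
  show "{d, s} \<notin> E"
  proof
    assume "{d, s} \<in> E"
    then have "conn E (insert s ?D)" using conn_insert[OF c d] by blast
    moreover have "insert s ?D \<subseteq> S" "x \<in> insert s ?D" using s x by auto
    ultimately have "s \<in> ?D" by blast
    then show False using s by blast
  qed
qed

lemma feas_mono: "feas E V W x y \<Longrightarrow> V \<subseteq> V' \<Longrightarrow> W' \<subseteq> W \<Longrightarrow> E \<subseteq> E' \<Longrightarrow> feas E' V' W' x y"
  unfolding feas_def by (meson conn_mono order_trans)

lemma feas_sym: "feas E V W x y \<longleftrightarrow> feas E V W y x"
  unfolding feas_def by blast

lemma feasI: "S \<subseteq> V \<Longrightarrow> T \<subseteq> V \<Longrightarrow> S \<inter> T = {} \<Longrightarrow> conn E S \<Longrightarrow> conn E T \<Longrightarrow> x \<in> S \<Longrightarrow> y \<in> S \<Longrightarrow> W \<subseteq> T \<Longrightarrow> feas E V W x y"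
  unfolding feas_def by blast

lemma feasE:
  assumes "feas E V W x y"
  obtains S T where "S \<subseteq> V" "T \<subseteq> V" "S \<inter> T = {}" "conn E S" "conn E T" "x \<in> S" "y \<in> S" "W \<subseteq> T"
  using assms unfolding feas_def by (elim exE conjE) (rule that)

lemma conn_path:
  assumes "conn E S" "x \<in> S" "y \<in> S"
  shows "\<exists>p. p \<noteq> [] \<and> hd p = x \<and> last p = y \<and> distinct p \<and> set p \<subseteq> S \<and> (\<forall>i. Suc i < length p \<longrightarrow> {p ! i, p ! Suc i} \<in> E)"
proof -
  let ?P = "\<lambda>p y. p \<noteq> [] \<and> hd p = x \<and> last p = y \<and> distinct p \<and> set p \<subseteq> S \<and> (\<forall>i. Suc i < length p \<longrightarrow> {p ! i, p ! Suc i} \<in> E)"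
  let ?D = "{y. \<exists>p. ?P p y}"
  \<comment> \<open>Prefixes of a simple path lead to each of its vertices. So a vertex outside
    \<open>?D\<close> is not on the path and can be appended without repetition.\<close>
  have sub: "set p \<subseteq> ?D" if p: "?P p z" for p z
  proof
    fix w assume "w \<in> set p"
    then obtain i where i: "i < length p" "p ! i = w" by (metis in_set_conv_nth)
    have "last (take (Suc i) p) = w" using i by (simp add: take_Suc_conv_app_nth)
    moreover have "hd (take (Suc i) p) = x" "take (Suc i) p \<noteq> []" using p by (auto simp: hd_conv_nth)
    moreover have "set (take (Suc i) p) \<subseteq> S"
      using conjunct1[OF conjunct2[OF conjunct2[OF conjunct2[OF conjunct2[OF p]]]]] set_take_subset[of "Suc i" p] by simp
    moreover have "distinct (take (Suc i) p)" using conjunct1[OF conjunct2[OF conjunct2[OF conjunct2[OF p]]]] by simp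
    moreover have "\<forall>j. Suc j < length (take (Suc i) p) \<longrightarrow> {take (Suc i) p ! j, take (Suc i) p ! Suc j} \<in> E"
      using conjunct2[OF conjunct2[OF conjunct2[OF conjunct2[OF conjunct2[OF p]]]]] by simp
    ultimately have "?P (take (Suc i) p) w" by blast
    then show "w \<in> ?D" by blast
  qed
  have x: "x \<in> ?D" using assms(2) by (intro CollectI exI[of _ "[x]"]) auto
  have "S \<subseteq> ?D"
  proof (rule connD[OF assms(1)])
    show "S \<inter> ?D \<noteq> {}" using x assms(2) by blast
    fix d s assume d: "d \<in> ?D" "d \<in> S" and s: "s \<in> S - ?D"
    show "{d, s} \<notin> E"
    proof
      assume e: "{d, s} \<in> E"
      obtain p where p: "?P p d" using d by blast
      have "s \<notin> set p" using sub[OF p] s by blast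
      have "{(p @ [s]) ! i, (p @ [s]) ! Suc i} \<in> E" if "Suc i < length (p @ [s])" for i
      proof (cases "Suc i < length p")
        case True then show ?thesis using p by (simp add: nth_append)
      next
        case False
        then have "i = length p - 1" "i < length p" using that p by auto
        then show ?thesis using p e last_conv_nth[of p] by (simp add: nth_append)
      qed
      then have "?P (p @ [s]) s" using p s \<open>s \<notin> set p\<close> by simp
      then show False using s by blast
    qed
  qed
  then show ?thesis using assms(3) by blast
qed

lemma rho_Un_le: "graph E \<Longrightarrow> rho E (X \<union> Y) \<le> rho E X + rho E Y"
proof -
  assume "graph E"
  have "{e \<in> E. e \<inter> (X \<union> Y) \<noteq> {}} = {e \<in> E. e \<inter> X \<noteq> {}} \<union> {e \<in> E. e \<inter> Y \<noteq> {}}" by blast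
  then show ?thesis unfolding rho_def by (simp add: card_Un_le)
qed

lemma rho_empty [simp]: "rho E {} = 0"
  unfolding rho_def by simp

section \<open>Contracting an edge\<close>

text \<open>The vertex \<open>t\<close> is merged into \<open>s\<close>.\<close>

definition contract :: "'a set set \<Rightarrow> 'a \<Rightarrow> 'a \<Rightarrow> 'a set set" where
  "contract E s t = {e \<in> E. t \<notin> e} \<union> {{s, q} | q. q \<noteq> s \<and> q \<noteq> t \<and> {t, q} \<in> E}"

lemma contract_iff:
  assumes "s \<noteq> t" "graph E"
  shows "{p, q} \<in> contract E s t \<longleftrightarrow> p \<noteq> q \<and> p \<noteq> t \<and> q \<noteq> t \<and>
    ({p, q} \<in> E \<or> p = s \<and> {t, q} \<in> E \<or> q = s \<and> {t, p} \<in> E)"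
proof
  assume "{p, q} \<in> contract E s t"
  then consider "{p, q} \<in> E" "t \<notin> {p, q}" | r where "{p, q} = {s, r}" "r \<noteq> s" "r \<noteq> t" "{t, r} \<in> E"
    unfolding contract_def by blast
  then show "p \<noteq> q \<and> p \<noteq> t \<and> q \<noteq> t \<and> ({p, q} \<in> E \<or> p = s \<and> {t, q} \<in> E \<or> q = s \<and> {t, p} \<in> E)"
  proof cases
    case 1 then show ?thesis using graph_edge_ne[OF assms(2)] by auto
  next
    case 2
    from 2(1) consider "p = s" "q = r" | "p = r" "q = s" by (auto simp: doubleton_eq_iff)
    then show ?thesis by cases (use 2 assms(1) in auto)
  qed
next
  assume a: "p \<noteq> q \<and> p \<noteq> t \<and> q \<noteq> t \<and> ({p, q} \<in> E \<or> p = s \<and> {t, q} \<in> E \<or> q = s \<and> {t, p} \<in> E)"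
  then consider "{p, q} \<in> E" | "p = s" "{t, q} \<in> E" | "q = s" "{t, p} \<in> E" by blast
  then show "{p, q} \<in> contract E s t"
  proof cases
    case 1
    then have "{p, q} \<in> {e \<in> E. t \<notin> e}" using a by auto
    then show ?thesis unfolding contract_def by (rule UnI1)
  next
    case 2 then show ?thesis unfolding contract_def using a by auto
  next
    case 3
    then have "{s, p} \<in> contract E s t" unfolding contract_def using a by auto
    then show ?thesis using 3(1) by (simp add: insert_commute)
  qed
qed

lemma graph_contract: assumes "graph E" "s \<noteq> t" shows "graph (contract E s t)"
proof -
  have "{{s, q} | q. q \<noteq> s \<and> q \<noteq> t \<and> {t, q} \<in> E} \<subseteq> (\<lambda>q. {s, q}) ` (\<Union>E)" by blast
  from finite_subset[OF this finite_imageI[OF finite_Union_graph[OF assms(1)]]]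
  have fin2: "finite {{s, q} | q. q \<noteq> s \<and> q \<noteq> t \<and> {t, q} \<in> E}" .
  have fin1: "finite {e \<in> E. t \<notin> e}" using assms(1) unfolding graph_def by simp
  have "card e = 2" if "e \<in> contract E s t" for e
    using that assms(1) unfolding graph_def contract_def by auto
  moreover have "finite (contract E s t)" unfolding contract_def using fin1 fin2 by (rule finite_UnI)
  ultimately show ?thesis unfolding graph_def by simp
qed

lemma conn_contract:
  assumes g: "graph E" and st: "s \<noteq> t" "{s, t} \<in> E" and c: "conn (contract E s t) S" and t: "t \<notin> S"
  shows "conn E (if s \<in> S then insert t S else S)"
proof (rule connI)
  let ?S = "if s \<in> S then insert t S else S"
  fix D assume D: "D \<subseteq> ?S" "D \<noteq> {}" "D \<noteq> ?S"
    and no: "\<And>d s. d \<in> D \<Longrightarrow> s \<in> ?S - D \<Longrightarrow> {d, s} \<notin> E"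
  have ts: "{t, s} \<in> E" using st(2) by (simp add: insert_commute)
  have same: "t \<in> D \<longleftrightarrow> s \<in> D" if "s \<in> S"
    using no[of s t] no[of t s] st(2) ts that by auto
  have ne: "S \<inter> D \<noteq> {}"
  proof (cases "s \<in> S")
    case True then show ?thesis using D(1,2) same by auto
  next
    case False then show ?thesis using D(1,2) by auto
  qed
  have "S \<subseteq> D"
  proof (rule connD[OF c])
    show "S \<inter> D \<noteq> {}" by (rule ne)
    fix d r assume d: "d \<in> D" "d \<in> S" and r: "r \<in> S - D"
    show "{d, r} \<notin> contract E s t"
    proof
      assume "{d, r} \<in> contract E s t"
      then have "{d, r} \<in> E \<or> d = s \<and> {t, r} \<in> E \<or> r = s \<and> {t, d} \<in> E" using contract_iff[OF st(1) g] by blast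
      then show False
      proof (elim disjE conjE)
        assume "{d, r} \<in> E" moreover have "r \<in> ?S - D" using r by simp
        ultimately show False using no[of d r] d by simp
      next
        assume "d = s" "{t, r} \<in> E" then show False using no[of t r] d r same by auto
      next
        assume "r = s" "{t, d} \<in> E"
        then show False using no[of d t] d r same by (auto simp: insert_commute)
      qed
    qed
  qed
  then show False using D same by (auto split: if_splits)
qed

text \<open>\<open>t\<close> joins whichever side holds \<open>s\<close>, and is left out if neither
  does.\<close>

lemma feas_contract:
  assumes g: "graph E" and st: "s \<noteq> t" "{s, t} \<in> E" and f: "feas (contract E s t) V W x y" and t: "t \<notin> V"
  shows "feas E (insert t V) (if s \<in> W then insert t W else W) x y"
proof -
  obtain S T where ST: "S \<subseteq> V" "T \<subseteq> V" "S \<inter> T = {}" "conn (contract E s t) S" "conn (contract E s t) T" "x \<in> S" "y \<in> S" "W \<subseteq> T"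
    using f by (rule feasE)
  have tST: "t \<notin> S" "t \<notin> T" using t ST by auto
  show ?thesis
    by (rule feasI[OF _ _ _ conn_contract[OF g st ST(4) tST(1)] conn_contract[OF g st ST(5) tST(2)]])
      (use ST tST in \<open>auto split: if_splits\<close>)
qed

lemma nb_contract:
  assumes g: "graph E" and st: "s \<noteq> t" and Y: "s \<notin> Y" "t \<notin> Y"
  shows "nb (contract E s t) Y = nb E Y - {t} \<union> (if t \<in> nb E Y then {s} else {})"
proof (rule set_eqI)
  fix v
  show "v \<in> nb (contract E s t) Y \<longleftrightarrow> v \<in> nb E Y - {t} \<union> (if t \<in> nb E Y then {s} else {})"
  proof
    assume "v \<in> nb (contract E s t) Y"
    then obtain u where u: "v \<notin> Y" "u \<in> Y" "{u, v} \<in> contract E s t" by (auto simp: in_nb)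
    then have "v \<noteq> t" "{u, v} \<in> E \<or> v = s \<and> {t, u} \<in> E" using contract_iff[OF st g] Y by blast+
    then show "v \<in> nb E Y - {t} \<union> (if t \<in> nb E Y then {s} else {})"
      using u(1,2) Y by (auto simp: in_nb insert_commute)
  next
    assume "v \<in> nb E Y - {t} \<union> (if t \<in> nb E Y then {s} else {})"
    then consider "v \<in> nb E Y" "v \<noteq> t" | "v = s" "t \<in> nb E Y" by (auto split: if_splits)
    then show "v \<in> nb (contract E s t) Y"
    proof cases
      case 1
      then obtain u where "v \<notin> Y" "u \<in> Y" "{u, v} \<in> E" by (auto simp: in_nb)
      moreover then have "{u, v} \<in> contract E s t" using 1 Y contract_iff[OF st g, of u v] by auto
      ultimately show ?thesis by (auto simp: in_nb)
    next
      case 2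
      then obtain u where "u \<in> Y" "{u, t} \<in> E" by (auto simp: in_nb)
      moreover then have "{u, s} \<in> contract E s t" using 2 Y st contract_iff[OF st g, of u s] by (auto simp: insert_commute)
      ultimately show ?thesis using 2 Y by (auto simp: in_nb)
    qed
  qed
qed

lemma nb_contract_in:
  assumes g: "graph E" and st: "s \<noteq> t" and Y: "s \<in> Y" "t \<notin> Y"
  shows "nb (contract E s t) Y = nb E (insert t Y)"
proof (rule set_eqI)
  fix v
  show "v \<in> nb (contract E s t) Y \<longleftrightarrow> v \<in> nb E (insert t Y)"
  proof
    assume "v \<in> nb (contract E s t) Y"
    then obtain u where u: "v \<notin> Y" "u \<in> Y" "{u, v} \<in> contract E s t" by (auto simp: in_nb)
    then have "v \<noteq> t" "{u, v} \<in> E \<or> u = s \<and> {t, v} \<in> E" using contract_iff[OF st g] Y by blast+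
    then show "v \<in> nb E (insert t Y)" using u by (auto simp: in_nb)
  next
    assume "v \<in> nb E (insert t Y)"
    then obtain u where u: "v \<notin> Y" "v \<noteq> t" "u = t \<or> u \<in> Y" "{u, v} \<in> E" by (auto simp: in_nb)
    show "v \<in> nb (contract E s t) Y"
    proof (cases "u = t")
      case True
      then have "{s, v} \<in> contract E s t" using u Y st contract_iff[OF st g, of s v] by auto
      then show ?thesis using u Y by (auto simp: in_nb)
    next
      case False
      then have "{u, v} \<in> contract E s t" using u Y contract_iff[OF st g, of u v] by auto
      then show ?thesis using u False by (auto simp: in_nb)
    qed
  qed
qed

lemma card_nb_contract_le:
  assumes g: "graph E" and st: "s \<noteq> t" and Y: "s \<notin> Y" "t \<notin> Y"
  shows "card (nb E Y) \<le> Suc (card (nb (contract E s t) Y))"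
    and "\<not> (s \<in> nb E Y \<and> t \<in> nb E Y) \<Longrightarrow> card (nb E Y) = card (nb (contract E s t) Y)"
    and "s \<in> nb E Y \<Longrightarrow> t \<in> nb E Y \<Longrightarrow> card (nb E Y) = Suc (card (nb (contract E s t) Y))"
proof -
  note eq = nb_contract[OF assms]
  have f: "finite (nb E Y)" by (rule finite_nb[OF g])
  show 2: "\<not> (s \<in> nb E Y \<and> t \<in> nb E Y) \<Longrightarrow> card (nb E Y) = card (nb (contract E s t) Y)"
  proof -
    assume a: "\<not> (s \<in> nb E Y \<and> t \<in> nb E Y)"
    show "card (nb E Y) = card (nb (contract E s t) Y)"
    proof (cases "t \<in> nb E Y")
      case True
      then have "nb (contract E s t) Y = insert s (nb E Y - {t})" "s \<notin> nb E Y - {t}" using a eq by auto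
      then have "card (nb (contract E s t) Y) = Suc (card (nb E Y - {t}))" using f by simp
      then show ?thesis using card_Suc_Diff1[OF f True] by simp
    next
      case False then show ?thesis unfolding eq by simp
    qed
  qed
  show 3: "s \<in> nb E Y \<Longrightarrow> t \<in> nb E Y \<Longrightarrow> card (nb E Y) = Suc (card (nb (contract E s t) Y))"
  proof -
    assume a: "s \<in> nb E Y" "t \<in> nb E Y"
    then have "nb (contract E s t) Y = nb E Y - {t}" using eq st by auto
    then show "card (nb E Y) = Suc (card (nb (contract E s t) Y))" using card_Suc_Diff1[OF f a(2)] by simp
  qed
  show "card (nb E Y) \<le> Suc (card (nb (contract E s t) Y))" using 2 3 by linarith
qed


section \<open>Edges lost by a contraction\<close>

definition common :: "'a set set \<Rightarrow> 'a \<Rightarrow> 'a \<Rightarrow> 'a set" where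
  "common E s t = {y. {s, y} \<in> E \<and> {t, y} \<in> E}"

lemma finite_common: "graph E \<Longrightarrow> finite (common E s t)"
  using finite_subset[of "common E s t" "\<Union>E"] finite_Union_graph unfolding common_def by blast

text \<open>Two edges coincide after the merging only if they are \<open>{s, y}\<close> and
  \<open>{t, y}\<close> for a common neighbour \<open>y\<close>. Since \<open>s\<close> and
  \<open>t\<close> lie outside \<open>Y\<close>, no edge meeting \<open>Y\<close> is lost in any
  other way, so equality holds.\<close>

lemma rho_contract_ge_common:
  assumes g: "graph E" and st: "s \<noteq> t" and Y: "s \<notin> Y" "t \<notin> Y"
  shows "rho E Y = rho (contract E s t) Y + card (Y \<inter> common E s t)"
proof -
  let ?F = "{e \<in> E. e \<inter> Y \<noteq> {}}" and ?R = "(\<lambda>y. {t, y}) ` (Y \<inter> common E s t)"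
  \<comment> \<open>Redirects edges from \<open>t\<close> to \<open>s\<close>. It is injective once
    \<open>?R\<close>, the edges whose image is already present, is set aside.\<close>
  let ?f = "\<lambda>e. if t \<in> e then insert s (e - {t}) else e"
  have fin: "finite ?F" using g unfolding graph_def by simp
  have R: "?R \<subseteq> ?F" unfolding common_def by auto
  have cR: "card ?R = card (Y \<inter> common E s t)" using Y by (intro card_image) (auto simp: inj_on_def doubleton_eq_iff)
  have edge: "\<exists>y. e = {t, y} \<and> y \<in> Y \<and> y \<noteq> t \<and> y \<noteq> s \<and> {t, y} \<in> E \<and> ?f e = {s, y}" if "e \<in> ?F" "t \<in> e" for e
  proof -
    have eE: "e \<in> E" "t \<in> e" using that by blast+
    obtain y where y: "e = {t, y}" "t \<noteq> y" using graph_edge_at[OF g eE] by metis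
    then have "y \<in> Y" using that Y by auto
    then show ?thesis using y that Y by auto
  qed
  have inj: "inj_on ?f (?F - ?R)"
  proof (rule inj_onI)
    fix e1 e2 assume e: "e1 \<in> ?F - ?R" "e2 \<in> ?F - ?R" "?f e1 = ?f e2"
    have *: False if "d1 \<in> ?F - ?R" "d2 \<in> ?F - ?R" "?f d1 = ?f d2" "t \<in> d1" "t \<notin> d2" for d1 d2
    proof -
      have d1: "d1 \<in> ?F" "t \<in> d1" using that by blast+
      obtain y where y: "d1 = {t, y}" "y \<in> Y" "{t, y} \<in> E" "?f d1 = {s, y}" using edge[OF d1] by blast
      then have "d2 = {s, y}" using that by simp
      then have "y \<in> common E s t" using that y unfolding common_def by auto
      then show False using that(1) y by blast
    qed
    show "e1 = e2"
    proof (cases "t \<in> e1")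
      case True
      then have t2: "t \<in> e2" using *[of e1 e2] e by blast
      obtain y where y: "e1 = {t, y}" "y \<noteq> s" "?f e1 = {s, y}" using edge[of e1] e True by blast
      obtain z where z: "e2 = {t, z}" "z \<noteq> s" "?f e2 = {s, z}" using edge[of e2] e t2 by blast
      have "{s, y} = {s, z}" using e(3) y(3) z(3) by simp
      then show ?thesis using y z by (auto simp: doubleton_eq_iff)
    next
      case False
      then have "t \<notin> e2" using *[of e2 e1] e by metis
      then show ?thesis using False e(3) by simp
    qed
  qed
  have im: "?f ` (?F - ?R) = {e \<in> contract E s t. e \<inter> Y \<noteq> {}}"
  proof
    show "?f ` (?F - ?R) \<subseteq> {e \<in> contract E s t. e \<inter> Y \<noteq> {}}"
    proof
      fix d assume "d \<in> ?f ` (?F - ?R)"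
      then obtain e where e: "e \<in> ?F - ?R" "d = ?f e" by blast
      show "d \<in> {e \<in> contract E s t. e \<inter> Y \<noteq> {}}"
      proof (cases "t \<in> e")
        case True
        then obtain y where y: "y \<in> Y" "y \<noteq> t" "y \<noteq> s" "{t, y} \<in> E" "?f e = {s, y}" using edge[of e] e by blast
        then show ?thesis using e(2) unfolding contract_def by auto
      next
        case False then show ?thesis using e unfolding contract_def by auto
      qed
    qed
    show "{e \<in> contract E s t. e \<inter> Y \<noteq> {}} \<subseteq> ?f ` (?F - ?R)"
    proof
      fix d assume d: "d \<in> {e \<in> contract E s t. e \<inter> Y \<noteq> {}}"
      show "d \<in> ?f ` (?F - ?R)"
      proof (cases "d \<in> E")
        case True
        then have "t \<notin> d" using d st unfolding contract_def by auto
        then have 1: "d \<in> ?F - ?R" "d = ?f d" using d True by auto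
        from 1(2,1) show ?thesis by (rule image_eqI)
      next
        case False
        then obtain q where q: "d = {s, q}" "q \<noteq> s" "q \<noteq> t" "{t, q} \<in> E" using d unfolding contract_def by blast
        have "q \<in> Y" using d q Y by auto
        moreover have "{t, q} \<notin> ?R" using False q unfolding common_def by (auto simp: doubleton_eq_iff)
        ultimately have 1: "{t, q} \<in> ?F - ?R" using q by auto
        have "d = ?f {t, q}" using q st by auto
        from this 1 show ?thesis by (rule image_eqI)
      qed
    qed
  qed
  have "card ?F = card (?F - ?R) + card ?R"
    using card_Diff_subset[OF finite_subset[OF R fin] R] card_mono[OF fin R] by simp
  then show ?thesis unfolding rho_def using cR card_image[OF inj] im by simp
qed

text \<open>
  The vertices whose edge to \<open>t\<close> is lost on merging \<open>t\<close> into \<open>s\<close>: it becomes parallel to an edge at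
  \<open>s\<close>, or joins two roots and thus no longer meets \<open>U\<close>.
\<close>

definition lost :: "'a set set \<Rightarrow> 'a set \<Rightarrow> 'a \<Rightarrow> 'a \<Rightarrow> 'a set" where
  "lost E R s t = {y. y \<noteq> s \<and> {t, y} \<in> E \<and> ({s, y} \<in> E \<or> s \<in> R \<and> y \<in> R)}"

text \<open>Here \<open>t\<close> belongs to the set that is counted, so the edge
  \<open>{s, t}\<close> disappears as well, which is the 1. A redirected edge \<open>{s, y}\<close>
  stops meeting the set only if \<open>s\<close> and \<open>y\<close> are both roots.\<close>

lemma rho_contract_ge:
  assumes g: "graph E" and st: "s \<noteq> t" "{s, t} \<in> E" and U: "t \<in> U" "nb E U \<subseteq> R"
  shows "rho E U \<le> rho (contract E s t) (U - {t}) + 1 + card (lost E R s t)"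
proof -
  let ?F = "{e \<in> E. e \<inter> U \<noteq> {}}" and ?C = "(\<lambda>y. {t, y}) ` insert s (lost E R s t)"
  let ?f = "\<lambda>e. if t \<in> e then insert s (e - {t}) else e"
  have finC: "finite (lost E R s t)"
    by (rule finite_subset[OF _ finite_Union_graph[OF g]]) (auto simp: lost_def)
  have edge: "\<exists>y. e = {t, y} \<and> y \<noteq> t \<and> {t, y} \<in> E \<and> y \<noteq> s \<and> y \<notin> lost E R s t \<and> ?f e = {s, y}" if "e \<in> ?F - ?C" "t \<in> e" for e
  proof -
    have eE: "e \<in> E" "t \<in> e" using that by blast+
    obtain y where y: "e = {t, y}" "t \<noteq> y" using graph_edge_at[OF g eE] by metis
    then have "y \<notin> insert s (lost E R s t)" using that by blast
    then show ?thesis using y that by auto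
  qed
  have inj: "inj_on ?f (?F - ?C)"
  proof (rule inj_onI)
    fix e1 e2 assume e: "e1 \<in> ?F - ?C" "e2 \<in> ?F - ?C" "?f e1 = ?f e2"
    have *: False if d: "d1 \<in> ?F - ?C" "d2 \<in> ?F - ?C" "?f d1 = ?f d2" "t \<in> d1" "t \<notin> d2" for d1 d2
    proof -
      obtain y where y: "d1 = {t, y}" "{t, y} \<in> E" "y \<noteq> s" "y \<notin> lost E R s t" "?f d1 = {s, y}" using edge[OF d(1,4)] by blast
      then have "d2 = {s, y}" using d by simp
      then show False using d y unfolding lost_def by auto
    qed
    show "e1 = e2"
    proof (cases "t \<in> e1")
      case True
      then have t2: "t \<in> e2" using *[of e1 e2] e by blast
      obtain y where y: "e1 = {t, y}" "y \<noteq> s" "?f e1 = {s, y}" using edge[of e1] e True by blast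
      obtain z where z: "e2 = {t, z}" "z \<noteq> s" "?f e2 = {s, z}" using edge[of e2] e t2 by blast
      have "{s, y} = {s, z}" using e(3) y(3) z(3) by simp
      then show ?thesis using y z by (auto simp: doubleton_eq_iff)
    next
      case False
      then have "t \<notin> e2" using *[of e2 e1] e by metis
      then show ?thesis using False e(3) by simp
    qed
  qed
  have im: "?f ` (?F - ?C) \<subseteq> {e \<in> contract E s t. e \<inter> (U - {t}) \<noteq> {}}"
  proof
    fix d assume "d \<in> ?f ` (?F - ?C)"
    then obtain e where e: "e \<in> ?F - ?C" "d = ?f e" by blast
    show "d \<in> {e \<in> contract E s t. e \<inter> (U - {t}) \<noteq> {}}"
    proof (cases "t \<in> e")
      case True
      then obtain y where y: "y \<noteq> t" "y \<noteq> s" "{t, y} \<in> E" "y \<notin> lost E R s t" "?f e = {s, y}" using edge[OF e(1)] by blast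
      have d: "d = {s, y}" using e(2) y(5) by simp
      have "{s, y} \<inter> (U - {t}) \<noteq> {}"
      proof
        assume "{s, y} \<inter> (U - {t}) = {}"
        then have n: "s \<notin> U" "y \<notin> U" using y st by auto
        have "{t, s} \<in> E" using st(2) by (simp add: insert_commute)
        then have "s \<in> nb E U" "y \<in> nb E U" using n y(3) U(1) unfolding in_nb by blast+
        then have "s \<in> R" "y \<in> R" using U(2) by blast+
        then show False using y unfolding lost_def by blast
      qed
      moreover have "{s, y} \<in> contract E s t" using y unfolding contract_def by auto
      ultimately show ?thesis using d by blast
    next
      case False then show ?thesis using e unfolding contract_def by auto
    qed
  qed
  have "finite (contract E s t)" using graph_contract[OF g st(1)] unfolding graph_def by simp
  then have "card (?F - ?C) \<le> rho (contract E s t) (U - {t})"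
    unfolding rho_def using card_image[OF inj] card_mono[OF _ im] by simp
  moreover have "card ?F \<le> card (?F - ?C) + card ?C"
using diff_card_le_card_Diff[of ?C ?F] finC by simp
  moreover have "card ?C \<le> 1 + card (lost E R s t)"
    using card_image_le[of "insert s (lost E R s t)" "\<lambda>y. {t, y}"] finC card_insert_le_m1[of "Suc (card (lost E R s t))" "lost E R s t" s]
    by (simp add: card_insert_if split: if_splits)
  ultimately show ?thesis unfolding rho_def by linarith
qed

section \<open>Collapsing a set to a clique on its neighbourhood\<close>

definition collapse :: "'a set set \<Rightarrow> 'a set \<Rightarrow> 'a set set" where
  "collapse E Z = {e \<in> E. e \<inter> Z = {}} \<union> all_pairs (nb E Z)"

lemma all_pairs_iff: "{p, q} \<in> all_pairs K \<longleftrightarrow> p \<in> K \<and> q \<in> K \<and> p \<noteq> q"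
  unfolding all_pairs_def by (auto simp: doubleton_eq_iff)

lemma finite_all_pairs: assumes "finite K" shows "finite (all_pairs K)"
proof -
  have "all_pairs K \<subseteq> Pow K" unfolding all_pairs_def by auto
  then show ?thesis using assms finite_subset by blast
qed

lemma card_all_pairs_elem: "e \<in> all_pairs K \<Longrightarrow> card e = 2"
  unfolding all_pairs_def by auto

lemma collapse_iff: "{p, q} \<in> collapse E Z \<longleftrightarrow> {p, q} \<in> E \<and> p \<notin> Z \<and> q \<notin> Z \<or> p \<in> nb E Z \<and> q \<in> nb E Z \<and> p \<noteq> q"
proof -
  have "{p, q} \<in> collapse E Z \<longleftrightarrow> {p, q} \<in> E \<and> {p, q} \<inter> Z = {} \<or> {p, q} \<in> all_pairs (nb E Z)"
    unfolding collapse_def by blast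
  then show ?thesis unfolding all_pairs_iff by simp
qed

lemma graph_collapse: assumes "graph E" shows "graph (collapse E Z)"
proof -
  have "finite (collapse E Z)" unfolding collapse_def
    using assms finite_all_pairs[OF finite_nb[OF assms]] by (simp add: graph_def)
  moreover have "card e = 2" if "e \<in> collapse E Z" for e
    using that assms card_all_pairs_elem[of e] unfolding collapse_def graph_def by blast
  ultimately show ?thesis unfolding graph_def by blast
qed

lemma nb_collapse_far:
  assumes "Y \<inter> Z = {}" "Y \<inter> nb E Z = {}"
  shows "nb (collapse E Z) Y = nb E Y"
proof (rule set_eqI)
  fix v
  have *: "{u, v} \<in> collapse E Z \<longleftrightarrow> {u, v} \<in> E" if "u \<in> Y" for u
  proof -
    have "u \<notin> Z" "u \<notin> nb E Z" using that assms by auto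
    moreover then have "v \<notin> Z" if "{u, v} \<in> E" using that by (auto simp: in_nb insert_commute)
    ultimately show ?thesis unfolding collapse_iff by blast
  qed
  show "v \<in> nb (collapse E Z) Y \<longleftrightarrow> v \<in> nb E Y" unfolding in_nb using * by blast
qed

lemma rho_collapse_far:
  assumes "graph E" "Y \<inter> Z = {}" "Y \<inter> nb E Z = {}"
  shows "rho (collapse E Z) Y = rho E Y"
proof -
  have "{e \<in> collapse E Z. e \<inter> Y \<noteq> {}} = {e \<in> E. e \<inter> Y \<noteq> {}}"
  proof (rule set_eqI)
    fix e
    have 1: "e \<inter> Z = {}" if "e \<in> E" "e \<inter> Y \<noteq> {}"
    proof -
      note e = that
      from e obtain y where y: "y \<in> e" "y \<in> Y" by blast
      obtain z where z: "e = {y, z}" using graph_edge_at[OF assms(1) e(1) y(1)] by metis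
      have "{z, y} \<in> E" "y \<notin> Z" "y \<notin> nb E Z" using assms(2,3) y z e(1) by (auto simp: insert_commute)
      then have "z \<notin> Z" unfolding in_nb by blast
      then show ?thesis using assms(2) y z by auto
    qed
    have 2: "e \<notin> all_pairs (nb E Z)" if "e \<inter> Y \<noteq> {}" using that assms(3) unfolding all_pairs_def by blast
    show "e \<in> {e \<in> collapse E Z. e \<inter> Y \<noteq> {}} \<longleftrightarrow> e \<in> {e \<in> E. e \<inter> Y \<noteq> {}}"
      unfolding collapse_def using 1 2 by blast
  qed
  then show ?thesis unfolding rho_def by simp
qed

lemma nb_collapse_near:
  assumes "Y \<inter> Z = {}" "Y \<inter> nb E Z \<noteq> {}" "graph E"
  shows "nb E (Y \<union> Z) = nb (collapse E Z) Y"
proof (rule set_eqI)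
  fix v
  show "v \<in> nb E (Y \<union> Z) \<longleftrightarrow> v \<in> nb (collapse E Z) Y"
  proof
    assume v: "v \<in> nb E (Y \<union> Z)"
    then have vn: "v \<notin> Y" "v \<notin> Z" by (auto simp: in_nb)
    from v obtain u where u: "u \<in> Y \<or> u \<in> Z" "{u, v} \<in> E" by (auto simp: in_nb)
    show "v \<in> nb (collapse E Z) Y"
    proof (cases "u \<in> Z")
      case True
      then have vK: "v \<in> nb E Z" using u vn by (auto simp: in_nb)
      obtain y where y: "y \<in> Y" "y \<in> nb E Z" using assms(2) by blast
      then have "{y, v} \<in> collapse E Z" using vK vn unfolding collapse_iff by blast
      then show ?thesis using y vn unfolding in_nb by blast
    next
      case False
      then have "{u, v} \<in> collapse E Z" "u \<in> Y" using u vn unfolding collapse_iff by blast+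
      then show ?thesis using vn unfolding in_nb by blast
    qed
  next
    assume "v \<in> nb (collapse E Z) Y"
    then obtain u where u: "v \<notin> Y" "u \<in> Y" "{u, v} \<in> collapse E Z" unfolding in_nb by blast
    from u(3) consider "{u, v} \<in> E" "v \<notin> Z" | "v \<in> nb E Z" unfolding collapse_iff by blast
    then show "v \<in> nb E (Y \<union> Z)" by cases (use u in \<open>auto simp: in_nb\<close>)
  qed
qed

lemma nb_collapse_clique: "Y \<inter> nb E Z \<noteq> {} \<Longrightarrow> nb E Z \<subseteq> Y \<union> nb (collapse E Z) Y"
  unfolding nb_def[of "collapse E Z"] collapse_iff by blast

text \<open>A vertex that becomes a common neighbour of \<open>a\<close> and \<open>b\<close> only
  through the collapse has a new edge to one of them. These edges, one per vertex, pay for the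
  growth of the common neighbourhood; thereby the last alternative of \<open>dense\<close> survives
  a collapse.\<close>

lemma rho_collapse_ge:
  assumes g: "graph E" and False: "\<not> (a \<in> U \<or> b \<in> U \<or> a = b)"
  shows "rho E U + card ((U - Z) \<inter> common (collapse E Z) a b) \<le> rho (collapse E Z) (U - Z) + rho E Z + card (U \<inter> common E a b)"
proof -
  let ?old = "{e \<in> E. e \<inter> Z = {} \<and> e \<inter> (U - Z) \<noteq> {}}"
  let ?N = "(U - Z) \<inter> common (collapse E Z) a b - common E a b"
  let ?f = "\<lambda>y. if {a, y} \<in> E then {b, y} else {a, y}"
  have finE: "finite E" "finite (collapse E Z)" using g graph_collapse[OF g] unfolding graph_def by auto
  have fc: "finite (common (collapse E Z) a b)" "finite (common E a b)" using finite_common[OF g] finite_common[OF graph_collapse[OF g]] by auto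
  show ?thesis
  proof -
    have inj: "inj_on ?f ?N"
    proof (rule inj_onI)
      fix p q assume p: "p \<in> ?N" and q: "q \<in> ?N" and e: "?f p = ?f q"
      have "p \<noteq> a" "p \<noteq> b" "q \<noteq> a" "q \<noteq> b" "a \<noteq> b" using p q False by auto
      then show "p = q" using e by (simp add: doubleton_eq_iff split: if_splits)
    qed
    have ne: "?f y \<notin> E" if "y \<in> ?N" for y using that unfolding common_def by auto
    have inc: "?f y \<in> collapse E Z" if "y \<in> ?N" for y using that unfolding common_def by auto
    have disj: "?old \<inter> ?f ` ?N = {}" using ne by blast
    have sub: "?old \<union> ?f ` ?N \<subseteq> {e \<in> collapse E Z. e \<inter> (U - Z) \<noteq> {}}"
    proof -
      have "?old \<subseteq> {e \<in> collapse E Z. e \<inter> (U - Z) \<noteq> {}}" unfolding collapse_def by blast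
      moreover have "?f y \<inter> (U - Z) \<noteq> {}" if "y \<in> ?N" for y using that by auto
      ultimately show ?thesis using inc by blast
    qed
    have "card ?old + card ?N = card (?old \<union> ?f ` ?N)"
      using card_Un_disjoint[OF _ _ disj] finE fc card_image[OF inj] by simp
    also have "\<dots> \<le> rho (collapse E Z) (U - Z)"
      unfolding rho_def using finE sub by (intro card_mono) auto
    finally have 1: "card ?old + card ?N \<le> rho (collapse E Z) (U - Z)" .
    have "{e \<in> E. e \<inter> U \<noteq> {}} \<subseteq> ?old \<union> {e \<in> E. e \<inter> Z \<noteq> {}}" by blast
    then have "rho E U \<le> card (?old \<union> {e \<in> E. e \<inter> Z \<noteq> {}})" unfolding rho_def using finE by (intro card_mono) auto
    also have "\<dots> \<le> card ?old + rho E Z" unfolding rho_def by (rule card_Un_le)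
    finally have 2: "rho E U \<le> card ?old + rho E Z" .
    have "(U - Z) \<inter> common (collapse E Z) a b \<subseteq> ?N \<union> (U \<inter> common E a b)" by blast
    then have "card ((U - Z) \<inter> common (collapse E Z) a b) \<le> card (?N \<union> (U \<inter> common E a b))" using fc by (intro card_mono) auto
    also have "\<dots> \<le> card ?N + card (U \<inter> common E a b)" by (rule card_Un_le)
    finally show ?thesis using 1 2 by linarith
  qed
qed

text \<open>\<open>T0\<close> replaces every clique edge inside \<open>T\<close>, since it already
  connects the vertices of \<open>nb E Z\<close> that \<open>T\<close> contains.\<close>

lemma conn_collapse:
  assumes T: "conn (collapse E Z) T" and T0: "conn E T0" and sub: "T \<inter> nb E Z \<subseteq> T0" and ne: "T \<inter> nb E Z \<noteq> {}"
  shows "conn E (T \<union> T0)"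
proof (rule connI)
  fix D assume D: "D \<subseteq> T \<union> T0" "D \<noteq> {}" "D \<noteq> T \<union> T0"
    and no: "\<And>d s. d \<in> D \<Longrightarrow> s \<in> T \<union> T0 - D \<Longrightarrow> {d, s} \<notin> E"
  have t0: "T0 \<subseteq> D" if "T0 \<inter> D \<noteq> {}" by (rule connD[OF T0]) (use no that in blast)+
  have t: "T \<subseteq> D" if "T \<inter> D \<noteq> {}"
  proof (rule connD[OF T _ that])
    fix d s assume d: "d \<in> D" "d \<in> T" and s: "s \<in> T - D"
    show "{d, s} \<notin> collapse E Z"
    proof
      assume "{d, s} \<in> collapse E Z"
      then consider "{d, s} \<in> E" | "d \<in> nb E Z" "s \<in> nb E Z" unfolding collapse_iff by blast
      then show False
      proof cases
        case 1 then show False using no[of d s] d s by blast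
      next
        case 2
        then have "d \<in> T0" "s \<in> T0" using sub d s by auto
        then show False using t0 d s by blast
      qed
    qed
  qed
  obtain k where k: "k \<in> T" "k \<in> T0" using sub ne by blast
  show False
  proof (cases "k \<in> D")
    case True then show False using t t0 k D by blast
  next
    case False
    then have "T \<inter> D = {}" "T0 \<inter> D = {}" using t t0 k by blast+
    then show False using D by blast
  qed
qed

lemma conn_collapse_free:
  assumes "conn (collapse E Z) T" "\<And>p q. p \<in> T \<Longrightarrow> q \<in> T \<Longrightarrow> p \<in> nb E Z \<Longrightarrow> q \<in> nb E Z \<Longrightarrow> p = q"
  shows "conn E T"
proof (rule connI)
  fix D assume D: "D \<subseteq> T" "D \<noteq> {}" "D \<noteq> T" and no: "\<And>d s. d \<in> D \<Longrightarrow> s \<in> T - D \<Longrightarrow> {d, s} \<notin> E"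
  have "T \<subseteq> D"
  proof (rule connD[OF assms(1)])
    show "T \<inter> D \<noteq> {}" using D by blast
    fix d s assume d: "d \<in> D" "d \<in> T" and s: "s \<in> T - D"
    show "{d, s} \<notin> collapse E Z"
    proof
      assume "{d, s} \<in> collapse E Z"
      then consider "{d, s} \<in> E" | "d \<in> nb E Z" "s \<in> nb E Z" "d \<noteq> s" unfolding collapse_iff by blast
      then show False
      proof cases
        case 1 then show False using no[of d s] d s by blast
      next
        case 2 then show False using assms(2)[of d s] d s by blast
      qed
    qed
  qed
  then show False using D by blast
qed

text \<open>The counterpart of cutting a path from \<open>x\<close> at its first vertex in
  \<open>K\<close>: the component of \<open>x\<close> in \<open>S - K\<close> together with one
  vertex \<open>k\<close> through which it is left.\<close>

lemma conn_split:
  assumes S: "conn F S" and x: "x \<in> S" and K: "S \<inter> K \<noteq> {}"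
  obtains D k where "D \<subseteq> S" "conn F D" "x \<in> D" "D \<inter> K = {k}" "x \<in> K \<Longrightarrow> k = x"
proof (cases "x \<in> K")
  case True
  then show ?thesis using that[of "{x}" x] x by auto
next
  case False
  then obtain D where D: "D \<subseteq> S - K" "x \<in> D" "conn F D" "\<And>d s. d \<in> D \<Longrightarrow> s \<in> S - K - D \<Longrightarrow> {d, s} \<notin> F"
    using conn_reach[of x "S - K" F] x by blast
  have "\<not> S \<subseteq> D" using D K by blast
  then obtain d k where dk: "d \<in> D" "k \<in> S - D" "{d, k} \<in> F"
    using connD[OF S, of D] D x by blast
  then have "k \<in> K" using D by blast
  show ?thesis
  proof (rule that[of "insert k D" k])
    show "conn F (insert k D)" using conn_insert[OF D(3) dk(1) dk(3)] .
    show "insert k D \<inter> K = {k}" using D(1) \<open>k \<in> K\<close> by blast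
  qed (use D dk False in auto)
qed

lemma good_core:
  assumes "good h E A B Z"
  obtains D where "D \<subseteq> Z" "D \<noteq> {}" "conn E D" "nb E Z \<subseteq> nb E D"
  using conjunct1[OF assms[unfolded good_def]] by blast

lemma goodD:
  assumes "good h E A B Z" "x \<in> nb E Z" "y \<in> nb E Z" "x \<noteq> y" "W \<subseteq> nb E Z - {x, y}" "card W \<le> h - 2"
    "A \<inter> nb E Z \<subseteq> W" "B \<inter> nb E Z \<subseteq> {x, y}"
  shows "feas E (Z \<union> nb E Z) W x y"
  using conjunct2[OF assms(1)[unfolded good_def]] assms(2-) by blast

text \<open>If \<open>S\<close> can do without \<open>Z\<close>, the clique edges of
  \<open>T\<close> are rerouted through the connected core of \<open>Z\<close>. Otherwise
  \<open>S\<close> needs \<open>Z\<close> only once, between first contacts \<open>k1\<close> and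
  \<open>k2\<close> with \<open>nb E Z\<close>. Goodness then joins these two and gathers all other
  vertices of \<open>nb E Z\<close> disjointly; they number at most \<open>h - 2\<close> because
  \<open>nb E Z\<close> has at most \<open>h\<close> vertices.\<close>

lemma feas_uncollapse:
  assumes g: "graph E" and gd: "good h E A B Z" and h: "card (nb E Z) \<le> h"
    and f: "feas (collapse E Z) V W x y" and V: "V \<inter> Z = {}" "nb E Z \<subseteq> V"
    and A: "A \<inter> nb E Z \<subseteq> W" and B: "B \<inter> nb E Z \<subseteq> {x, y}"
  shows "feas E (V \<union> Z) W x y"
proof -
  let ?K = "nb E Z"
  obtain S T where ST: "S \<subseteq> V" "T \<subseteq> V" "S \<inter> T = {}" "conn (collapse E Z) S" "conn (collapse E Z) T" "x \<in> S" "y \<in> S" "W \<subseteq> T"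
    using f by (rule feasE)
  obtain Q where Q: "Q \<subseteq> Z" "Q \<noteq> {}" "conn E Q" "?K \<subseteq> nb E Q" using gd by (rule good_core)
  define T1 where "T1 = (if T \<inter> ?K = {} then T else T \<union> (Q \<union> (T \<inter> ?K)))"
  have T1c: "conn E T1"
  proof (cases "T \<inter> ?K = {}")
    case True
    then show ?thesis unfolding T1_def using conn_collapse_free[OF ST(5)] by auto
  next
    case False
    have "conn E (Q \<union> (T \<inter> ?K))" by (rule conn_attach[OF Q(3,2)]) (use Q(4) in blast)
    then show ?thesis unfolding T1_def using conn_collapse[OF ST(5)] False by auto
  qed
  have T1s: "T1 \<subseteq> V \<union> Z" "T \<subseteq> T1" "T1 \<inter> S = {}" using ST(1,2,3) V Q(1) unfolding T1_def by auto
  show ?thesis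
  proof (cases "S \<inter> ?K = {}")
    case True
    then have "conn E S" using conn_collapse_free[OF ST(4)] by auto
    then show ?thesis using T1c T1s ST by (intro feasI[of S _ T1]) auto
  next
    case False
    obtain D1 k1 where D1: "D1 \<subseteq> S" "conn (collapse E Z) D1" "x \<in> D1" "D1 \<inter> ?K = {k1}" "x \<in> ?K \<Longrightarrow> k1 = x"
      using conn_split[OF ST(4,6) False] by metis
    obtain D2 k2 where D2: "D2 \<subseteq> S" "conn (collapse E Z) D2" "y \<in> D2" "D2 \<inter> ?K = {k2}" "y \<in> ?K \<Longrightarrow> k2 = y"
      using conn_split[OF ST(4,7) False] by metis
    have "\<And>p. p \<in> D1 \<Longrightarrow> p \<in> ?K \<Longrightarrow> p = k1" "\<And>p. p \<in> D2 \<Longrightarrow> p \<in> ?K \<Longrightarrow> p = k2"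
      using D1(4) D2(4) by blast+
    then have c1: "conn E D1" and c2: "conn E D2"
      using conn_collapse_free[OF D1(2)] conn_collapse_free[OF D2(2)] by metis+
    show ?thesis
    proof (cases "D1 \<inter> D2 = {}")
      case False
      \<comment> \<open>The pieces already join \<open>x\<close> to \<open>y\<close> outside
        \<open>Z\<close>, so the core of \<open>Z\<close> remains free for
        \<open>T1\<close>.\<close>
      have "conn E (D1 \<union> D2)" by (rule conn_Un[OF c1 c2 False])
      then show ?thesis using T1c T1s ST D1 D2 by (intro feasI[of "D1 \<union> D2" _ T1]) auto
    next
      case True
      have k: "k1 \<in> ?K" "k2 \<in> ?K" "k1 \<in> D1" "k2 \<in> D2" using D1 D2 by blast+
      then have kn: "k1 \<noteq> k2" using True by blast
      have AK: "A \<inter> ?K \<subseteq> ?K - {k1, k2}"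
        using A ST k D1(1) D2(1) by blast
      have f0: "feas E (Z \<union> ?K) (?K - {k1, k2}) k1 k2"
      proof (rule goodD[OF gd k(1,2) kn])
        have "card (?K - {k1, k2}) = card ?K - 2" using k kn finite_nb[OF g] by (simp add: card_Diff_subset)
        then show "card (?K - {k1, k2}) \<le> h - 2" using h by simp
        \<comment> \<open>A root of \<open>B\<close> in \<open>nb E Z\<close> is \<open>x\<close> or
          \<open>y\<close>, and is then its own first contact.\<close>
        show "B \<inter> ?K \<subseteq> {k1, k2}" using B D1(5) D2(5) by blast
      qed (use AK in auto)
      obtain S0 T0 where 0: "S0 \<subseteq> Z \<union> ?K" "T0 \<subseteq> Z \<union> ?K" "S0 \<inter> T0 = {}" "conn E S0" "conn E T0" "k1 \<in> S0" "k2 \<in> S0" "?K - {k1, k2} \<subseteq> T0"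
        by (rule feasE[OF f0])
      define T2 where "T2 = (if T \<inter> ?K = {} then T else T \<union> T0)"
      have "conn E T2"
      proof (cases "T \<inter> ?K = {}")
        case True
        then show ?thesis unfolding T2_def using conn_collapse_free[OF ST(5)] by auto
      next
        case False
        have "T \<inter> ?K \<subseteq> T0" using 0(8) k ST(3) D1(1) D2(1) by blast
        then show ?thesis unfolding T2_def using conn_collapse[OF ST(5) 0(5)] False by auto
      qed
      moreover have "conn E (D1 \<union> S0 \<union> D2)"
        by (intro conn_Un c1 c2 0(4)) (use k 0 in blast)+
      moreover have "(D1 \<union> S0 \<union> D2) \<inter> T2 = {}"
      proof -
        have a: "S0 \<inter> ?K \<subseteq> {k1, k2}" using 0 by blast
        have "D1 \<inter> Z = {}" "D2 \<inter> Z = {}" using D1(1) D2(1) ST(1) V(1) by blast+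
        then have "(D1 \<union> D2) \<inter> (Z \<union> ?K) \<subseteq> {k1, k2}" using D1(4) D2(4) by auto
        then have "(D1 \<union> D2) \<inter> T0 = {}" using 0 by blast
        moreover have "T \<inter> Z = {}" "k1 \<notin> T" "k2 \<notin> T" using ST(2,3) V(1) k(3,4) D1(1) D2(1) by blast+
        then have "S0 \<inter> T = {}" using a 0(1) by blast
        moreover have "(D1 \<union> D2) \<inter> T = {}" using D1 D2 ST by blast
        ultimately show ?thesis unfolding T2_def using 0(3) by auto
      qed
      moreover have "D1 \<union> S0 \<union> D2 \<subseteq> V \<union> Z" "T2 \<subseteq> V \<union> Z" "W \<subseteq> T2"
        using D1(1) D2(1) 0(1,2) ST V unfolding T2_def by auto
      ultimately show ?thesis using D1(3) D2(3) by (intro feasI[of "D1 \<union> S0 \<union> D2" _ T2]) auto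
    qed
  qed
qed

section \<open>Disjoint linkages\<close>

text \<open>Disjoint paths from \<open>nb E Y\<close> to \<open>nb E Z\<close>, kept as connected
  sets. Each meets \<open>nb E Z\<close> in its end \<open>c r\<close> only, so sets found inside
  \<open>Z \<union> nb E Z\<close> touch the paths nowhere but at their ends.\<close>

definition linkage :: "'a set set \<Rightarrow> 'a set \<Rightarrow> 'a set \<Rightarrow> ('a \<Rightarrow> 'a set) \<Rightarrow> ('a \<Rightarrow> 'a) \<Rightarrow> bool" where
  "linkage E Z Y C c \<longleftrightarrow>
     (\<forall>r\<in>nb E Y. r \<in> C r \<and> conn E (C r) \<and> C r \<subseteq> (Y \<union> nb E Y) - Z \<and> C r \<inter> nb E Z = {c r}) \<and>
     (\<forall>r\<in>nb E Y. \<forall>r'\<in>nb E Y. r \<noteq> r' \<longrightarrow> C r \<inter> C r' = {})"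

lemma nb_between: "Z \<subseteq> Y \<Longrightarrow> nb E Z \<subseteq> Y \<union> nb E Y"
  unfolding nb_def by blast

text \<open>Menger's theorem, by induction on |Y - Z|. If a set strictly between \<open>Z\<close>
  and \<open>Y\<close> has no more neighbours than \<open>Y\<close>, linkages to and from its
  neighbourhood are composed. Otherwise an edge from some \<open>r\<close> in \<open>nb E Y\<close>,
  outside \<open>nb E Z\<close>, into \<open>Y\<close> is contracted: the sets strictly between have
  a neighbour to spare, and \<open>Z\<close> loses none because \<open>r\<close> is not its
  neighbour.\<close>

lemma menger_linkage:
  assumes "graph E" "finite Y" "Z \<subseteq> Y" "\<And>X. Z \<subseteq> X \<Longrightarrow> X \<subseteq> Y \<Longrightarrow> card (nb E Y) \<le> card (nb E X)"
  shows "\<exists>C c. linkage E Z Y C c"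
  using assms
proof (induction "card (Y - Z)" arbitrary: E Z Y rule: less_induct)
  case less
  note g = less.prems(1) and fY = less.prems(2) and ZY = less.prems(3) and min = less.prems(4)
  show ?case
  proof (cases "nb E Y \<subseteq> nb E Z")
    case True
    have "linkage E Z Y (\<lambda>r. {r}) (\<lambda>r. r)"
      unfolding linkage_def using True nb_disj[of E Y] ZY by auto
    then show ?thesis by blast
  next
    case False
    then obtain r where r: "r \<in> nb E Y" "r \<notin> nb E Z" by blast
    then obtain y where y: "y \<in> Y" "{y, r} \<in> E" "r \<notin> Y" unfolding in_nb by blast
    have ry: "r \<noteq> y" "{r, y} \<in> E" using y by (auto simp: insert_commute)
    have yZ: "y \<notin> Z" using r(2) y ZY unfolding in_nb by blast
    show ?thesis
    proof (cases "\<exists>X. Z \<subset> X \<and> X \<subset> Y \<and> card (nb E X) \<le> card (nb E Y)")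
      case True
      then obtain X where X: "Z \<subset> X" "X \<subset> Y" "card (nb E X) \<le> card (nb E Y)" by blast
      have fX: "finite X" using X(2) fY finite_subset by blast
      have "card (X - Z) < card (Y - Z)" using X fY by (intro psubset_card_mono) auto
      then have "\<exists>C c. linkage E Z X C c"
      proof (rule less.hyps[OF _ g fX])
        show "Z \<subseteq> X" using X(1) by blast
        fix X' assume "Z \<subseteq> X'" "X' \<subseteq> X"
        then have "card (nb E Y) \<le> card (nb E X')" using min[of X'] X(2) by blast
        then show "card (nb E X) \<le> card (nb E X')" using X(3) by simp
      qed
      then obtain C2 c2 where l2: "linkage E Z X C2 c2" by blast
      have "card (Y - X) < card (Y - Z)" using X fY by (intro psubset_card_mono) auto
      then obtain C1 c1 where l1: "linkage E X Y C1 c1"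
        using less.hyps[of Y X E] g fY X min by fastforce
      let ?C = "\<lambda>r. C1 r \<union> C2 (c1 r)"
      have L1: "r \<in> C1 r" "conn E (C1 r)" "C1 r \<subseteq> (Y \<union> nb E Y) - X" "C1 r \<inter> nb E X = {c1 r}" if "r \<in> nb E Y" for r
        using l1 that unfolding linkage_def by auto
      have L2: "r \<in> C2 r" "conn E (C2 r)" "C2 r \<subseteq> (X \<union> nb E X) - Z" "C2 r \<inter> nb E Z = {c2 r}" if "r \<in> nb E X" for r
        using l2 that unfolding linkage_def by auto
      have d1: "C1 r \<inter> C1 r' = {}" if "r \<in> nb E Y" "r' \<in> nb E Y" "r \<noteq> r'" for r r'
        using l1 that unfolding linkage_def by blast
      have d2: "C2 r \<inter> C2 r' = {}" if "r \<in> nb E X" "r' \<in> nb E X" "r \<noteq> r'" for r r'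
        using l2 that unfolding linkage_def by blast
      have c1X: "c1 r \<in> nb E X" "c1 r \<in> C1 r" if "r \<in> nb E Y" for r using L1(4)[OF that] by auto
      have only2: "C2 q \<inter> nb E X = {q}" if "q \<in> nb E X" for q
        using d2[OF that] L2(1) that by blast
      have ZX: "nb E Z \<subseteq> X \<union> nb E X" using nb_between[of Z X E] X(1) by blast
      have "linkage E Z Y ?C (\<lambda>r. c2 (c1 r))"
        unfolding linkage_def
      proof (intro conjI ballI impI)
        fix r assume r: "r \<in> nb E Y"
        note c = c1X[OF r]
        show "r \<in> ?C r" using L1(1)[OF r] by blast
        show "conn E (?C r)" using conn_Un[OF L1(2)[OF r] L2(2)[OF c(1)]] c L2(1)[OF c(1)] by blast
        have "nb E X \<subseteq> Y \<union> nb E Y" using nb_between[of X Y E] X by blast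
        then show "?C r \<subseteq> (Y \<union> nb E Y) - Z" using L1(3)[OF r] L2(3)[OF c(1)] X by blast
        have "C1 r \<inter> nb E Z \<subseteq> {c1 r}" using L1(3,4)[OF r] ZX by blast
        then have "C1 r \<inter> nb E Z \<subseteq> C2 (c1 r) \<inter> nb E Z" using L2(1)[OF c(1)] by blast
        then show "?C r \<inter> nb E Z = {c2 (c1 r)}" using L2(4)[OF c(1)] by blast
      next
        fix r r' assume r: "r \<in> nb E Y" "r' \<in> nb E Y" "r \<noteq> r'"
        have ne: "c1 r \<noteq> c1 r'" using d1[OF r] c1X(2)[OF r(1)] c1X(2)[OF r(2)] by auto
        have x: "C1 p \<inter> C2 (c1 q) = {}" if "p \<in> nb E Y" "q \<in> nb E Y" "p \<noteq> q" for p q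
        proof -
          have "C1 p \<inter> C2 (c1 q) \<subseteq> C1 p \<inter> {c1 q}"
            using L1(3)[OF that(1)] L2(3)[OF c1X(1)[OF that(2)]] only2[OF c1X(1)[OF that(2)]] by blast
          then show ?thesis using d1[OF that] c1X(2)[OF that(2)] by blast
        qed
        show "?C r \<inter> ?C r' = {}"
          using d1[OF r] d2[OF c1X(1)[OF r(1)] c1X(1)[OF r(2)] ne] x[OF r] x[OF r(2,1) r(3)[symmetric]] by blast
      qed
      then show ?thesis by blast
    next
      case False
      let ?F = "contract E r y" and ?Y = "Y - {y}"
      have gF: "graph ?F" by (rule graph_contract[OF g ry(1)])
      have card_le: "card (nb E Y) \<le> card (nb ?F W)" if W: "Z \<subseteq> W" "W \<subseteq> ?Y" for W
      proof -
        have rW: "r \<notin> W" "y \<notin> W" using W y by blast+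
        show ?thesis
        proof (cases "W = Z")
          case True
          then have "card (nb E W) = card (nb ?F W)" using card_nb_contract_le(2)[OF g ry(1) rW] r(2) by blast
          moreover have "card (nb E Y) \<le> card (nb E W)" using min W by blast
          ultimately show ?thesis by simp
        next
          case WZ: False
          have "Z \<subset> W" "W \<subset> Y" using W WZ y(1) by blast+
          then have "card (nb E Y) < card (nb E W)" using False by (meson not_le)
          then show ?thesis using card_nb_contract_le(1)[OF g ry(1) rW] by simp
        qed
      qed
      have sub: "nb ?F ?Y \<subseteq> nb E Y"
      proof -
        have "r \<notin> ?Y" "y \<notin> ?Y" using y by auto
        from nb_contract[OF g ry(1) this] have "nb ?F ?Y \<subseteq> nb E ?Y - {y} \<union> {r}" by auto
        moreover have "nb E ?Y - {y} \<subseteq> nb E Y" unfolding nb_def by blast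
        ultimately show ?thesis using r(1) by blast
      qed
      have ZY': "Z \<subseteq> ?Y" using ZY yZ by blast
      have eq: "nb ?F ?Y = nb E Y"
        using card_le[OF ZY'] sub finite_nb[OF g] by (metis card_seteq order_refl)
      have "card (?Y - Z) < card (Y - Z)" using y(1) yZ fY by (intro psubset_card_mono) auto
      then obtain C c where l: "linkage ?F Z ?Y C c"
        using less.hyps[of ?Y Z ?F] gF fY ZY' card_le eq by fastforce
      have L: "q \<in> C q" "conn ?F (C q)" "C q \<subseteq> (?Y \<union> nb E Y) - Z" "C q \<inter> nb ?F Z = {c q}" if "q \<in> nb E Y" for q
        using l that unfolding linkage_def eq by auto
      have d: "C q \<inter> C q' = {}" if "q \<in> nb E Y" "q' \<in> nb E Y" "q \<noteq> q'" for q q'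
        using l that unfolding linkage_def eq by blast
      have yC: "y \<notin> C q" if "q \<in> nb E Y" for q using L(3)[OF that] y(1) nb_disj[of E Y] by blast
      have rC: "r \<in> C q \<longleftrightarrow> q = r" if "q \<in> nb E Y" for q using L(1)[OF r(1)] L(1)[OF that] d[OF that r(1)] by blast
      let ?C = "\<lambda>q. if q = r then insert y (C q) else C q"
      have nZ: "nb ?F Z = nb E Z - {y} \<union> (if y \<in> nb E Z then {r} else {})"
      proof -
        have "r \<notin> Z" "y \<notin> Z" using y ZY yZ by auto
        then show ?thesis by (rule nb_contract[OF g ry(1)])
      qed
      \<comment> \<open>Undoing the contraction puts \<open>y\<close> into the path at
        \<open>r\<close>. If \<open>y\<close> is in \<open>nb E Z\<close>, then \<open>r\<close> was
        an end only on behalf of \<open>y\<close>, and \<open>y\<close> takes its place.\<close>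
      have "linkage E Z Y ?C (\<lambda>q. if q = r \<and> y \<in> nb E Z then y else c q)"
        unfolding linkage_def
      proof (intro conjI ballI impI)
        fix q assume q: "q \<in> nb E Y"
        show "q \<in> ?C q" using L(1)[OF q] by (cases "q = r") simp_all
        show "conn E (?C q)" using conn_contract[OF g ry L(2)[OF q] yC[OF q]] rC[OF q] by simp
        show "?C q \<subseteq> (Y \<union> nb E Y) - Z" using L(3)[OF q] y(1) yZ by auto
        show "?C q \<inter> nb E Z = {if q = r \<and> y \<in> nb E Z then y else c q}"
        proof (cases "q = r")
          case True
          show ?thesis
          proof (cases "y \<in> nb E Z")
            case yn: True
            then have "r \<in> nb ?F Z" using nZ by simp
            then have "r \<in> C r \<inter> nb ?F Z" using L(1)[OF r(1)] by blast
            then have "C r \<inter> nb ?F Z = {r}" unfolding L(4)[OF r(1)] by simp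
            then have "C r \<inter> (nb E Z - {y}) \<subseteq> {r}" using nZ by auto
            then have "C r \<inter> nb E Z = {}" using r(2) yC[OF r(1)] by blast
            then show ?thesis using True yn by auto
          next
            case False
            then have "nb ?F Z = nb E Z" using nZ by simp
            then show ?thesis using True False L(4)[OF q] by auto
          qed
        next
          case False
          then have "C q \<inter> nb ?F Z = C q \<inter> nb E Z" using nZ rC[OF q] yC[OF q] by auto
          then show ?thesis using False L(4)[OF q] by simp
        qed
      next
        fix q q' assume q: "q \<in> nb E Y" "q' \<in> nb E Y" "q \<noteq> q'"
        show "?C q \<inter> ?C q' = {}" using d[OF q] yC[OF q(1)] yC[OF q(2)] q(3) by auto
      qed
      then show ?thesis by blast
    qed
  qed
qed

text \<open>\<open>x\<close>, \<open>y\<close> and the members of \<open>W\<close> are followed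
  along their own paths to \<open>nb E Z\<close>, where goodness takes over. However large
  \<open>nb E Z\<close> is, only card W + 2 of its vertices matter, which is why \<open>good\<close>
  bounds the set to be gathered. A vertex of \<open>nb E Z\<close> outside \<open>Y\<close> is the
  end of its own path, so the constraints from \<open>A\<close> and \<open>B\<close> carry over to
  the ends.\<close>

lemma linkage_feas:
  assumes g: "graph E" and gd: "good h E A B Z" and ZY: "Z \<subseteq> Y" and l: "linkage E Z Y C c"
    and x: "x \<in> nb E Y" "y \<in> nb E Y" "x \<noteq> y" and W: "W \<subseteq> nb E Y - {x, y}" "card W \<le> h - 2"
    and A: "A \<inter> nb E Y \<subseteq> W" and B: "B \<inter> nb E Y \<subseteq> {x, y}" and AB: "A \<inter> Y = {}" "B \<inter> Y = {}"
  shows "feas E (Y \<union> nb E Y) W x y"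
proof -
  have L: "r \<in> C r" "conn E (C r)" "C r \<subseteq> (Y \<union> nb E Y) - Z" "C r \<inter> nb E Z = {c r}" if "r \<in> nb E Y" for r
    using l that unfolding linkage_def by auto
  have d: "C r \<inter> C r' = {}" if "r \<in> nb E Y" "r' \<in> nb E Y" "r \<noteq> r'" for r r'
    using l that unfolding linkage_def by blast
  have cZ: "c r \<in> nb E Z" "c r \<in> C r" if "r \<in> nb E Y" for r using L(4)[OF that] by auto
  have inj: "c r \<noteq> c r'" if "r \<in> nb E Y" "r' \<in> nb E Y" "r \<noteq> r'" for r r'
    using d[OF that] cZ[OF that(1)] cZ[OF that(2)] by auto
  have root: "r \<in> nb E Y \<and> c r = r" if "r \<in> nb E Z" "r \<notin> Y" for r
  proof -
    have "r \<in> nb E Y" using nb_between[OF ZY] that by blast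
    then have "r \<in> C r \<inter> nb E Z" "C r \<inter> nb E Z = {c r}" using L(1,4) that(1) by auto
    then show ?thesis using \<open>r \<in> nb E Y\<close> by simp
  qed
  have f: "feas E (Z \<union> nb E Z) (c ` W) (c x) (c y)"
  proof (rule goodD[OF gd cZ(1)[OF x(1)] cZ(1)[OF x(2)] inj[OF x]])
    have *: "w \<in> nb E Y" "w \<noteq> x" "w \<noteq> y" if "w \<in> W" for w using W(1) that by auto
    show "c ` W \<subseteq> nb E Z - {c x, c y}"
    proof
      fix k assume "k \<in> c ` W"
      then obtain w where w: "w \<in> W" "k = c w" by blast
      show "k \<in> nb E Z - {c x, c y}"
        using cZ(1)[OF *(1)[OF w(1)]] inj[OF *(1)[OF w(1)] x(1) *(2)[OF w(1)]] inj[OF *(1)[OF w(1)] x(2) *(3)[OF w(1)]] w(2) by simp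
    qed
    have "finite W" using W(1) finite_nb[OF g, of Y] finite_subset by blast
    then show "card (c ` W) \<le> h - 2" using card_image_le[of W c] W(2) by linarith
    show "A \<inter> nb E Z \<subseteq> c ` W"
    proof
      fix a assume a: "a \<in> A \<inter> nb E Z"
      then have "a \<in> nb E Y" "c a = a" using root[of a] AB by auto
      then show "a \<in> c ` W" using A a by (metis IntD1 IntI imageI subsetD)
    qed
    show "B \<inter> nb E Z \<subseteq> {c x, c y}"
    proof
      fix b assume b: "b \<in> B \<inter> nb E Z"
      then have "b \<in> nb E Y" "c b = b" using root[of b] AB by auto
      then show "b \<in> {c x, c y}" using B b by auto
    qed
  qed
  obtain S0 T0 where 0: "S0 \<subseteq> Z \<union> nb E Z" "T0 \<subseteq> Z \<union> nb E Z" "S0 \<inter> T0 = {}" "conn E S0" "conn E T0" "c x \<in> S0" "c y \<in> S0" "c ` W \<subseteq> T0"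
    by (rule feasE[OF f])
  let ?S = "C x \<union> S0 \<union> C y" and ?T = "T0 \<union> \<Union>(C ` W)"
  have WY: "w \<in> nb E Y" "w \<noteq> x" "w \<noteq> y" if "w \<in> W" for w using W(1) that by auto
  have 1: "C r \<inter> (Z \<union> nb E Z) = {c r}" if "r \<in> nb E Y" for r using L(3,4)[OF that] by blast
  have cS: "conn E ?S" by (intro conn_Un 0(4) L(2) x(1,2)) (use cZ[OF x(1)] cZ[OF x(2)] 0 in blast)+
  have cT: "conn E ?T"
  proof (rule conn_Union[OF _ _ 0(5)])
    fix X assume "X \<in> C ` W"
    then obtain w where w: "w \<in> W" "X = C w" by blast
    show "conn E X" using L(2)[OF WY(1)[OF w(1)]] w(2) by simp
    have "c w \<in> X \<inter> T0" using cZ(2)[OF WY(1)[OF w(1)]] w 0(8) by blast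
    then show "X \<inter> T0 \<noteq> {}" by blast
  qed
  have disj: "?S \<inter> ?T = {}"
  proof -
    have "C r \<inter> T0 \<subseteq> {c r}" if "r \<in> nb E Y" for r using 1[OF that] 0(2) by blast
    then have "C x \<inter> T0 = {}" "C y \<inter> T0 = {}" using x(1,2) 0(3,6,7) by blast+
    moreover have "C w \<inter> S0 = {}" if "w \<in> W" for w
    proof -
      have "C w \<inter> S0 \<subseteq> {c w}" using 1[OF WY(1)[OF that]] 0(1) by blast
      then show ?thesis using 0(3,8) that by blast
    qed
    moreover have "C x \<inter> C w = {}" "C y \<inter> C w = {}" if "w \<in> W" for w
      using d[OF x(1) WY(1)[OF that]] d[OF x(2) WY(1)[OF that]] WY(2,3)[OF that] by auto
    ultimately show ?thesis using 0(3) by blast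
  qed
  have "Z \<union> nb E Z \<subseteq> Y \<union> nb E Y" using nb_between[OF ZY] ZY by blast
  moreover have "C r \<subseteq> Y \<union> nb E Y" if "r \<in> nb E Y" for r using L(3)[OF that] by blast
  ultimately have "?S \<subseteq> Y \<union> nb E Y" "?T \<subseteq> Y \<union> nb E Y" using 0(1,2) x(1,2) WY(1) by blast+
  then show ?thesis
    using cS cT disj L(1)[OF x(1)] L(1)[OF x(2)] L(1)[OF WY(1)] by (intro feasI[of ?S _ ?T]) auto
qed

section \<open>Minimal counterexamples\<close>

definition rooted :: "'a set set \<Rightarrow> 'a set \<Rightarrow> 'a set \<Rightarrow> 'a \<Rightarrow> 'a \<Rightarrow> nat \<Rightarrow> bool" where
  "rooted E U R b1 b2 h \<longleftrightarrow> graph E \<and> finite U \<and> finite R \<and> U \<inter> R = {} \<and> nb E U \<subseteq> R \<and> card R = h \<and>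
     b1 \<in> R \<and> b2 \<in> R \<and> b1 \<noteq> b2"

definition sparse :: "'a set set \<Rightarrow> 'a set \<Rightarrow> nat \<Rightarrow> nat \<Rightarrow> bool" where
  "sparse E U h \<alpha> \<longleftrightarrow> (\<forall>Y. Y \<subseteq> U \<longrightarrow> Y \<noteq> {} \<longrightarrow> card (nb E Y) < h \<longrightarrow> rho E Y \<le> \<alpha> * card Y)"

text \<open>
  At the extremal value \<open>h = \<alpha> + 1\<close> a surplus of one edge is not enough. The last alternative makes
  the induction work for \<open>Y \<subset> U\<close> with adjacent \<open>s, t \<in> N(Y)\<close> and a surplus beyond the common neighbours of
  \<open>s\<close> and \<open>t\<close>: if \<open>s\<close> and \<open>t\<close> go to different sides, it holds for \<open>Y\<close>; if not, they can be merged,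
  which loses one edge per common neighbour.
\<close>

definition dense :: "'a set set \<Rightarrow> 'a set \<Rightarrow> 'a set \<Rightarrow> 'a \<Rightarrow> 'a \<Rightarrow> nat \<Rightarrow> nat \<Rightarrow> bool" where
  "dense E U R b1 b2 h \<alpha> \<longleftrightarrow> h \<le> \<alpha> \<and> \<alpha> * card U + 1 \<le> rho E U \<or>
     h = \<alpha> + 1 \<and> (\<alpha> * card U + 2 \<le> rho E U \<or>
       (\<exists>a\<in>R - {b1, b2}. \<exists>b\<in>{b1, b2}. \<alpha> * card U + 1 + card (U \<inter> common E a b) \<le> rho E U))"

definition linked :: "'a set set \<Rightarrow> 'a set \<Rightarrow> 'a set \<Rightarrow> 'a \<Rightarrow> 'a \<Rightarrow> bool" where
  "linked E U R b1 b2 \<longleftrightarrow> feas E (U \<union> R) (R - {b1, b2}) b1 b2"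

lemma sparseD: "sparse E U h \<alpha> \<Longrightarrow> Y \<subseteq> U \<Longrightarrow> Y \<noteq> {} \<Longrightarrow> card (nb E Y) < h \<Longrightarrow> rho E Y \<le> \<alpha> * card Y"
  unfolding sparse_def by blast

lemma sparse_subset: "sparse E U h \<alpha> \<Longrightarrow> Y \<subseteq> U \<Longrightarrow> sparse E Y h \<alpha>"
  unfolding sparse_def by blast

lemma dense_le: "dense E U R b1 b2 h \<alpha> \<Longrightarrow> h \<le> \<alpha> + 1 \<and> \<alpha> * card U + 1 \<le> rho E U"
  unfolding dense_def by auto

text \<open>\<open>rho\<close> is subadditive and the cardinalities are additive, so when a set
  splits into two parts without edges between them, one part keeps the surplus. Hence a smallest
  union of components with surplus is connected, and sparsity denies it fewer than \<open>h\<close>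
  neighbours. \<open>J\<close> is a set of common neighbours in the strengthened surplus, or empty
  in the plain one.\<close>

lemma conn_dense_part:
  assumes g: "graph E" and fY: "finite Y" and r: "\<alpha> * card Y + 1 + card (Y \<inter> J) \<le> rho E Y"
    and sp: "sparse E Y h \<alpha>" and h: "card (nb E Y) \<le> h"
  shows "\<exists>D. D \<subseteq> Y \<and> D \<noteq> {} \<and> conn E D \<and> nb E D = nb E Y \<and> \<alpha> * card D + 1 + card (D \<inter> J) \<le> rho E D"
proof -
  let ?P = "\<lambda>D. D \<subseteq> Y \<and> (\<forall>d\<in>D. \<forall>y\<in>Y - D. {d, y} \<notin> E) \<and> \<alpha> * card D + 1 + card (D \<inter> J) \<le> rho E D"
  have "?P Y" using r by auto
  obtain D where D: "?P D" and min: "\<And>D'. ?P D' \<Longrightarrow> card D \<le> card D'"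
    by (rule least_obtain[of ?P Y card, OF \<open>?P Y\<close>]) (rule that)
  have fD: "finite D" using D fY finite_subset by blast
  have ne: "D \<noteq> {}"
  proof
    assume "D = {}" then show False using D by simp
  qed
  have "conn E D"
  proof (rule connI)
    fix D1 assume D1: "D1 \<subseteq> D" "D1 \<noteq> {}" "D1 \<noteq> D" and no: "\<And>d s. d \<in> D1 \<Longrightarrow> s \<in> D - D1 \<Longrightarrow> {d, s} \<notin> E"
    let ?D2 = "D - D1"
    have un: "D = D1 \<union> ?D2" "D1 \<inter> ?D2 = {}" using D1 by blast+
    have f: "finite D1" "finite ?D2" using fD D1 finite_subset by auto
    have c: "card D = card D1 + card ?D2" using card_Un_disjoint[OF f un(2)] un(1) by simp
    have "(D1 \<inter> J) \<inter> (?D2 \<inter> J) = {}" by blast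
    then have "card ((D1 \<inter> J) \<union> (?D2 \<inter> J)) = card (D1 \<inter> J) + card (?D2 \<inter> J)" using f by (intro card_Un_disjoint) auto
    moreover have "(D1 \<inter> J) \<union> (?D2 \<inter> J) = D \<inter> J" using un(1) by blast
    ultimately have card_J: "card (D \<inter> J) = card (D1 \<inter> J) + card (?D2 \<inter> J)" by simp
    have "rho E D \<le> rho E D1 + rho E ?D2" using rho_Un_le[OF g, of D1 ?D2] un(1) by simp
    then have "\<alpha> * card D1 + 1 + card (D1 \<inter> J) \<le> rho E D1 \<or> \<alpha> * card ?D2 + 1 + card (?D2 \<inter> J) \<le> rho E ?D2"
      using D c card_J by (auto simp: algebra_simps)
    then show False
    proof
      assume a: "\<alpha> * card D1 + 1 + card (D1 \<inter> J) \<le> rho E D1"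
      have "\<forall>d\<in>D1. \<forall>y\<in>Y - D1. {d, y} \<notin> E" using no D D1(1) by blast
      then have "?P D1" using a D D1(1) by blast
      then have "card D \<le> card D1" by (rule min)
      then show False using c D1 f by auto
    next
      assume a: "\<alpha> * card ?D2 + 1 + card (?D2 \<inter> J) \<le> rho E ?D2"
      have "{d, y} \<notin> E" if "d \<in> ?D2" "y \<in> Y - ?D2" for d y
      proof (cases "y \<in> D1")
        case True then show ?thesis using no[of y d] that by (simp add: insert_commute)
      next
        case False then show ?thesis using D that by blast
      qed
      then have "?P ?D2" using a D by blast
      then have "card D \<le> card ?D2" by (rule min)
      moreover have "card D1 \<noteq> 0" using D1(2) f by simp
      ultimately show False using c by linarith
    qed
  qed
  moreover have "nb E D = nb E Y"
  proof -
    have sub: "nb E D \<subseteq> nb E Y"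
    proof
      fix v assume "v \<in> nb E D"
      then obtain u where u: "v \<notin> D" "u \<in> D" "{u, v} \<in> E" unfolding in_nb by blast
      then have "v \<notin> Y" using D by blast
      then show "v \<in> nb E Y" using u D unfolding in_nb by blast
    qed
    have "\<not> card (nb E D) < h" using sparseD[OF sp, of D] D ne by auto
    then show ?thesis using card_seteq[OF finite_nb[OF g] sub] h by simp
  qed
  ultimately show ?thesis using D ne by blast
qed

lemma goodI:
  assumes D: "D \<subseteq> Y" "D \<noteq> {}" "conn E D" "nb E Y \<subseteq> nb E D"
    and f: "\<And>x y. x \<in> nb E Y \<Longrightarrow> y \<in> nb E Y \<Longrightarrow> x \<noteq> y \<Longrightarrow> feas E (Y \<union> nb E Y) (nb E Y - {x, y}) x y"
  shows "good k E A B Y"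
  unfolding good_def
proof (intro conjI allI impI)
  show "\<exists>D. D \<subseteq> Y \<and> D \<noteq> {} \<and> conn E D \<and> nb E Y \<subseteq> nb E D" using D by blast
  fix x y W assume "x \<in> nb E Y" "y \<in> nb E Y" "x \<noteq> y" "W \<subseteq> nb E Y - {x, y}"
  then show "feas E (Y \<union> nb E Y) W x y" using feas_mono[OF f order_refl _ order_refl] by simp
qed

lemma linked_nb: "linked E Y (nb E Y) x y \<longleftrightarrow> feas E (Y \<union> nb E Y) (nb E Y - {x, y}) x y"
  unfolding linked_def ..

lemma rooted_nb: "graph E \<Longrightarrow> finite Y \<Longrightarrow> x \<in> nb E Y \<Longrightarrow> y \<in> nb E Y \<Longrightarrow> x \<noteq> y \<Longrightarrow> rooted E Y (nb E Y) x y (card (nb E Y))"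
  unfolding rooted_def using finite_nb nb_disj[of E Y] by auto

text \<open>A violator with the fewest neighbours is sparse relative to its own neighbourhood, which
  has at most h - 1 \<le> \<alpha> vertices. There a surplus of one suffices for the induction
  hypothesis, which links every pair of neighbours against all the others; so \<open>k\<close>,
  \<open>A\<close> and \<open>B\<close> are arbitrary.\<close>

lemma good_violator:
  assumes IH: "\<And>E U R b1 b2 h. card (U :: 'a set) < n \<Longrightarrow> rooted E U R b1 b2 h \<Longrightarrow> sparse E U h \<alpha> \<Longrightarrow> dense E U R b1 b2 h \<alpha> \<Longrightarrow> linked E U R b1 b2"
    and g: "graph E" and U: "finite (U :: 'a set)"
    and small: "\<And>D. D \<subseteq> U \<Longrightarrow> D \<noteq> {} \<Longrightarrow> card (nb E D) < h \<Longrightarrow> \<alpha> * card D + 1 \<le> rho E D \<Longrightarrow> card D < n"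
    and ns: "\<not> sparse E U h \<alpha>" and h: "h \<le> \<alpha> + 1"
  obtains D where "D \<subseteq> U" "D \<noteq> {}" "conn E D" "card (nb E D) < h" "\<alpha> * card D + 1 \<le> rho E D" "good k E A B D"
proof -
  let ?P = "\<lambda>Y. Y \<subseteq> U \<and> Y \<noteq> {} \<and> card (nb E Y) < h \<and> \<alpha> * card Y + 1 \<le> rho E Y"
  obtain Y0 where Y0: "?P Y0" using ns unfolding sparse_def by (auto simp: not_le Suc_le_eq)
  obtain Y where Y: "?P Y" and min: "\<And>Y'. ?P Y' \<Longrightarrow> card (nb E Y) \<le> card (nb E Y')"
    by (rule least_obtain[of ?P Y0 "\<lambda>Y. card (nb E Y)", OF Y0]) (rule that)
  let ?h = "card (nb E Y)"
  have sp: "sparse E Y ?h \<alpha>"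
    unfolding sparse_def
  proof (intro allI impI, rule ccontr)
    fix X assume X: "X \<subseteq> Y" "X \<noteq> {}" "card (nb E X) < ?h" "\<not> rho E X \<le> \<alpha> * card X"
    then have "?P X" using Y by auto
    then have "?h \<le> card (nb E X)" by (rule min)
    then show False using X(3) by simp
  qed
  have fY: "finite Y" using Y U finite_subset by blast
  have "\<alpha> * card Y + 1 + card (Y \<inter> {}) \<le> rho E Y" using Y by simp
  from conn_dense_part[OF g fY this sp order_refl] obtain D where D: "D \<subseteq> Y" "D \<noteq> {}" "conn E D" "nb E D = nb E Y" "\<alpha> * card D + 1 \<le> rho E D"
    by auto
  have fD: "finite D" using D(1) fY finite_subset by blast
  have "D \<subseteq> U" using D(1) Y by blast
  then have "card D < n" using small[of D] D(2,4,5) Y by simp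
  have "good k E A B D"
  proof (rule goodI[OF order_refl D(2,3) order_refl])
    fix x y assume xy: "x \<in> nb E D" "y \<in> nb E D" "x \<noteq> y"
    have "dense E D (nb E D) x y ?h \<alpha>" unfolding dense_def using D(5) Y h by simp
    then have "linked E D (nb E D) x y"
      using IH[OF \<open>card D < n\<close>, of E "nb E D" x y ?h] rooted_nb[OF g fD xy] sparse_subset[OF sp D(1)] D(4) by simp
    then show "feas E (D \<union> nb E D) (nb E D - {x, y}) x y" by (simp add: linked_nb)
  qed
  moreover have "card (nb E D) < h" using D(4) Y by simp
  ultimately show ?thesis using that[of D] \<open>D \<subseteq> U\<close> D(2,3,5) by blast
qed

text \<open>The core of \<open>Z\<close> is extended along each path to just before its end in
  \<open>nb E Y\<close>.\<close>

lemma linkage_core: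
  assumes l: "linkage E Z Y C c" and ZY: "Z \<subseteq> Y" and D: "D \<subseteq> Z" "D \<noteq> {}" "conn E D" "nb E Z \<subseteq> nb E D"
  shows "\<exists>D. D \<subseteq> Y \<and> D \<noteq> {} \<and> conn E D \<and> nb E Y \<subseteq> nb E D"
proof -
  have L: "r \<in> C r" "conn E (C r)" "C r \<subseteq> (Y \<union> nb E Y) - Z" "C r \<inter> nb E Z = {c r}" if "r \<in> nb E Y" for r
    using l that unfolding linkage_def by auto
  have d: "C r \<inter> C r' = {}" if "r \<in> nb E Y" "r' \<in> nb E Y" "r \<noteq> r'" for r r'
    using l that unfolding linkage_def by blast
  have "\<exists>X. X \<subseteq> Y \<and> conn E X \<and> X \<inter> D \<noteq> {} \<and> (\<exists>u\<in>X. {u, r} \<in> E)" if r: "r \<in> nb E Y" for r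
  proof (cases "c r = r")
    case True
    have "c r \<in> nb E Z" using L(4)[OF r] by auto
    then have "r \<in> nb E D" using True D(4) by auto
    then obtain u where "u \<in> D" "{u, r} \<in> E" unfolding in_nb by blast
    then show ?thesis using D ZY by (intro exI[of _ D]) auto
  next
    case False
    have "c r \<in> C r \<inter> nb E Z" unfolding L(4)[OF r] by simp
    then have cr: "c r \<in> C r" "c r \<in> nb E D" using D(4) by auto
    \<comment> \<open>The part of the path reachable from \<open>c r\<close> without passing
      \<open>r\<close>. As the whole path is connected, this part contains a neighbour of
      \<open>r\<close>.\<close>
    obtain P where P: "P \<subseteq> C r - {r}" "c r \<in> P" "conn E P" "\<And>p s. p \<in> P \<Longrightarrow> s \<in> C r - {r} - P \<Longrightarrow> {p, s} \<notin> E"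
      using conn_reach[of "c r" "C r - {r}" E] cr(1) False by blast
    have "\<exists>u\<in>P. {u, r} \<in> E"
    proof (rule ccontr)
      assume n: "\<not> (\<exists>u\<in>P. {u, r} \<in> E)"
      have "C r \<subseteq> P" by (rule connD[OF L(2)[OF r]]) (use n P cr(1) in blast)+
      then show False using L(1)[OF r] P(1) by blast
    qed
    moreover have "P \<subseteq> Y"
    proof
      fix p assume p: "p \<in> P"
      then have "p \<in> Y \<union> nb E Y" using P(1) L(3)[OF r] by blast
      moreover have "p \<notin> nb E Y"
      proof
        assume q: "p \<in> nb E Y"
        have "p \<noteq> r" "p \<in> C r" using p P(1) by blast+
        then show False using d[OF q r] L(1)[OF q] by blast
      qed
      ultimately show "p \<in> Y" by blast
    qed
    moreover have "conn E (D \<union> P)"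
    proof -
      obtain u where "u \<in> D" "{u, c r} \<in> E" using cr(2) unfolding in_nb by blast
      then show ?thesis using conn_Un_edge[OF D(3) P(3) _ P(2)] by blast
    qed
    ultimately show ?thesis using D ZY by (intro exI[of _ "D \<union> P"]) auto
  qed
  then obtain X where X: "\<And>r. r \<in> nb E Y \<Longrightarrow> X r \<subseteq> Y \<and> conn E (X r) \<and> X r \<inter> D \<noteq> {} \<and> (\<exists>u\<in>X r. {u, r} \<in> E)"
    by metis
  let ?D = "D \<union> \<Union>(X ` nb E Y)"
  have "conn E ?D" by (rule conn_Union[OF _ _ D(3)]) (use X in auto)
  moreover have sub: "?D \<subseteq> Y" using X D ZY by blast
  moreover have "nb E Y \<subseteq> nb E ?D"
  proof
    fix r assume r: "r \<in> nb E Y"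
    then obtain u where u: "u \<in> X r" "{u, r} \<in> E" using X by blast
    then have "u \<in> ?D" using r by blast
    moreover have "r \<notin> ?D" using sub r nb_disj[of E Y] by blast
    ultimately show "r \<in> nb E ?D" unfolding in_nb using u(2) by (intro conjI bexI[of _ u])
  qed
  ultimately show ?thesis using D(2) by blast
qed

lemma rooted_collapse:
  assumes ins: "rooted E U R b1 b2 h" and "Z \<subseteq> U" shows "rooted (collapse E Z) (U - Z) R b1 b2 h"
proof -
  have g: "graph E" and nbU: "nb E U \<subseteq> R" using ins unfolding rooted_def by auto
  have "nb (collapse E Z) (U - Z) \<subseteq> R"
  proof
    fix v assume "v \<in> nb (collapse E Z) (U - Z)"
    then obtain u where u: "v \<notin> U - Z" "u \<in> U - Z" "{u, v} \<in> collapse E Z" unfolding in_nb by blast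
    from u(3) consider "{u, v} \<in> E" "v \<notin> Z" | "v \<in> nb E Z" unfolding collapse_iff by blast
    then have "v \<in> nb E U"
    proof cases
      case 1 then show ?thesis using u unfolding in_nb by blast
    next
      case 2 then show ?thesis using u assms(2) unfolding in_nb by blast
    qed
    then show "v \<in> R" using nbU by blast
  qed
  then show ?thesis using ins graph_collapse[OF g] unfolding rooted_def by auto
qed

lemma linked_collapse:
  assumes ins: "rooted E U R b1 b2 h" and Z: "Z \<subseteq> U" "card (nb E Z) \<le> h"
    and gd: "good h E (R - {b1, b2}) {b1, b2} Z" and l: "linked (collapse E Z) (U - Z) R b1 b2"
  shows "linked E U R b1 b2"
proof -
  have g: "graph E" and nbU: "nb E U \<subseteq> R" and UR: "U \<inter> R = {}" using ins unfolding rooted_def by auto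
  have f: "feas (collapse E Z) ((U - Z) \<union> R) (R - {b1, b2}) b1 b2" using l unfolding linked_def .
  have "feas E (((U - Z) \<union> R) \<union> Z) (R - {b1, b2}) b1 b2"
  proof (rule feas_uncollapse[OF g gd Z(2) f])
    show "((U - Z) \<union> R) \<inter> Z = {}" using UR Z(1) by blast
    show "nb E Z \<subseteq> (U - Z) \<union> R" using nb_between[of Z U E] nbU Z(1) nb_disj[of E Z] by blast
  qed auto
  moreover have "((U - Z) \<union> R) \<union> Z = U \<union> R" using Z(1) by blast
  ultimately show ?thesis unfolding linked_def by simp
qed

text \<open>Minimal in |U| only, but over all root sets and both parameters: merged roots and
  violators of sparsity change the number of roots, and \<open>reduce_dense\<close> changes
  \<alpha>.\<close>

locale critical =
  fixes E :: "'a set set" and U R :: "'a set" and b1 b2 :: 'a and h \<alpha> :: nat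
  assumes ins: "rooted E U R b1 b2 h" and spar: "sparse E U h \<alpha>" and cnd: "dense E U R b1 b2 h \<alpha>"
    and nolink: "\<not> linked E U R b1 b2"
    and IH: "\<And>E' U' R' c1 c2 k \<beta>. card (U' :: 'a set) < card U \<Longrightarrow> rooted E' U' R' c1 c2 k \<Longrightarrow> sparse E' U' k \<beta> \<Longrightarrow>
      dense E' U' R' c1 c2 k \<beta> \<Longrightarrow> linked E' U' R' c1 c2"
begin

abbreviation "A \<equiv> R - {b1, b2}"
abbreviation "B \<equiv> {b1, b2}"

lemma g: "graph E" and fU: "finite U" and fR: "finite R" and UR: "U \<inter> R = {}" and nbU: "nb E U \<subseteq> R"
  and cR: "card R = h" and b12: "b1 \<in> R" "b2 \<in> R" "b1 \<noteq> b2"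
  using ins unfolding rooted_def by auto

lemma h\<alpha>: "h \<le> \<alpha> + 1" and rhoU: "\<alpha> * card U + 1 \<le> rho E U"
  using dense_le[OF cnd] by auto

lemma U_nonempty: "U \<noteq> {}"
  using rhoU by auto

lemma nbU_eq: "nb E U = R"
proof -
  have "\<not> card (nb E U) < h" using sparseD[OF spar order_refl U_nonempty] rhoU by auto
  then show ?thesis using card_seteq[OF fR nbU] cR by simp
qed

lemma nolink': "\<not> feas E (U \<union> R) A b1 b2"
  using nolink unfolding linked_def .

lemma root_disj: "Y \<subseteq> U \<Longrightarrow> A \<inter> Y = {} \<and> B \<inter> Y = {}"
  using UR b12 by blast

lemma finite_sub: "Y \<subseteq> U \<Longrightarrow> finite Y"
  using fU finite_subset by blast

lemma rho_collapse_le: "rho E U \<le> rho (collapse E Z) (U - Z) + rho E Z"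
proof -
  have f: "finite E" "finite (collapse E Z)" using g graph_collapse[OF g] unfolding graph_def by auto
  have "{e \<in> E. e \<inter> U \<noteq> {}} \<subseteq> {e \<in> collapse E Z. e \<inter> (U - Z) \<noteq> {}} \<union> {e \<in> E. e \<inter> Z \<noteq> {}}"
    unfolding collapse_def by blast
  then have "rho E U \<le> card ({e \<in> collapse E Z. e \<inter> (U - Z) \<noteq> {}} \<union> {e \<in> E. e \<inter> Z \<noteq> {}})"
    unfolding rho_def using f by (intro card_mono) auto
  also have "\<dots> \<le> rho (collapse E Z) (U - Z) + rho E Z" unfolding rho_def by (rule card_Un_le)
  finally show ?thesis .
qed

lemma dense_collapse:
  assumes Z: "Z \<subseteq> U" "rho E Z \<le> \<alpha> * card Z"
  shows "dense (collapse E Z) (U - Z) R b1 b2 h \<alpha>"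
proof -
  have c: "card U = card (U - Z) + card Z"
    using card_Diff_subset[OF finite_sub[OF Z(1)] Z(1)] card_mono[OF fU Z(1)] by simp
  then have m: "\<alpha> * card U = \<alpha> * card (U - Z) + \<alpha> * card Z" by (simp add: algebra_simps)
  from cnd consider "h \<le> \<alpha>" "\<alpha> * card U + 1 \<le> rho E U" | "h = \<alpha> + 1" "\<alpha> * card U + 2 \<le> rho E U"
    | a b where "h = \<alpha> + 1" "a \<in> A" "b \<in> B" "\<alpha> * card U + 1 + card (U \<inter> common E a b) \<le> rho E U"
    unfolding dense_def by blast
  then show ?thesis
  proof cases
    case 1 then show ?thesis unfolding dense_def using rho_collapse_le[of Z] m Z(2) by simp
  next
    case 2 then show ?thesis unfolding dense_def using rho_collapse_le[of Z] m Z(2) by simp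
  next
    case 3
    have "\<not> (a \<in> U \<or> b \<in> U \<or> a = b)" using 3 UR b12 by blast
    from rho_collapse_ge[OF g this, of Z]
    have "\<alpha> * card (U - Z) + 1 + card ((U - Z) \<inter> common (collapse E Z) a b) \<le> rho (collapse E Z) (U - Z)" using 3(4) m Z(2) by linarith
    then show ?thesis unfolding dense_def using 3(1,2,3) by blast
  qed
qed

text \<open>
  For a maximal good \<open>Z\<close>, sparsity must fail after collapsing \<open>Z\<close>; a good violator then merges with
  \<open>Z\<close> to a larger good set.
\<close>

lemma no_good_few_nb:
  assumes "Z \<subseteq> U" "Z \<noteq> {}" "card (nb E Z) < h"
  shows "\<not> good h E A B Z"
proof
  assume "good h E A B Z"
  let ?P = "\<lambda>Z. Z \<subseteq> U \<and> Z \<noteq> {} \<and> card (nb E Z) < h \<and> good h E A B Z"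
  have PZ: "?P Z" using assms \<open>good h E A B Z\<close> by blast
  have bd: "card Z \<le> card U" if "?P Z" for Z using card_mono[OF fU] that by blast
  obtain Z where Z: "?P Z" and max: "\<And>Z'. ?P Z' \<Longrightarrow> card Z' \<le> card Z"
  proof (rule greatest_obtain[of ?P Z card "card U", OF PZ])
    fix Y assume "?P Y" then show "card Y \<le> card U" by (rule bd)
  next
    fix X assume "?P X" "\<And>Y. ?P Y \<Longrightarrow> card Y \<le> card X"
    then show thesis by (rule that)
  qed
  let ?E = "collapse E Z" and ?U = "U - Z"
  have gE: "graph ?E" by (rule graph_collapse[OF g])
  have smaller: "card ?U < card U" using Z fU by (intro psubset_card_mono) auto
  have notl: "\<not> linked ?E ?U R b1 b2"
  proof
    assume "linked ?E ?U R b1 b2"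
    then have "linked E U R b1 b2" by (rule linked_collapse[OF ins, rotated 3]) (use Z in auto)
    then show False using nolink by blast
  qed
  have rZ: "rho E Z \<le> \<alpha> * card Z" using sparseD[OF spar] Z by blast
  have ns: "\<not> sparse ?E ?U h \<alpha>"
    using IH[OF smaller rooted_collapse[OF ins] _ dense_collapse] Z rZ notl by blast
  obtain D where D: "D \<subseteq> ?U" "D \<noteq> {}" "conn ?E D" "card (nb ?E D) < h" "\<alpha> * card D + 1 \<le> rho ?E D" "good h ?E A B D"
    by (rule good_violator[OF IH gE finite_Diff[OF fU] le_less_trans[OF card_mono[OF finite_Diff[OF fU]] smaller] ns h\<alpha>, where k = h and A = A and B = B])
  have DZ: "D \<inter> Z = {}" using D(1) by blast
  show False
  \<comment> \<open>Away from \<open>nb E Z\<close> the collapse changes neither the neighbours nor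
    the edges of \<open>D\<close>, so \<open>D\<close> would violate sparsity in \<open>E\<close>
    already.\<close>
  proof (cases "D \<inter> nb E Z = {}")
    case True
    then have "nb ?E D = nb E D" "rho ?E D = rho E D" using nb_collapse_far[OF DZ] rho_collapse_far[OF g DZ] by auto
    moreover then have "rho E D \<le> \<alpha> * card D" using sparseD[OF spar, of D] D by auto
    ultimately show False using D(5) by simp
  next
    case False
    have nbDZ: "nb E (D \<union> Z) = nb ?E D" by (rule nb_collapse_near[OF DZ False g])
    obtain Q where Q: "Q \<subseteq> Z" "Q \<noteq> {}" "conn E Q" "nb E Z \<subseteq> nb E Q"
      using conjunct2[OF conjunct2[OF conjunct2[OF Z]]] by (rule good_core)
    have "conn E (Q \<union> (D \<inter> nb E Z))" by (rule conn_attach[OF Q(3,2)]) (use Q(4) in blast)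
    then have "conn E (D \<union> (Q \<union> (D \<inter> nb E Z)))" using conn_collapse[OF D(3)] False by blast
    moreover have "D \<union> (Q \<union> (D \<inter> nb E Z)) = D \<union> Q" by blast
    ultimately have cDQ: "conn E (D \<union> Q)" by simp
    have nbDQ: "nb E (D \<union> Z) \<subseteq> nb E (D \<union> Q)"
    proof
      fix v assume "v \<in> nb E (D \<union> Z)"
      then obtain u where u: "v \<notin> D" "v \<notin> Z" "u \<in> D \<or> u \<in> Z" "{u, v} \<in> E" unfolding in_nb by blast
      show "v \<in> nb E (D \<union> Q)"
      proof (cases "u \<in> D")
        case True then show ?thesis using u Q(1) unfolding in_nb by blast
      next
        case False
        then have "v \<in> nb E Z" using u unfolding in_nb by blast
        then have "v \<in> nb E Q" using Q(4) by blast
        then show ?thesis using u unfolding in_nb by blast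
      qed
    qed
    have nbVZ: "nb ?E D \<inter> Z = {}" using nb_disj[of E "D \<union> Z"] nbDZ by blast
    have gDZ: "good h E A B (D \<union> Z)"
      unfolding good_def nbDZ
    proof (intro conjI allI impI)
      show "\<exists>Q. Q \<subseteq> D \<union> Z \<and> Q \<noteq> {} \<and> conn E Q \<and> nb ?E D \<subseteq> nb E Q"
        by (intro exI[of _ "D \<union> Q"]) (use cDQ nbDQ nbDZ Q(1) D(2) in auto)
      fix x y W assume a: "x \<in> nb ?E D" "y \<in> nb ?E D" "x \<noteq> y" "W \<subseteq> nb ?E D - {x, y}" "card W \<le> h - 2"
        "A \<inter> nb ?E D \<subseteq> W" "B \<inter> nb ?E D \<subseteq> {x, y}"
      have f: "feas ?E (D \<union> nb ?E D) W x y" by (rule goodD[OF D(6) a])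
      have nZ: "nb E Z \<subseteq> D \<union> nb ?E D" by (rule nb_collapse_clique[OF False])
      have "A \<inter> D = {}" "B \<inter> D = {}" using root_disj[of D] D(1) by blast+
      then have AB: "A \<inter> nb E Z \<subseteq> nb ?E D" "B \<inter> nb E Z \<subseteq> nb ?E D" using nZ by blast+
      have "feas E ((D \<union> nb ?E D) \<union> Z) W x y"
      proof (rule feas_uncollapse[OF g conjunct2[OF conjunct2[OF conjunct2[OF Z]]] _ f])
        show "(D \<union> nb ?E D) \<inter> Z = {}" using nbVZ DZ by blast
        show "A \<inter> nb E Z \<subseteq> W" using AB(1) a(6) by blast
        show "B \<inter> nb E Z \<subseteq> {x, y}" using AB(2) a(7) by blast
      qed (use Z nZ in auto)
      moreover have "(D \<union> nb ?E D) \<union> Z = D \<union> Z \<union> nb ?E D" by blast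
      ultimately show "feas E (D \<union> Z \<union> nb ?E D) W x y" by simp
    qed
    have "?P (D \<union> Z)" using gDZ nbDZ D(1,4) Z by auto
    then have "card (D \<union> Z) \<le> card Z" by (rule max)
    moreover have "card (D \<union> Z) = card D + card Z"
      using card_Un_disjoint[OF _ _ DZ] finite_sub D(1) Z by (metis Diff_subset order_trans)
    moreover have "D \<subseteq> U" using D(1) by blast
    then have "card D \<noteq> 0" using D(2) finite_sub[of D] by auto
    ultimately show False by simp
  qed
qed

text \<open>
  A set \<open>Y \<supseteq> Z\<close> with the fewest neighbours is linked to \<open>N(Z)\<close> by disjoint paths, which make \<open>Y\<close> good as well.
  So if \<open>|N(Y)| < h\<close> the previous lemma applies, and otherwise \<open>Z\<close> links the roots themselves.
\<close>

lemma no_good: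
  assumes "Z \<subseteq> U" "Z \<noteq> {}"
  shows "\<not> good h E A B Z"
proof
  assume gd: "good h E A B Z"
  let ?P = "\<lambda>Y. Z \<subseteq> Y \<and> Y \<subseteq> U"
  have "?P U" using assms by blast
  obtain Y where Y: "?P Y" and min0: "\<And>Y'. ?P Y' \<Longrightarrow> card (nb E Y) \<le> card (nb E Y')"
    by (rule least_obtain[of ?P U "\<lambda>Y. card (nb E Y)", OF \<open>?P U\<close>]) (rule that)
  let ?k = "card (nb E Y)"
  show False
  proof (cases "?k < h")
    case True
    have fY: "finite Y" using Y finite_sub by blast
    have m: "card (nb E Y) \<le> card (nb E X)" if "Z \<subseteq> X" "X \<subseteq> Y" for X
      using min0[of X] Y that by auto
    have ZY: "Z \<subseteq> Y" using Y by blast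
    obtain C c where l: "linkage E Z Y C c" using menger_linkage[OF g fY ZY m] by blast
    obtain D where D: "D \<subseteq> Z" "D \<noteq> {}" "conn E D" "nb E Z \<subseteq> nb E D" using gd by (rule good_core)
    have "good h E A B Y"
      unfolding good_def
    proof (intro conjI allI impI linkage_core[OF l ZY D])
      fix x y W assume a: "x \<in> nb E Y" "y \<in> nb E Y" "x \<noteq> y" "W \<subseteq> nb E Y - {x, y}" "card W \<le> h - 2"
        "A \<inter> nb E Y \<subseteq> W" "B \<inter> nb E Y \<subseteq> {x, y}"
      show "feas E (Y \<union> nb E Y) W x y"
        using linkage_feas[OF g gd ZY l a] root_disj[of Y] Y by blast
    qed
    moreover have "Y \<noteq> {}" "card (nb E Y) < h" using ZY assms(2) Y True by auto
    ultimately show False using no_good_few_nb[of Y] Y by blast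
  next
    case False
    have m: "card (nb E U) \<le> card (nb E X)" if "Z \<subseteq> X" "X \<subseteq> U" for X
      using min0[of X] that False nbU_eq cR by auto
    obtain C c where l: "linkage E Z U C c" using menger_linkage[OF g fU assms(1) m] by blast
    have "feas E (U \<union> nb E U) A b1 b2"
    proof (rule linkage_feas[OF g gd assms(1) l])
      have "card (R - {b1, b2}) = card R - 2" using b12 fR by (simp add: card_Diff_subset)
      then show "card A \<le> h - 2" using cR by simp
    qed (use nbU_eq b12 root_disj[of U] in auto)
    then show False using nolink' nbU_eq by simp
  qed
qed

lemma dense_feas:
  assumes "Y \<subset> U" "x \<in> nb E Y" "y \<in> nb E Y" "x \<noteq> y" "card (nb E Y) = h" "dense E Y (nb E Y) x y h \<alpha>"
  shows "feas E (Y \<union> nb E Y) (nb E Y - {x, y}) x y"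
proof -
  have "card Y < card U" using assms(1) fU by (rule psubset_card_mono[rotated])
  moreover have "rooted E Y (nb E Y) x y h" using rooted_nb[OF g _ assms(2,3,4)] assms(1,5) finite_sub[of Y] by auto
  moreover have "sparse E Y h \<alpha>" using sparse_subset[OF spar] assms(1) by blast
  ultimately have "linked E Y (nb E Y) x y" using assms(6) by (rule IH)
  then show ?thesis unfolding linked_nb .
qed

text \<open>A surplus of two on a proper subset with \<open>h\<close> neighbours lets minimality
  link every pair of them, so the subset would be good. With fewer neighbours sparsity excludes even
  a surplus of one.\<close>

lemma rho_proper_le:
  assumes Y: "Y \<subset> U" "Y \<noteq> {}" "card (nb E Y) \<le> h" and h: "h = \<alpha> + 1"
  shows "rho E Y \<le> \<alpha> * card Y + 1"
proof (rule ccontr)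
  assume n: "\<not> rho E Y \<le> \<alpha> * card Y + 1"
  then have "\<not> card (nb E Y) < h" using sparseD[OF spar _ Y(2)] Y(1) by auto
  then have ch: "card (nb E Y) = h" using Y(3) by simp
  have fY: "finite Y" using finite_sub Y by blast
  have sp: "sparse E Y h \<alpha>" using sparse_subset[OF spar] Y by blast
  have "\<alpha> * card Y + 1 + card (Y \<inter> {}) \<le> rho E Y" using n by simp
  from conn_dense_part[OF g fY this sp] ch obtain D where D: "D \<subseteq> Y" "D \<noteq> {}" "conn E D" "nb E D = nb E Y" by auto
  have gd: "feas E (Y \<union> nb E Y) (nb E Y - {x, y}) x y" if "x \<in> nb E Y" "y \<in> nb E Y" "x \<noteq> y" for x y
    by (rule dense_feas[OF Y(1) that ch]) (use n h in \<open>auto simp: dense_def\<close>)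
  have "good h E A B Y" by (rule goodI[OF D(1,2,3) _ gd]) (use D(4) in auto)
  then show False using no_good[of Y] Y by blast
qed

text \<open>Otherwise \<open>Y\<close> is good, by cases on the ends \<open>x\<close> and
  \<open>y\<close>. If just one of \<open>s\<close>, \<open>t\<close> is an end, the last
  alternative of \<open>dense\<close> applies. If both are ends, their edge joins them and a
  connected core of \<open>Y\<close> gathers the rest. If neither is, they are merged.\<close>

lemma rho_proper_le_common:
  assumes Y: "Y \<subset> U" "Y \<noteq> {}" "card (nb E Y) = h" and h: "h = \<alpha> + 1"
    and st: "s \<in> nb E Y" "t \<in> nb E Y" "{s, t} \<in> E"
  shows "rho E Y \<le> \<alpha> * card Y + card (Y \<inter> common E s t)"
proof (rule ccontr)
  assume n: "\<not> rho E Y \<le> \<alpha> * card Y + card (Y \<inter> common E s t)"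
  have fY: "finite Y" using finite_sub Y by blast
  have sp: "sparse E Y h \<alpha>" using sparse_subset[OF spar] Y by blast
  have sn: "s \<noteq> t" using graph_edge_ne[OF g st(3)] .
  have stY: "s \<notin> Y" "t \<notin> Y" using st(1,2) unfolding in_nb by blast+
  have rY: "\<alpha> * card Y + 1 + card (Y \<inter> common E s t) \<le> rho E Y" using n by simp
  from conn_dense_part[OF g fY rY sp] Y(3) obtain D where D: "D \<subseteq> Y" "D \<noteq> {}" "conn E D" "nb E D = nb E Y" by auto
  have cm: "common E t s = common E s t" unfolding common_def by blast
  let ?N = "nb E Y"
  have split: "feas E (Y \<union> ?N) (?N - {x, y}) x y"
    if xy: "x \<in> ?N" "y \<in> ?N" "x \<noteq> y" and p: "p \<in> {x, y}" "q \<in> ?N - {x, y}" and pq: "{p, q} = {s, t}" for x y p q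
  proof (rule dense_feas[OF Y(1) xy Y(3)])
    have "common E q p = common E s t" using pq cm by (auto simp: doubleton_eq_iff)
    then have "\<alpha> * card Y + 1 + card (Y \<inter> common E q p) \<le> rho E Y" using rY by simp
    then show "dense E Y ?N x y h \<alpha>" unfolding dense_def using h p by blast
  qed
  have both: "feas E (Y \<union> ?N) (?N - {s, t}) s t"
  proof (rule feasI[of "{s, t}" _ "D \<union> (?N - {s, t})"])
    show "conn E {s, t}" by (rule conn_edge[OF st(3)])
    show "conn E (D \<union> (?N - {s, t}))" by (rule conn_attach[OF D(3,2)]) (use D(4) in blast)
  qed (use st stY D(1) in auto)
  \<comment> \<open>Both \<open>s\<close> and \<open>t\<close> belong to the gathered side, so
    merging them is harmless. It leaves h - 1 = \<alpha> roots, for which a surplus of one suffices,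
    and costs exactly the common neighbours that the assumed surplus covers.\<close>
  have neither: "feas E (Y \<union> ?N) (?N - {x, y}) x y"
    if xy: "x \<in> ?N" "y \<in> ?N" "x \<noteq> y" and no: "s \<notin> {x, y}" "t \<notin> {x, y}" for x y
  proof -
    let ?E = "contract E s t"
    have nbE: "nb ?E Y = ?N - {t}" using nb_contract[OF g sn stY] st(1,2) sn by auto
    have "card (?N - {t}) = h - 1" using Y(3) st(2) finite_nb[OF g] by simp
    have 1: "card Y < card U" using Y(1) fU by (intro psubset_card_mono) auto
    have 2: "rooted ?E Y (?N - {t}) x y (h - 1)"
      using rooted_nb[OF graph_contract[OF g sn] fY, of x y] nbE xy no \<open>card (?N - {t}) = h - 1\<close> by auto
    have 3: "sparse ?E Y (h - 1) \<alpha>"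
      unfolding sparse_def
    proof (intro allI impI)
      fix X assume X: "X \<subseteq> Y" "X \<noteq> {}" "card (nb ?E X) < h - 1"
      have sX: "s \<notin> X" "t \<notin> X" using X(1) stY by auto
      have "card (nb E X) < h" using card_nb_contract_le(1)[OF g sn sX] X(3) by linarith
      then have "rho E X \<le> \<alpha> * card X" using sparseD[OF sp X(1,2)] by blast
      then show "rho ?E X \<le> \<alpha> * card X" using rho_contract_ge_common[OF g sn sX] by linarith
    qed
    have 4: "dense ?E Y (?N - {t}) x y (h - 1) \<alpha>"
      unfolding dense_def using rho_contract_ge_common[OF g sn stY] rY h by simp
    have "linked ?E Y (?N - {t}) x y" by (rule IH[OF 1 2 3 4])
    then have "feas ?E (Y \<union> (?N - {t})) (?N - {t} - {x, y}) x y" unfolding linked_def .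
    from feas_contract[OF g sn st(3) this]
    have "feas E (insert t (Y \<union> (?N - {t}))) (if s \<in> ?N - {t} - {x, y} then insert t (?N - {t} - {x, y}) else ?N - {t} - {x, y}) x y"
      using stY by blast
    moreover have "s \<in> ?N - {t} - {x, y}" using st no sn by auto
    moreover have "insert t (Y \<union> (?N - {t})) = Y \<union> ?N" "insert t (?N - {t} - {x, y}) = ?N - {x, y}" using st no by auto
    ultimately show ?thesis by simp
  qed
  have "good h E A B Y"
  proof (rule goodI[OF D(1,2,3)])
    show "?N \<subseteq> nb E D" using D(4) by simp
    fix x y assume xy: "x \<in> ?N" "y \<in> ?N" "x \<noteq> y"
    consider "s \<in> {x, y}" "t \<in> {x, y}" | "s \<in> {x, y}" "t \<notin> {x, y}" | "s \<notin> {x, y}" "t \<in> {x, y}" | "s \<notin> {x, y}" "t \<notin> {x, y}"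
      by blast
    then show "feas E (Y \<union> ?N) (?N - {x, y}) x y"
    proof cases
      case 1
      then have "x = s \<and> y = t \<or> x = t \<and> y = s" using xy sn by auto
      then show ?thesis using both feas_sym[of E _ _ s t] by (auto simp: insert_commute)
    next
      case 2 show ?thesis by (rule split[OF xy 2(1)]) (use 2 st in auto)
    next
      case 3 show ?thesis by (rule split[OF xy 3(2), of s]) (use 3 st in auto)
    next
      case 4 then show ?thesis by (rule neither[OF xy])
    qed
  qed
  then show False using no_good[of Y] Y by blast
qed

text \<open>A dense contraction must fail to be sparse, since a solution in it could be
  uncontracted. Take a good violator \<open>D\<close>. If it contains \<open>s\<close>, adding
  \<open>t\<close> gives a good set of \<open>E\<close> with few neighbours. If not, sparsity of
  \<open>E\<close> is respected only when \<open>s\<close> and \<open>t\<close> are both neighbours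
  of \<open>D\<close> and \<open>D\<close> has exactly \<open>h\<close> neighbours in
  \<open>E\<close>; that is excluded by \<open>rho_proper_le_common\<close>.\<close>

lemma contraction_not_dense:
  assumes h: "h = \<alpha> + 1" and st: "{s, t} \<in> E" "t \<in> U"
  shows "\<not> dense (contract E s t) (U - {t}) R b1 b2 h \<alpha>"
proof
  let ?E = "contract E s t" and ?U = "U - {t}"
  assume cd: "dense ?E ?U R b1 b2 h \<alpha>"
  have sn: "s \<noteq> t" using graph_edge_ne[OF g st(1)] .
  have gE: "graph ?E" by (rule graph_contract[OF g sn])
  have tR: "t \<notin> R" using st UR by blast
  have ts: "{t, s} \<in> E" using st(1) by (simp add: insert_commute)
  have sUR: "s \<in> U \<or> s \<in> R" using ts st(2) nbU unfolding nb_def by blast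
  have ii: "rooted ?E ?U R b1 b2 h"
  proof -
    have "nb ?E ?U \<subseteq> R"
    proof (cases "s \<in> U")
      case True
      then have "nb ?E ?U = nb E (insert t ?U)" by (intro nb_contract_in[OF g sn]) (use sn in auto)
      then show ?thesis using nbU st(2) by (simp add: insert_absorb)
    next
      case False
      have "nb ?E ?U = nb E ?U - {t} \<union> (if t \<in> nb E ?U then {s} else {})"
        by (rule nb_contract[OF g sn]) (use False in auto)
      moreover have "nb E ?U - {t} \<subseteq> nb E U" unfolding nb_def by blast
      ultimately show ?thesis using nbU sUR False by (auto split: if_splits)
    qed
    then show ?thesis using ins gE unfolding rooted_def by auto
  qed
  have smaller: "card ?U < card U" using st(2) fU by (intro psubset_card_mono) auto
  have notl: "\<not> linked ?E ?U R b1 b2"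
  proof
    assume "linked ?E ?U R b1 b2"
    then have "feas ?E (?U \<union> R) A b1 b2" unfolding linked_def .
    moreover have "t \<notin> ?U \<union> R" using tR by blast
    ultimately have "feas E (insert t (?U \<union> R)) (if s \<in> A then insert t A else A) b1 b2"
      by (rule feas_contract[OF g sn st(1)])
    then have "feas E (U \<union> R) A b1 b2" by (rule feas_mono) (use st(2) in auto)
    then show False using nolink' by blast
  qed
  have ns: "\<not> sparse ?E ?U h \<alpha>" using IH[OF smaller ii _ cd] notl by blast
  have fU': "finite ?U" using fU by simp
  obtain D where D: "D \<subseteq> ?U" "D \<noteq> {}" "conn ?E D" "card (nb ?E D) < h" "\<alpha> * card D + 1 \<le> rho ?E D" "good h ?E A B D"
    by (rule good_violator[OF IH gE fU' le_less_trans[OF card_mono[OF fU'] smaller] ns h\<alpha>, where k = h and A = A and B = B])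
  have tD: "t \<notin> D" using D(1) by blast
  show False
  proof (cases "s \<in> D")
    case True
    let ?Z = "insert t D"
    have nbZ: "nb E ?Z = nb ?E D" by (rule nb_contract_in[OF g sn True tD, symmetric])
    have cZ: "conn E ?Z" using conn_contract[OF g sn st(1) D(3) tD] True by simp
    have "good h E A B ?Z"
      unfolding good_def nbZ
    proof (intro conjI allI impI)
      show "\<exists>Q. Q \<subseteq> ?Z \<and> Q \<noteq> {} \<and> conn E Q \<and> nb ?E D \<subseteq> nb E Q"
        using cZ nbZ by (intro exI[of _ ?Z]) auto
      fix x y W assume a: "x \<in> nb ?E D" "y \<in> nb ?E D" "x \<noteq> y" "W \<subseteq> nb ?E D - {x, y}" "card W \<le> h - 2"
        "A \<inter> nb ?E D \<subseteq> W" "B \<inter> nb ?E D \<subseteq> {x, y}"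
      have f: "feas ?E (D \<union> nb ?E D) W x y" by (rule goodD[OF D(6) a])
      have "t \<notin> D \<union> nb ?E D" using tD nbZ nb_disj[of E ?Z] by blast
      from feas_contract[OF g sn st(1) f this]
      show "feas E (?Z \<union> nb ?E D) W x y" by (rule feas_mono) auto
    qed
    then show False using no_good_few_nb[of ?Z] D(1,4) st(2) nbZ by auto
  next
    case False
    have r: "rho E D = rho ?E D + card (D \<inter> common E s t)" by (rule rho_contract_ge_common[OF g sn False tD])
    have "\<not> card (nb E D) < h"
    proof
      assume "card (nb E D) < h"
      then have "rho E D \<le> \<alpha> * card D" using sparseD[OF spar, of D] D(1,2) by blast
      then show False using r D(5) by linarith
    qed
    moreover have "card (nb E D) \<le> Suc (card (nb ?E D))" by (rule card_nb_contract_le(1)[OF g sn False tD])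
    ultimately have c: "card (nb E D) = h" "card (nb E D) \<noteq> card (nb ?E D)" using D(4) by linarith+
    then have "s \<in> nb E D" "t \<in> nb E D" using card_nb_contract_le(2)[OF g sn False tD] by blast+
    moreover have "D \<subset> U" using D(1) st(2) by blast
    ultimately have "rho E D \<le> \<alpha> * card D + card (D \<inter> common E s t)" using rho_proper_le_common[OF _ D(2) c(1) h _ _ st(1)] by blast
    then show False using r D(5) by linarith
  qed
qed

text \<open>Going from \<alpha> \<ge> h down to h - 1 lowers the required count by at least |U|
  \<ge> 1, which turns a surplus of one into a surplus of two. Sparsity persists because a violator
  would yield a good set with few neighbours. So only the case h = \<alpha> + 1 needs an argument of
  its own.\<close>

lemma reduce_dense:
  assumes "h \<le> \<alpha>" and P: "sparse E U h (h - 1) \<Longrightarrow> dense E U R b1 b2 h (h - 1) \<Longrightarrow> linked E U R b1 b2"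
  shows False
proof -
  have "{b1, b2} \<subseteq> R" using b12 by blast
  then have h2: "2 \<le> h" using card_mono[OF fR, of "{b1, b2}"] b12(3) cR by simp
  have sp: "sparse E U h (h - 1)"
  proof (rule ccontr)
    assume ns: "\<not> sparse E U h (h - 1)"
    have small: "card D < card U" if D: "D \<subseteq> U" "D \<noteq> {}" "card (nb E D) < h" "(h - 1) * card D + 1 \<le> rho E D" for D
    proof -
      have "D \<noteq> U" using sparseD[OF spar D(1,2,3)] rhoU by auto
      then show ?thesis using D(1) fU by (intro psubset_card_mono) auto
    qed
    obtain D where D: "D \<subseteq> U" "D \<noteq> {}" "conn E D" "card (nb E D) < h" "(h - 1) * card D + 1 \<le> rho E D" "good h E A B D"
      by (rule good_violator[OF IH g fU small ns, where k = h and A = A and B = B]) (use h2 in auto)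
    then show False using no_good_few_nb by blast
  qed
  have "card U \<noteq> 0" using U_nonempty fU by simp
  then have "(h - 1) * card U + 2 \<le> h * card U + 1" using h2 by (cases h) auto
  also have "\<dots> \<le> \<alpha> * card U + 1" using assms(1) by simp
  finally have "dense E U R b1 b2 h (h - 1)" unfolding dense_def using rhoU h2 by simp
  then show False using P[OF sp] nolink by blast
qed

end

section \<open>Degree sums, and connectivity from a minimum degree\<close>

lemma card_edges_at:
  assumes "graph E"
  shows "card {e \<in> E. x \<in> e} = card {y. {x, y} \<in> E}"
proof -
  have "{e \<in> E. x \<in> e} = (\<lambda>y. {x, y}) ` {y. {x, y} \<in> E}"
  proof
    show "{e \<in> E. x \<in> e} \<subseteq> (\<lambda>y. {x, y}) ` {y. {x, y} \<in> E}"
    proof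
      fix e assume e: "e \<in> {e \<in> E. x \<in> e}"
      obtain y where "e = {x, y}" by (rule graph_edge_at[OF assms, of e x]) (use e in auto)
      then show "e \<in> (\<lambda>y. {x, y}) ` {y. {x, y} \<in> E}" using e by blast
    qed
  qed auto
  moreover have "inj_on (\<lambda>y. {x, y}) {y. {x, y} \<in> E}" by (auto simp: inj_on_def doubleton_eq_iff)
  ultimately show ?thesis by (simp add: card_image)
qed

lemma sum_incidence:
  assumes "finite F" "finite X" shows "(\<Sum>x\<in>X. card {e \<in> F. x \<in> e}) = (\<Sum>e\<in>F. card (e \<inter> X))"
proof -
  have "(\<Sum>x\<in>X. card {e \<in> F. x \<in> e}) = (\<Sum>x\<in>X. \<Sum>e\<in>F. if x \<in> e then 1 else 0)"
  proof (rule sum.cong[OF refl])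
    fix x
    show "card {e \<in> F. x \<in> e} = (\<Sum>e\<in>F. if x \<in> e then 1 else 0)"
      using sum.inter_filter[OF assms(1), of "\<lambda>_. 1 :: nat" "\<lambda>e. x \<in> e"] by simp
  qed
  also have "\<dots> = (\<Sum>e\<in>F. \<Sum>x\<in>X. if x \<in> e then 1 else 0)" by (rule sum.swap)
  also have "\<dots> = (\<Sum>e\<in>F. card (e \<inter> X))"
  proof (rule sum.cong[OF refl])
    fix e
    have "e \<inter> X = {x \<in> X. x \<in> e}" by blast
    then show "(\<Sum>x\<in>X. if x \<in> e then 1 else 0) = card (e \<inter> X)"
      using sum.inter_filter[OF assms(2), of "\<lambda>_. 1 :: nat" "\<lambda>x. x \<in> e"] by simp
  qed
  finally show ?thesis .
qed

text \<open>Double counting of edge ends: an edge that meets \<open>U\<close> has both ends in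
  \<open>U \<union> R\<close>.\<close>

lemma sum_degrees:
  assumes g: "graph E" and U: "finite U" "finite R" "U \<inter> R = {}" "nb E U \<subseteq> R"
  shows "(\<Sum>x\<in>U. card (nb E {x})) + (\<Sum>r\<in>R. card {x \<in> U. {r, x} \<in> E}) = 2 * rho E U"
proof -
  let ?F = "{e \<in> E. e \<inter> U \<noteq> {}}"
  have fF: "finite ?F" using g unfolding graph_def by simp
  have 1: "card (nb E {x}) = card {e \<in> ?F. x \<in> e}" if "x \<in> U" for x
  proof -
    have "{e \<in> ?F. x \<in> e} = {e \<in> E. x \<in> e}" using that by blast
    then show ?thesis using card_edges_at[OF g, of x] nb_sing[OF g, of x] by simp
  qed
  have 2: "card {x \<in> U. {r, x} \<in> E} = card {e \<in> ?F. r \<in> e}" if "r \<in> R" for r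
  proof -
    have "{e \<in> ?F. r \<in> e} = (\<lambda>y. {r, y}) ` {x \<in> U. {r, x} \<in> E}"
    proof
      show "{e \<in> ?F. r \<in> e} \<subseteq> (\<lambda>y. {r, y}) ` {x \<in> U. {r, x} \<in> E}"
      proof
        fix e assume e: "e \<in> {e \<in> ?F. r \<in> e}"
        obtain y where y: "e = {r, y}" by (rule graph_edge_at[OF g, of e r]) (use e in auto)
        have "y \<in> U" using e y that U(3) by auto
        then show "e \<in> (\<lambda>y. {r, y}) ` {x \<in> U. {r, x} \<in> E}" using e y by blast
      qed
      show "(\<lambda>y. {r, y}) ` {x \<in> U. {r, x} \<in> E} \<subseteq> {e \<in> ?F. r \<in> e}" by auto
    qed
    moreover have "inj_on (\<lambda>y. {r, y}) {x \<in> U. {r, x} \<in> E}" by (auto simp: inj_on_def doubleton_eq_iff)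
    ultimately show ?thesis by (simp add: card_image)
  qed
  have 3: "card (e \<inter> U) + card (e \<inter> R) = 2" if e: "e \<in> ?F" for e
  proof -
    have "e \<subseteq> U \<union> R"
    proof -
      have eE: "e \<in> E" using e by blast
      obtain x where x: "x \<in> e" "x \<in> U" using e by blast
      obtain y where y: "e = {x, y}" using graph_edge_at[OF g eE x(1)] by metis
      have "y \<in> U \<or> y \<in> nb E U" using y x eE unfolding in_nb by blast
      then show ?thesis using y x U(4) by blast
    qed
    then have "e = (e \<inter> U) \<union> (e \<inter> R)" by blast
    moreover have "card e = 2" "finite e" using e g unfolding graph_def by (auto intro: card_ge_0_finite)
    ultimately show ?thesis using card_Un_disjoint[of "e \<inter> U" "e \<inter> R"] U(3) by (metis finite_Int inf_assoc inf_bot_right inf_left_commute)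
  qed
  have "(\<Sum>x\<in>U. card (nb E {x})) + (\<Sum>r\<in>R. card {x \<in> U. {r, x} \<in> E}) = (\<Sum>e\<in>?F. card (e \<inter> U)) + (\<Sum>e\<in>?F. card (e \<inter> R))"
    using 1 2 sum_incidence[OF fF U(1)] sum_incidence[OF fF U(2)] by simp
  also have "\<dots> = (\<Sum>e\<in>?F. 2)" using 3 by (simp flip: sum.distrib)
  finally show ?thesis unfolding rho_def by simp
qed

text \<open>Two parts of \<open>T\<close> without edges between them would each have more than \<open>q\<close> vertices.\<close>

lemma conn_min_degree:
  assumes "finite T" "\<And>z. z \<in> T \<inter> U \<Longrightarrow> q \<le> card ({y. {z, y} \<in> E} \<inter> T)" "card T < 2 * q + 2" "graph E"
    "\<And>r. r \<in> T - U \<Longrightarrow> \<exists>z\<in>T \<inter> U. {r, z} \<in> E"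
  shows "conn E T"
proof (rule connI)
  fix D assume D: "D \<subseteq> T" "D \<noteq> {}" "D \<noteq> T" and no: "\<And>d s. d \<in> D \<Longrightarrow> s \<in> T - D \<Longrightarrow> {d, s} \<notin> E"
  have no': "{d, s} \<notin> E" if "d \<in> T - D" "s \<in> T - (T - D)" for d s
    using no[of s d] that by (auto simp: insert_commute)
  have big: "q + 1 \<le> card X" if X: "X \<subseteq> T" "X \<noteq> {}" "\<And>d s. d \<in> X \<Longrightarrow> s \<in> T - X \<Longrightarrow> {d, s} \<notin> E" for X
  proof -
    obtain z where z: "z \<in> X" "z \<in> U"
    proof -
      obtain x where x: "x \<in> X" using X(2) by blast
      show thesis
      proof (cases "x \<in> U")
        case True then show thesis using that x by blast
      next
        case False
        then obtain z where "z \<in> T \<inter> U" "{x, z} \<in> E" using assms(5)[of x] x X(1) by blast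
        then show thesis using that[of z] X(3)[OF x, of z] by blast
      qed
    qed
    have "insert z ({y. {z, y} \<in> E} \<inter> T) \<subseteq> X" using z X by blast
    moreover have "finite X" using X(1) assms(1) finite_subset by blast
    ultimately have "card (insert z ({y. {z, y} \<in> E} \<inter> T)) \<le> card X" by (rule card_mono[rotated])
    moreover have "z \<notin> {y. {z, y} \<in> E} \<inter> T" using graph_edge_ne[OF assms(4)] by blast
    ultimately show ?thesis using assms(1) assms(2)[of z] z X(1) by (auto simp: card_insert_if)
  qed
  have "q + 1 \<le> card D" using big[OF D(1,2) no] by blast
  moreover have "T - D \<noteq> {}" using D by blast
  then have "q + 1 \<le> card (T - D)" using big[of "T - D"] no' by blast
  moreover have "card T = card D + card (T - D)" using D(1) assms(1) by (metis card_Diff_subset card_mono finite_subset le_add_diff_inverse)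
  ultimately show False using assms(3) by linarith
qed

section \<open>The extremal case \<open>h = \<alpha> + 1\<close>\<close>

locale critical_tight = critical +
  assumes h: "h = \<alpha> + 1"
begin

abbreviation "N x \<equiv> nb E {x}"

lemma in_N: "y \<in> N x \<longleftrightarrow> {x, y} \<in> E"
  using nb_sing[OF g] by blast

lemma finite_N: "finite (N x)" by (rule finite_nb[OF g])

lemma N_UR: "x \<in> U \<Longrightarrow> N x \<subseteq> U \<union> R"
  using nbU unfolding nb_def by blast

lemma sym: "{x, y} \<in> E \<longleftrightarrow> {y, x} \<in> E"
  by (simp add: insert_commute)

lemma common_N: "common E x y = N x \<inter> N y"
  using in_N unfolding common_def by blast

lemma core: "\<exists>D. D \<subseteq> U \<and> D \<noteq> {} \<and> conn E D \<and> nb E D = R"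
proof -
  have "\<alpha> * card U + 1 + card (U \<inter> {}) \<le> rho E U" using rhoU by simp
  from conn_dense_part[OF g fU this spar] show ?thesis using nbU_eq cR by auto
qed

lemma cardA: "card A = h - 2" "2 \<le> h"
proof -
  have "{b1, b2} \<subseteq> R" using b12 by blast
  then show "2 \<le> h" using card_mono[OF fR, of "{b1, b2}"] b12(3) cR by simp
  show "card A = h - 2" using b12 fR cR by (simp add: card_Diff_subset)
qed

lemma linkI:
  assumes "S \<subseteq> U \<union> R" "T \<subseteq> U \<union> R" "S \<inter> T = {}" "conn E S" "conn E T" "b1 \<in> S" "b2 \<in> S" "A \<subseteq> T"
  shows False
  using nolink' feasI[OF assms] by blast

text \<open>For h \<le> 3 the set \<open>A\<close> has at most one vertex and is connected by
  itself, while a core of \<open>U\<close> joins \<open>b1\<close> to \<open>b2\<close>.\<close>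

lemma h4: "4 \<le> h"
proof (rule ccontr)
  assume n: "\<not> 4 \<le> h"
  obtain D where D: "D \<subseteq> U" "D \<noteq> {}" "conn E D" "nb E D = R" using core by blast
  have "conn E A"
  proof -
    have fA: "finite A" using fR by simp
    have "card A = 0 \<or> card A = 1" using cardA n by linarith
    then have "A = {} \<or> (\<exists>a. A = {a})" using fA by (auto simp: card_1_singleton_iff)
    then show ?thesis by (metis conn_empty conn_sing)
  qed
  moreover have "conn E (D \<union> B)" by (rule conn_attach[OF D(3,2)]) (use D(4) b12 in auto)
  ultimately show False using linkI[of "D \<union> B" A] D(1) b12 UR by auto
qed

lemma rho_U_contract:
  assumes "{s, t} \<in> E" "t \<in> U"
  shows "rho E U \<le> rho (contract E s t) (U - {t}) + 1 + card (lost E R s t)"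
  by (rule rho_contract_ge[OF g graph_edge_ne[OF g assms(1)] assms(1,2) nbU])

lemma cardU: "t \<in> U \<Longrightarrow> \<alpha> * card U = \<alpha> * card (U - {t}) + \<alpha>"
proof -
  assume "t \<in> U"
  then have "card U = Suc (card (U - {t}))" using card_Suc_Diff1[OF fU] by simp
  then show ?thesis by simp
qed

lemma lost_U: assumes "s \<in> U" shows "lost E R s t \<subseteq> common E s t"
proof -
  have "s \<notin> R" using assms UR by blast
  then show ?thesis unfolding lost_def common_def by auto
qed

lemma card_lost_U: "s \<in> U \<Longrightarrow> card (lost E R s t) \<le> card (common E s t)"
  by (rule card_mono[OF finite_common[OF g] lost_U])

text \<open>A lost vertex is a common nonroot neighbour or another root at \<open>x\<close>. The
  root \<open>r\<close> is in \<open>N x\<close> but is not lost, which gives the 1.\<close>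

lemma card_lost_R:
  assumes "r \<in> R" "{r, x} \<in> E"
  shows "card (lost E R r x) + 1 \<le> card (common E r x - R) + card (N x \<inter> R)"
proof -
  have r: "r \<in> N x \<inter> R" using assms in_N sym by auto
  have "lost E R r x \<subseteq> (common E r x - R) \<union> (N x \<inter> R - {r})"
  proof
    fix y assume "y \<in> lost E R r x"
    then have y: "y \<noteq> r" "{x, y} \<in> E" "{r, y} \<in> E \<or> y \<in> R" unfolding lost_def by auto
    then show "y \<in> (common E r x - R) \<union> (N x \<inter> R - {r})" using in_N unfolding common_def by auto
  qed
  then have "card (lost E R r x) \<le> card ((common E r x - R) \<union> (N x \<inter> R - {r}))"
    using finite_common[OF g] finite_N by (intro card_mono) auto
  also have "\<dots> \<le> card (common E r x - R) + card (N x \<inter> R - {r})" by (rule card_Un_le)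
  also have "card (N x \<inter> R) = Suc (card (N x \<inter> R - {r}))" using card_Suc_Diff1[OF _ r] finite_N by simp
  then have "card (common E r x - R) + card (N x \<inter> R - {r}) + 1 = card (common E r x - R) + card (N x \<inter> R)" by simp
  ultimately show ?thesis by linarith
qed

text \<open>The form in which a vertex of small degree is refuted: \<open>{x}\<close> would be a
  good set.\<close>

lemma star_goodI:
  assumes x: "x \<in> U"
    and f: "\<And>x1 x2 W. x1 \<in> N x \<Longrightarrow> x2 \<in> N x \<Longrightarrow> x1 \<noteq> x2 \<Longrightarrow> W \<subseteq> N x - {x1, x2} \<Longrightarrow> card W \<le> h - 2 \<Longrightarrow>
      A \<inter> N x \<subseteq> W \<Longrightarrow> B \<inter> N x \<subseteq> {x1, x2} \<Longrightarrow> feas E ({x} \<union> N x) W x1 x2"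
  shows False
proof -
  have "good h E A B {x}"
    unfolding good_def
  proof (intro conjI allI impI)
    show "\<exists>D\<subseteq>{x}. D \<noteq> {} \<and> conn E D \<and> N x \<subseteq> nb E D" by (intro exI[of _ "{x}"]) simp
  qed (rule f)
  then show False using no_good[of "{x}"] x by blast
qed

text \<open>Here \<open>x\<close> joins the two ends, and the rest of \<open>N x\<close> must hold
  together by itself.\<close>

lemma star_S:
  assumes "x1 \<in> N x" "x2 \<in> N x" "W \<subseteq> N x - {x1, x2}" "conn E (N x - {x1, x2})"
  shows "feas E ({x} \<union> N x) W x1 x2"
proof (rule feasI[of "{x} \<union> {x1, x2}" _ "N x - {x1, x2}"])
  show "conn E ({x} \<union> {x1, x2})" by (rule conn_attach) (use assms in auto)
  show "({x} \<union> {x1, x2}) \<inter> (N x - {x1, x2}) = {}" using nb_disj[of E "{x}"] by blast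
qed (use assms in auto)

text \<open>Here \<open>x\<close> gathers \<open>W\<close>, and the ends must be joined within
  \<open>N x\<close>.\<close>

lemma star_T:
  assumes "S \<subseteq> N x" "conn E S" "x1 \<in> S" "x2 \<in> S" "W \<subseteq> N x - S"
  shows "feas E ({x} \<union> N x) W x1 x2"
proof (rule feasI[of S _ "{x} \<union> W"])
  show "conn E ({x} \<union> W)" by (rule conn_attach) (use assms in auto)
  show "S \<inter> ({x} \<union> W) = {}" using nb_disj[of E "{x}"] assms by blast
qed (use assms in auto)

lemma card_root_nbrs: "card (N x \<inter> R) = card (A \<inter> N x) + card (B \<inter> N x)"
proof -
  have "N x \<inter> R = (A \<inter> N x) \<union> (B \<inter> N x)" using b12 by blast
  moreover have "(A \<inter> N x) \<inter> (B \<inter> N x) = {}" by blast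
  ultimately show ?thesis using card_Un_disjoint[of "A \<inter> N x" "B \<inter> N x"] finite_N by simp
qed

lemma ends_nonroot:
  assumes "x1 \<noteq> x2" "B \<inter> N x \<subseteq> {x1, x2}"
  shows "card ({x1, x2} - R) + card (B \<inter> N x) \<le> 2"
proof -
  have "({x1, x2} - R) \<inter> (B \<inter> N x) = {}" using b12 by blast
  then have "card ({x1, x2} - R) + card (B \<inter> N x) = card (({x1, x2} - R) \<union> (B \<inter> N x))"
    by (intro card_Un_disjoint[symmetric]) auto
  also have "\<dots> \<le> card {x1, x2}" by (rule card_mono) (use assms(2) in auto)
  finally show ?thesis using card_insert_le_m1[of 2 "{x2}" x1] by (simp add: card_insert_if split: if_splits)
qed

text \<open>The ends include all members of \<open>B\<close> in \<open>N x\<close>, so at most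
  \<open>2 - card (B \<inter> N x)\<close> of them are nonroots. That is fewer than the common
  nonroot neighbours of \<open>r\<close> and \<open>x\<close>.\<close>

lemma root_nbr:
  assumes x: "x \<in> U" and B: "x1 \<noteq> x2" "B \<inter> N x \<subseteq> {x1, x2}"
    and c: "3 \<le> card (common E r x - R) + card (B \<inter> N x)"
  shows "\<exists>z\<in>(N x - {x1, x2}) \<inter> U. {r, z} \<in> E"
proof -
  have "\<not> common E r x - R \<subseteq> {x1, x2} - R"
  proof
    assume "common E r x - R \<subseteq> {x1, x2} - R"
    then have "card (common E r x - R) \<le> card ({x1, x2} - R)" by (intro card_mono) auto
    then show False using c ends_nonroot[OF B] by linarith
  qed
  then obtain z where z: "z \<in> common E r x" "z \<notin> R" "z \<notin> {x1, x2}" by blast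
  then have "z \<in> N x" "{r, z} \<in> E" using in_N unfolding common_def by auto
  then show ?thesis using z N_UR[OF x] by blast
qed

text \<open>Without the two ends, \<open>N x\<close> has at most 2 \<alpha> - 3 vertices, while two
  disconnected parts with minimum degree \<alpha> - 2 would have 2 \<alpha> - 2. Since
  \<open>x\<close> misses some vertex of \<open>A\<close>, at most h - 3 vertices of
  \<open>A\<close> are adjacent to \<open>x\<close>; this yields the 3 that \<open>root_nbr\<close>
  asks for.\<close>

lemma star_link:
  assumes x: "x \<in> U" and d: "card (N x) \<le> 2 * \<alpha> - 1" and nA: "\<not> A \<subseteq> N x"
    and e: "x1 \<in> N x" "x2 \<in> N x" "x1 \<noteq> x2" "B \<inter> N x \<subseteq> {x1, x2}" "W \<subseteq> N x - {x1, x2}"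
    and z: "\<And>z. z \<in> N x \<inter> U \<Longrightarrow> z \<notin> {x1, x2} \<Longrightarrow> \<alpha> - 2 \<le> card (N z \<inter> (N x - {x1, x2}))"
    and r: "\<And>r. r \<in> A \<inter> N x \<Longrightarrow> h \<le> card (common E r x - R) + card (N x \<inter> R)"
  shows "feas E ({x} \<union> N x) W x1 x2"
proof (rule star_S[OF e(1,2,5)])
  let ?T = "N x - {x1, x2}"
  have cT: "card ?T = card (N x) - 2" using e(1,2,3) finite_N by (simp add: card_Diff_subset)
  show "conn E ?T"
  proof (rule conn_min_degree[where q = "\<alpha> - 2" and U = U])
    show "card ?T < 2 * (\<alpha> - 2) + 2" using cT d h h4 by linarith
    show "\<alpha> - 2 \<le> card ({y. {p, y} \<in> E} \<inter> ?T)" if "p \<in> ?T \<inter> U" for p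
      using z[of p] that nb_sing[OF g, of p] by auto
    show "\<exists>z\<in>?T \<inter> U. {q, z} \<in> E" if q: "q \<in> ?T - U" for q
    proof (rule root_nbr[OF x e(3,4)])
      have "q \<in> R" using q N_UR[OF x] by blast
      then have qA: "q \<in> A \<inter> N x" using q e(4) by blast
      have "A \<inter> N x \<subset> A" using nA by blast
      then have "card (A \<inter> N x) < card A" using fR by (intro psubset_card_mono) auto
      then show "3 \<le> card (common E q x - R) + card (B \<inter> N x)"
        using r[OF qA] card_root_nbrs[of x] cardA h4 by linarith
    qed
  qed (use finite_N g in auto)
qed

end

section \<open>The case h = \<alpha> + 1 with a surplus of at least two\<close>

locale critical_surplus = critical_tight +
  assumes rho2: "\<alpha> * card U + 2 \<le> rho E U"
begin

text \<open>Merging removes one vertex, worth \<alpha>, and the edge \<open>{s, t}\<close>. With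
  fewer than \<alpha> further losses the surplus of two would persist and the contraction would be
  dense.\<close>

lemma lost_ge:
  assumes "{s, t} \<in> E" "t \<in> U"
  shows "\<alpha> \<le> card (lost E R s t)"
proof (rule ccontr)
  assume "\<not> \<alpha> \<le> card (lost E R s t)"
  then have "\<alpha> * card (U - {t}) + 2 \<le> rho (contract E s t) (U - {t})"
    using rho_U_contract[OF assms] cardU[OF assms(2)] rho2 by linarith
  then have "dense (contract E s t) (U - {t}) R b1 b2 h \<alpha>" unfolding dense_def using h by simp
  then show False using contraction_not_dense[OF h assms] by blast
qed

lemma common_ge: "{x, z} \<in> E \<Longrightarrow> x \<in> U \<Longrightarrow> z \<in> U \<Longrightarrow> \<alpha> \<le> card (common E z x)"
  using lost_ge[of z x] card_lost_U[of z x] sym by fastforce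

lemma root_common: "r \<in> R \<Longrightarrow> {r, x} \<in> E \<Longrightarrow> x \<in> U \<Longrightarrow> h \<le> card (common E r x - R) + card (N x \<inter> R)"
  using lost_ge[of r x] card_lost_R[of r x] h by fastforce

text \<open>A set with a surplus cannot have fewer than \<open>h\<close> neighbours, so if they all
  lie in a set of size \<open>h\<close>, it sees that entire set.\<close>

lemma tight_core:
  assumes X: "X \<subseteq> U - {x}" "nb E X \<subseteq> insert x (insert b A)" "b \<in> B" "x \<in> U" "\<alpha> * card X + 1 \<le> rho E X"
  shows "\<exists>D. D \<subseteq> X \<and> D \<noteq> {} \<and> conn E D \<and> nb E D = insert x (insert b A)"
proof -
  have fX: "finite X" using X(1) fU finite_subset by blast
  have "card (insert b A) = h - 1" using X(3) fR cardA by (auto simp: card_insert_if)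
  then have "card (insert x (insert b A)) = h"
    using X(3,4) UR b12 fR cardA(2) by (auto simp: card_insert_if)
  moreover have sp: "sparse E X h \<alpha>" using sparse_subset[OF spar] X(1) by blast
  ultimately have "card (nb E X) \<le> h" using X(2) card_mono[of "insert x (insert b A)" "nb E X"] fR by simp
  moreover have "\<alpha> * card X + 1 + card (X \<inter> {}) \<le> rho E X" using X(5) by simp
  ultimately obtain D where D: "D \<subseteq> X" "D \<noteq> {}" "conn E D" "nb E D = nb E X"
    "\<alpha> * card D + 1 \<le> rho E D" using conn_dense_part[OF g fX _ sp, of "{}"] by auto
  have "\<not> card (nb E D) < h"
  proof
    assume "card (nb E D) < h"
    then have "rho E D \<le> \<alpha> * card D" using sparseD[OF sp D(1,2)] by blast
    then show False using D(5) by simp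
  qed
  then have "nb E D = insert x (insert b A)"
    using card_seteq[of "insert x (insert b A)" "nb E D"] X(2) D(4) fR \<open>card (insert x (insert b A)) = h\<close> by simp
  then show ?thesis using D by blast
qed

text \<open>
  Here \<open>{x} \<union> A\<close> is connected, so \<open>b1\<close> and \<open>b2\<close> are separated in \<open>U - {x}\<close>. The edge count forces one
  of the two sides to contain a connected set seeing \<open>x\<close>, \<open>A\<close> and its own end.
\<close>

lemma not_all_A:
  assumes x: "x \<in> U" and AN: "A \<subseteq> N x"
  shows False
proof -
  have b1U: "b1 \<notin> U" "b2 \<notin> U" "x \<noteq> b1" "x \<noteq> b2" "x \<notin> A" using b12 UR x by auto
  \<comment> \<open>The side of \<open>b1\<close>: what can be reached from it within
    \<open>U - {x}\<close>. Its nonroots form \<open>?P\<close>, and the remaining vertices of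
    \<open>U - {x}\<close> form \<open>?Q\<close>.\<close>
  obtain D where D: "D \<subseteq> insert b1 (U - {x})" "b1 \<in> D" "conn E D"
    and Dc: "\<And>d s. d \<in> D \<Longrightarrow> s \<in> insert b1 (U - {x}) - D \<Longrightarrow> {d, s} \<notin> E"
    using conn_reach[of b1 "insert b1 (U - {x})" E] by blast
  have cxA: "conn E ({x} \<union> A)" by (rule conn_attach) (use AN in auto)
  have nb2: "{d, b2} \<notin> E" if "d \<in> D" for d
  proof
    assume "{d, b2} \<in> E"
    then have "conn E (insert b2 D)" using conn_insert[OF D(3) that] by blast
    moreover have "insert b2 D \<inter> ({x} \<union> A) = {}" using D(1) b1U UR b12 by auto
    moreover have "insert b2 D \<subseteq> U \<union> R" using D(1) b12 by blast
    ultimately show False using linkI[OF _ _ _ _ cxA, of "insert b2 D"] D(2) x by blast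
  qed
  let ?P = "D - {b1}" and ?Q = "U - {x} - D"
  have PU: "?P \<subseteq> U - {x}" "?Q \<subseteq> U - {x}" using D(1) by blast+
  have nP: "nb E ?P \<subseteq> insert x (insert b1 A)"
  proof
    fix v assume "v \<in> nb E ?P"
    then obtain u where u: "v \<notin> ?P" "u \<in> D" "u \<noteq> b1" "{u, v} \<in> E" unfolding in_nb by blast
    have uU: "u \<in> U" using u D(1) by blast
    then have "v \<in> U \<or> v \<in> R" using N_UR[OF uU] u(4) in_N by blast
    moreover have "v \<noteq> b2" using nb2[OF u(2)] u(4) by blast
    moreover have "v = x" if "v \<in> U" using Dc[OF u(2), of v] u(1,4) that b1U by blast
    ultimately show "v \<in> insert x (insert b1 A)" by blast
  qed
  have nQ: "nb E ?Q \<subseteq> insert x (insert b2 A)"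
  proof
    fix v assume "v \<in> nb E ?Q"
    then obtain u where u: "v \<notin> ?Q" "u \<in> ?Q" "{u, v} \<in> E" unfolding in_nb by blast
    have uU: "u \<in> U" using u by blast
    then have "v \<in> U \<or> v \<in> R" using N_UR[OF uU] u(3) in_N by blast
    moreover have "v \<notin> D" using Dc[of v u] u sym by blast
    ultimately show "v \<in> insert x (insert b2 A)" using u(1) D(2) by blast
  qed
  have crd: "card (insert x (insert b A)) \<le> h" if "b \<in> B" for b
  proof -
    have "card (insert x (insert b A)) \<le> 2 + card A" using fR card_insert_le_m1 by (simp add: card_insert_if)
    then show ?thesis using cardA by linarith
  qed
  have bound: "rho E X \<le> \<alpha> * card X + 1" if "X \<subseteq> U - {x}" "nb E X \<subseteq> insert x (insert b A)" "b \<in> B" for X b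
  proof (cases "X = {}")
    case False
    have "card (nb E X) \<le> card (insert x (insert b A))" by (rule card_mono) (use that fR in auto)
    then have "card (nb E X) \<le> h" using crd[OF that(3)] by linarith
    moreover have "X \<subset> U" using that x by blast
    ultimately show ?thesis using rho_proper_le[of X] False h by blast
  qed simp
  have bP: "rho E ?P \<le> \<alpha> * card ?P + 1" using bound[OF PU(1) nP] by blast
  have bQ: "rho E ?Q \<le> \<alpha> * card ?Q + 1" using bound[OF PU(2) nQ] by blast
  have rU: "rho E U \<le> rho E ?P + rho E ?Q + card (N x \<inter> R)"
  proof -
    have "{e \<in> E. e \<inter> U \<noteq> {}} \<subseteq> ({e \<in> E. e \<inter> ?P \<noteq> {}} \<union> {e \<in> E. e \<inter> ?Q \<noteq> {}}) \<union> (\<lambda>y. {x, y}) ` (N x \<inter> R)"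
    proof
      fix e assume e: "e \<in> {e \<in> E. e \<inter> U \<noteq> {}}"
      show "e \<in> ({e \<in> E. e \<inter> ?P \<noteq> {}} \<union> {e \<in> E. e \<inter> ?Q \<noteq> {}}) \<union> (\<lambda>y. {x, y}) ` (N x \<inter> R)"
      proof (cases "e \<inter> ?P = {} \<and> e \<inter> ?Q = {}")
        case True
        have Ux: "U - {x} \<subseteq> ?P \<union> ?Q" using b1U by blast
        then have "x \<in> e" using e True by blast
        have eE: "e \<in> E" using e by blast
        obtain y where y: "e = {x, y}" "x \<noteq> y" using graph_edge_at[OF g eE \<open>x \<in> e\<close>] by metis
        then have "y \<in> N x" using eE in_N by blast
        moreover have "y \<notin> U" using True y Ux by blast
        ultimately have "y \<in> N x \<inter> R" using N_UR[OF x] by blast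
        then show ?thesis using y by blast
      qed (use e in blast)
    qed
    then have "rho E U \<le> card (({e \<in> E. e \<inter> ?P \<noteq> {}} \<union> {e \<in> E. e \<inter> ?Q \<noteq> {}}) \<union> (\<lambda>y. {x, y}) ` (N x \<inter> R))"
      unfolding rho_def using g finite_N by (intro card_mono) (auto simp: graph_def)
    also have "\<dots> \<le> card ({e \<in> E. e \<inter> ?P \<noteq> {}} \<union> {e \<in> E. e \<inter> ?Q \<noteq> {}}) + card ((\<lambda>y. {x, y}) ` (N x \<inter> R))"
      by (rule card_Un_le)
    also have "\<dots> \<le> rho E ?P + rho E ?Q + card (N x \<inter> R)"
      unfolding rho_def by (intro add_mono card_Un_le card_image_le) (use finite_N in auto)
    finally show ?thesis .
  qed
  have "card (U - {x}) = card ?P + card ?Q"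
  proof -
    have "U - {x} = ?P \<union> ?Q" "?P \<inter> ?Q = {}" using D(1) b1U by blast+
    then show ?thesis using card_Un_disjoint[of ?P ?Q] fU finite_subset[OF PU(1)] by simp
  qed
  then have "\<alpha> * card U = \<alpha> * card ?P + \<alpha> * card ?Q + \<alpha>" using cardU[OF x] by (simp add: algebra_simps)
  moreover have "A \<inter> N x = A" using AN by blast
  then have "card (N x \<inter> R) + 1 = \<alpha> + card (B \<inter> N x)" using card_root_nbrs[of x] cardA h by simp
  \<comment> \<open>Besides the edges at \<open>?P\<close> and \<open>?Q\<close> only those from
    \<open>x\<close> to roots count, \<alpha> - 1 to \<open>A\<close> and the rest to
    \<open>B\<close>. Removing \<open>x\<close> is worth \<alpha>, so the surplus of two becomes
    three, less the ends adjacent to \<open>x\<close>.\<close>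
  ultimately have tot: "\<alpha> * card ?P + \<alpha> * card ?Q + 3 \<le> rho E ?P + rho E ?Q + card (B \<inter> N x)" using rU rho2 by linarith
  have tP: "\<exists>D'. D' \<subseteq> ?P \<and> D' \<noteq> {} \<and> conn E D' \<and> nb E D' = insert x (insert b1 A)" if "\<alpha> * card ?P + 1 \<le> rho E ?P"
    using tight_core[OF PU(1) nP _ x that] by blast
  have tQ: "\<exists>D'. D' \<subseteq> ?Q \<and> D' \<noteq> {} \<and> conn E D' \<and> nb E D' = insert x (insert b2 A)" if "\<alpha> * card ?Q + 1 \<le> rho E ?Q"
    using tight_core[OF PU(2) nQ _ x that] by blast
  have fin: False if X: "X \<subseteq> U - {x}" "X \<noteq> {}" "conn E X" "A \<subseteq> nb E X" and S: "S \<subseteq> U \<union> B" "conn E S" "b1 \<in> S" "b2 \<in> S" "S \<inter> X = {}" for X S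
  proof (rule linkI[of S "X \<union> A"])
    show "conn E (X \<union> A)" by (rule conn_attach[OF X(3,2)]) (use X(4) in blast)
    show "S \<inter> (X \<union> A) = {}" using S(1,5) UR b12 by blast
  qed (use X(1) S b12 in auto)
  have ke: "card (B \<inter> N x) = (if b1 \<in> N x then 1 else 0) + (if b2 \<in> N x then 1 else 0)"
    using b12(3) by (auto simp: Int_insert_left)
  \<comment> \<open>Each side has a surplus of at most one. If both ends are adjacent to
    \<open>x\<close>, they are joined through \<open>x\<close>, and one side with a surplus gathers
    \<open>A\<close>. If only one is, both sides have a surplus: the core on the side of the other
    end joins that end to \<open>x\<close>, and the second core gathers \<open>A\<close>. If none
    is, the total is too large.\<close>
  consider "b1 \<in> N x" "b2 \<in> N x" | "b1 \<in> N x" "b2 \<notin> N x" | "b1 \<notin> N x" "b2 \<in> N x" | "b1 \<notin> N x" "b2 \<notin> N x" by blast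
  then show False
  proof cases
    case 1
    have c: "conn E ({x} \<union> B)" by (rule conn_attach) (use 1 in auto)
    have "card (B \<inter> N x) = 2" using ke 1 by simp
    then have "\<alpha> * card ?P + 1 \<le> rho E ?P \<or> \<alpha> * card ?Q + 1 \<le> rho E ?Q" using tot by linarith
    then show False
    proof
      assume "\<alpha> * card ?P + 1 \<le> rho E ?P"
      then obtain X where X: "X \<subseteq> ?P" "X \<noteq> {}" "conn E X" "nb E X = insert x (insert b1 A)" using tP by blast
      show False by (rule fin[of X "{x} \<union> B"]) (use X PU c x b1U in auto)
    next
      assume "\<alpha> * card ?Q + 1 \<le> rho E ?Q"
      then obtain X where X: "X \<subseteq> ?Q" "X \<noteq> {}" "conn E X" "nb E X = insert x (insert b2 A)" using tQ by blast
      show False by (rule fin[of X "{x} \<union> B"]) (use X PU c x b1U in auto)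
    qed
  next
    case 2
    then have "\<alpha> * card ?P + 1 \<le> rho E ?P" "\<alpha> * card ?Q + 1 \<le> rho E ?Q" using tot ke bP bQ by simp_all
    then obtain X Y where X: "X \<subseteq> ?P" "X \<noteq> {}" "conn E X" "nb E X = insert x (insert b1 A)"
      and Y: "Y \<subseteq> ?Q" "Y \<noteq> {}" "conn E Y" "nb E Y = insert x (insert b2 A)" using tP tQ by blast
    have "conn E (Y \<union> {x, b2})" by (rule conn_attach[OF Y(3,2)]) (use Y(4) in blast)
    moreover have "conn E {x, b1}" using 2(1) by (intro conn_edge) (simp add: in_N)
    ultimately have "conn E (Y \<union> {x, b2} \<union> {x, b1})" by (rule conn_Un) blast
    moreover have XU: "X \<subseteq> U - {x}" and YU: "Y \<subseteq> U - {x}" and XY: "X \<inter> Y = {}" using X(1) Y(1) PU by blast+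
    moreover have "A \<subseteq> nb E X" unfolding X(4) by blast
    moreover have "Y \<union> {x, b2} \<union> {x, b1} \<subseteq> U \<union> B" using YU x by blast
    moreover have "(Y \<union> {x, b2} \<union> {x, b1}) \<inter> X = {}" using XY XU b1U by blast
    ultimately show False using fin[of X "Y \<union> {x, b2} \<union> {x, b1}"] X(2,3) by simp
  next
    case 3
    then have "\<alpha> * card ?P + 1 \<le> rho E ?P" "\<alpha> * card ?Q + 1 \<le> rho E ?Q" using tot ke bP bQ by simp_all
    then obtain X Y where X: "X \<subseteq> ?P" "X \<noteq> {}" "conn E X" "nb E X = insert x (insert b1 A)"
      and Y: "Y \<subseteq> ?Q" "Y \<noteq> {}" "conn E Y" "nb E Y = insert x (insert b2 A)" using tP tQ by blast
    have "conn E (X \<union> {x, b1})" by (rule conn_attach[OF X(3,2)]) (use X(4) in blast)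
    moreover have "conn E {x, b2}" using 3(2) by (intro conn_edge) (simp add: in_N)
    ultimately have "conn E (X \<union> {x, b1} \<union> {x, b2})" by (rule conn_Un) blast
    moreover have XU: "X \<subseteq> U - {x}" and YU: "Y \<subseteq> U - {x}" and XY: "X \<inter> Y = {}" using X(1) Y(1) PU by blast+
    moreover have "A \<subseteq> nb E Y" unfolding Y(4) by blast
    moreover have "X \<union> {x, b1} \<union> {x, b2} \<subseteq> U \<union> B" using XU x by blast
    moreover have "(X \<union> {x, b1} \<union> {x, b2}) \<inter> Y = {}" using XY YU b1U by blast
    ultimately show False using fin[of Y "X \<union> {x, b1} \<union> {x, b2}"] Y(2,3) by simp
  next
    case 4
    then show False using tot ke bP bQ by simp
  qed
qed

text \<open>By \<open>not_all_A\<close> fewer than \<open>h\<close> roots are adjacent to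
  \<open>x\<close>, so the bound on lost edges leaves a common nonroot neighbour of \<open>r\<close>
  and \<open>x\<close>.\<close>

lemma two_nbrs:
  assumes r: "r \<in> R" and x: "x \<in> U" "{r, x} \<in> E"
  shows "\<exists>y\<in>U. y \<noteq> x \<and> {r, y} \<in> E"
proof -
  have "A \<inter> N x \<subset> A" using not_all_A[OF x(1)] by blast
  then have "card (A \<inter> N x) < card A" using fR by (intro psubset_card_mono) auto
  moreover have "card (B \<inter> N x) \<le> 2"
    using card_mono[of B "B \<inter> N x"] b12(3) by simp
  ultimately have "card (N x \<inter> R) < h" using card_root_nbrs[of x] cardA h4 by linarith
  then have "card (common E r x - R) \<noteq> 0" using root_common[OF r x(2,1)] by linarith
  then obtain y where y: "y \<in> common E r x" "y \<notin> R" by (metis DiffE card.empty ex_in_conv)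
  then have "{r, y} \<in> E" "y \<in> N x" using in_N unfolding common_def by auto
  moreover have "y \<noteq> x" using \<open>y \<in> N x\<close> nb_disj[of E "{x}"] by blast
  ultimately show ?thesis using N_UR[OF x(1)] y(2) by blast
qed

lemma root_deg:
  assumes r: "r \<in> R" shows "2 \<le> card {x \<in> U. {r, x} \<in> E}"
proof -
  have "r \<in> nb E U" using r nbU_eq by simp
  then obtain x where x: "x \<in> U" "{r, x} \<in> E" unfolding in_nb using sym by blast
  obtain y where y: "y \<in> U" "y \<noteq> x" "{r, y} \<in> E" using two_nbrs[OF r x] by blast
  have "card {x, y} \<le> card {x \<in> U. {r, x} \<in> E}" by (rule card_mono) (use x y fU in auto)
  then show ?thesis using y(2) by simp
qed

lemma surplus_two_False:
  assumes eq: "rho E U = \<alpha> * card U + 2"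
  shows False
proof -
  have "(\<Sum>r\<in>R. 2) \<le> (\<Sum>r\<in>R. card {x \<in> U. {r, x} \<in> E})" by (rule sum_mono) (rule root_deg)
  then have "2 * h \<le> (\<Sum>r\<in>R. card {x \<in> U. {r, x} \<in> E})" using cR by simp
  \<comment> \<open>All edge ends together number 2 \<alpha> |U| + 4, and the roots take at least 2
    h > 4 of them.\<close>
  then have "(\<Sum>x\<in>U. card (N x)) < 2 * \<alpha> * card U"
    using sum_degrees[OF g fU fR UR nbU] eq h4 by linarith
  then have "\<exists>x\<in>U. card (N x) < 2 * \<alpha>"
  proof (rule contrapos_pp)
    assume "\<not> (\<exists>x\<in>U. card (N x) < 2 * \<alpha>)"
    then have "(\<Sum>x\<in>U. 2 * \<alpha>) \<le> (\<Sum>x\<in>U. card (N x))" by (intro sum_mono) (auto simp: not_less)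
    then show "\<not> (\<Sum>x\<in>U. card (N x)) < 2 * \<alpha> * card U" by (simp add: mult.commute)
  qed
  then obtain x where x: "x \<in> U" "card (N x) < 2 * \<alpha>" by blast
  show False
  proof (rule star_goodI[OF x(1)])
    fix x1 x2 W assume e: "x1 \<in> N x" "x2 \<in> N x" "x1 \<noteq> x2" "W \<subseteq> N x - {x1, x2}" "B \<inter> N x \<subseteq> {x1, x2}"
    show "feas E ({x} \<union> N x) W x1 x2"
    proof (rule star_link[OF x(1) _ _ e(1,2,3,5,4)])
      show "\<not> A \<subseteq> N x" using not_all_A[OF x(1)] by blast
      show "\<alpha> - 2 \<le> card (N z \<inter> (N x - {x1, x2}))" if z: "z \<in> N x \<inter> U" for z
      proof -
        have "\<alpha> \<le> card (common E z x)" using common_ge[of x z] z x(1) in_N by blast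
        moreover have "N z \<inter> (N x - {x1, x2}) = common E z x - {x1, x2}" unfolding common_N by blast
        moreover have "card (common E z x) - card {x1, x2} \<le> card (common E z x - {x1, x2})" by (rule diff_card_le_card_Diff) simp
        ultimately show ?thesis using e(3) by simp
      qed
      show "h \<le> card (common E r x - R) + card (N x \<inter> R)" if "r \<in> A \<inter> N x" for r
        using root_common[of r x] that in_N sym x(1) by blast
    qed (use x(2) in auto)
  qed
qed

text \<open>
  With surplus above two, deleting an edge at \<open>b1\<close> keeps the graph dense, so it destroys sparsity.
\<close>

lemma surplus_False:
  assumes IHE: "\<And>E'. E' \<subset> E \<Longrightarrow> rooted E' U R b1 b2 h \<Longrightarrow> sparse E' U h \<alpha> \<Longrightarrow> dense E' U R b1 b2 h \<alpha> \<Longrightarrow> linked E' U R b1 b2"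
  shows False
proof (cases "rho E U = \<alpha> * card U + 2")
  case True then show False by (rule surplus_two_False)
next
  case False
  then have r3: "\<alpha> * card U + 3 \<le> rho E U" using rho2 by simp
  have "b1 \<in> nb E U" using b12 nbU_eq by simp
  then obtain x where x: "x \<in> U" "{b1, x} \<in> E" unfolding in_nb using sym by blast
  obtain y where y: "y \<in> U" "y \<noteq> x" "{b1, y} \<in> E" using two_nbrs[OF b12(1) x] by blast
  let ?e = "{b1, x}" let ?E = "E - {?e}"
  have b1U: "b1 \<notin> U" using b12 UR by blast
  have sub: "?E \<subset> E" using x(2) by blast
  have gE: "graph ?E" using g unfolding graph_def by auto
  have nbsub: "nb ?E Y \<subseteq> nb E Y" for Y unfolding nb_def by blast
  have ii: "rooted ?E U R b1 b2 h" using ins gE nbsub[of U] unfolding rooted_def by auto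
  have rho_in: "rho E Y = rho ?E Y + 1" if "x \<in> Y" for Y
  proof -
    have "{e \<in> E. e \<inter> Y \<noteq> {}} = insert ?e {e \<in> ?E. e \<inter> Y \<noteq> {}}" using x(2) that by auto
    moreover have "finite {e \<in> ?E. e \<inter> Y \<noteq> {}}" using gE unfolding graph_def by simp
    ultimately show ?thesis unfolding rho_def by simp
  qed
  have "dense ?E U R b1 b2 h \<alpha>" unfolding dense_def using rho_in[OF x(1)] r3 h by simp
  moreover have "\<not> linked ?E U R b1 b2"
    using nolink feas_mono[of ?E _ _ _ _ _ _ E] sub unfolding linked_def by blast
  ultimately have "\<not> sparse ?E U h \<alpha>" using IHE[OF sub ii] by blast
  then obtain Y where Y: "Y \<subseteq> U" "Y \<noteq> {}" "card (nb ?E Y) < h" "\<alpha> * card Y + 1 \<le> rho ?E Y"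
    unfolding sparse_def by (auto simp: not_le Suc_le_eq)
  show False
  proof (cases "x \<in> Y")
    case False
    have 0: "?e \<inter> Y = {}" using False Y(1) b1U by blast
    then have "{e \<in> ?E. e \<inter> Y \<noteq> {}} = {e \<in> E. e \<inter> Y \<noteq> {}}" by blast
    then have "rho ?E Y = rho E Y" unfolding rho_def by simp
    moreover have "nb E Y \<subseteq> nb ?E Y"
    proof
      fix v assume "v \<in> nb E Y"
      then obtain u where u: "v \<notin> Y" "u \<in> Y" "{u, v} \<in> E" unfolding in_nb by blast
      then have "{u, v} \<in> ?E" using 0 by blast
      then show "v \<in> nb ?E Y" using u unfolding in_nb by blast
    qed
    then have "card (nb E Y) < h" using nbsub[of Y] Y(3) by (metis subset_antisym)
    then have "rho E Y \<le> \<alpha> * card Y" using sparseD[OF spar Y(1,2)] by blast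
    ultimately show False using Y(4) by simp
  next
    case True
    have "nb E Y \<subseteq> insert b1 (nb ?E Y)"
    proof
      fix v assume "v \<in> nb E Y"
      then obtain u where u: "v \<notin> Y" "u \<in> Y" "{u, v} \<in> E" unfolding in_nb by blast
      show "v \<in> insert b1 (nb ?E Y)"
      proof (cases "{u, v} = ?e")
        case True
        then have "v = b1" using u(2) Y(1) b1U by (auto simp: doubleton_eq_iff)
        then show ?thesis by blast
      next
        case False
        then have "{u, v} \<in> ?E" using u by blast
        then have "v \<in> nb ?E Y" using u unfolding in_nb by blast
        then show ?thesis by blast
      qed
    qed
    then have *: "card (nb E Y) \<le> card (insert b1 (nb ?E Y))" using finite_nb[OF gE] by (intro card_mono) auto
    show False
    proof (cases "Y = U")
      case False
      have "card (nb E Y) \<le> h" using * Y(3) finite_nb[OF gE, of Y] by (simp add: card_insert_if split: if_splits)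
      then have "rho E Y \<le> \<alpha> * card Y + 1" using rho_proper_le[of Y] Y(1,2) False h by blast
      then show False using rho_in[OF True] Y(4) by linarith
    next
      case YU: True
      have "{y, b1} \<noteq> ?e" using y(2) b1U y(1) by (auto simp: doubleton_eq_iff)
      then have "{y, b1} \<in> ?E" using y(3) sym[of b1 y] by blast
      then have "b1 \<in> nb ?E U" using y(1) b1U unfolding in_nb by blast
      then show False using * Y(3) YU nbU_eq cR by (simp add: insert_absorb)
    qed
  qed
qed

end

section \<open>The case h = \<alpha> + 1 with a surplus of exactly one\<close>

locale critical_exact = critical_tight +
  fixes a :: 'a
  assumes rho1: "rho E U = \<alpha> * card U + 1" and aA: "a \<in> A" and noc: "U \<inter> common E a b1 = {}"
begin

lemma nocom: "x \<in> U \<Longrightarrow> a \<in> N x \<Longrightarrow> b1 \<in> N x \<Longrightarrow> False"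
  using noc in_N sym unfolding common_def by blast

lemma lost_ge1:
  assumes "{s, t} \<in> E" "t \<in> U"
  shows "\<alpha> \<le> card (lost E R s t) + 1"
proof (rule ccontr)
  assume "\<not> \<alpha> \<le> card (lost E R s t) + 1"
  then have "\<alpha> * card (U - {t}) + 2 \<le> rho (contract E s t) (U - {t})"
    using rho_U_contract[OF assms] cardU[OF assms(2)] rho1 by linarith
  then have "dense (contract E s t) (U - {t}) R b1 b2 h \<alpha>" unfolding dense_def using h by simp
  then show False using contraction_not_dense[OF h assms] by blast
qed

text \<open>If the contraction leaves \<open>a\<close> and \<open>b1\<close> without common
  neighbours, a surplus of one makes it dense through the last alternative of \<open>dense\<close>.
  This gains one over \<open>lost_ge1\<close>, where a surplus of two would have to arise.\<close>

lemma lost_ge2: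
  assumes st: "{s, t} \<in> E" "t \<in> U" and e: "(U - {t}) \<inter> common (contract E s t) a b1 = {}"
  shows "\<alpha> \<le> card (lost E R s t)"
proof (rule ccontr)
  assume "\<not> \<alpha> \<le> card (lost E R s t)"
  then have "\<alpha> * card (U - {t}) + 1 + card ((U - {t}) \<inter> common (contract E s t) a b1) \<le> rho (contract E s t) (U - {t})"
    using rho_U_contract[OF st] cardU[OF st(2)] rho1 e by simp
  then have "dense (contract E s t) (U - {t}) R b1 b2 h \<alpha>" unfolding dense_def using h aA by blast
  then show False using contraction_not_dense[OF h st] by blast
qed

lemma common_ge1: "{x, z} \<in> E \<Longrightarrow> x \<in> U \<Longrightarrow> z \<in> U \<Longrightarrow> \<alpha> \<le> card (common E z x) + 1"
  using lost_ge1[of z x] card_lost_U[of z x] sym by fastforce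

text \<open>Only the merged vertex could become a common neighbour of \<open>a\<close> and
  \<open>b1\<close>, and the last hypothesis rules that out.\<close>

lemma common_ge2:
  assumes "{x, z} \<in> E" "x \<in> U" "z \<in> U" and n: "\<not> ((a \<in> N z \<or> a \<in> N x) \<and> (b1 \<in> N z \<or> b1 \<in> N x))"
  shows "\<alpha> \<le> card (common E z x)"
proof -
  have zx: "{z, x} \<in> E" using assms(1) sym by blast
  have ne: "z \<noteq> x" using graph_edge_ne[OF g zx] .
  have az: "a \<noteq> z" "b1 \<noteq> z" using aA b12 assms(3) UR by blast+
  have "(U - {x}) \<inter> common (contract E z x) a b1 = {}"
  proof (rule ccontr)
    assume "(U - {x}) \<inter> common (contract E z x) a b1 \<noteq> {}"
    then obtain y where y: "y \<in> U" "y \<noteq> x" "{a, y} \<in> contract E z x" "{b1, y} \<in> contract E z x" unfolding common_def by blast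
    then have 1: "{a, y} \<in> E \<or> y = z \<and> {x, a} \<in> E" "{b1, y} \<in> E \<or> y = z \<and> {x, b1} \<in> E"
      using contract_iff[OF ne g] az by blast+
    show False
    proof (cases "y = z")
      case True then show False using 1 n in_N sym by blast
    next
      case False then show False using 1 nocom[OF y(1)] in_N sym by blast
    qed
  qed
  then have "\<alpha> \<le> card (lost E R z x)" by (rule lost_ge2[OF zx assms(2)])
  then show ?thesis using card_lost_U[of z x] assms(3) by simp
qed

text \<open>Merging into a root other than \<open>a\<close> and \<open>b1\<close> adds no edge from
  these two to \<open>U\<close>, so the stronger bound \<open>lost_ge2\<close> applies.\<close>

lemma root_common2:
  assumes r: "r \<in> R" "r \<noteq> a" "r \<noteq> b1" and x: "{r, x} \<in> E" "x \<in> U"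
  shows "h \<le> card (common E r x - R) + card (N x \<inter> R)"
proof -
  have ne: "r \<noteq> x" using graph_edge_ne[OF g x(1)] .
  have "(U - {x}) \<inter> common (contract E r x) a b1 = {}"
  proof (rule ccontr)
    assume "(U - {x}) \<inter> common (contract E r x) a b1 \<noteq> {}"
    then obtain y where y: "y \<in> U" "y \<noteq> x" "{a, y} \<in> contract E r x" "{b1, y} \<in> contract E r x" unfolding common_def by blast
    moreover have "y \<noteq> r" using y(1) r(1) UR by blast
    ultimately have "{a, y} \<in> E" "{b1, y} \<in> E" using contract_iff[OF ne g] r by blast+
    then show False using nocom[OF y(1)] in_N sym by blast
  qed
  then have "\<alpha> \<le> card (lost E R r x)" by (rule lost_ge2[OF x])
  then show ?thesis using card_lost_R[OF r(1) x(1)] h by linarith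
qed

lemma root_common1:
  assumes r: "r \<in> R" and x: "{r, x} \<in> E" "x \<in> U"
  shows "h \<le> card (common E r x - R) + card (N x \<inter> R) + 1"
  using lost_ge1[OF x] card_lost_R[OF r x(1)] h by linarith

lemma card_root_nbrs_less: "x \<in> U \<Longrightarrow> card (N x \<inter> R) < h"
proof -
  assume x: "x \<in> U"
  have "N x \<inter> R \<noteq> R" using nocom[OF x] aA b12 by blast
  then have "card (N x \<inter> R) < card R" using fR by (intro psubset_card_mono) auto
  then show ?thesis using cR by simp
qed

lemma root_deg2:
  assumes r: "r \<in> R" "r \<noteq> a" "r \<noteq> b1"
  shows "2 \<le> card {x \<in> U. {r, x} \<in> E}"
proof -
  have "r \<in> nb E U" using r nbU_eq by simp
  then obtain x where x: "x \<in> U" "{r, x} \<in> E" unfolding in_nb using sym by blast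
  have "card (common E r x - R) \<noteq> 0" using root_common2[OF r x(2,1)] card_root_nbrs_less[OF x(1)] by linarith
  then obtain y where y: "y \<in> common E r x" "y \<notin> R" by (metis DiffE card.empty ex_in_conv)
  then have ry: "{r, y} \<in> E" "y \<in> N x" using in_N unfolding common_def by auto
  have "y \<noteq> x" using ry nb_disj[of E "{x}"] by blast
  have "y \<in> U" using ry N_UR[OF x(1)] y(2) by blast
  have "card {x, y} \<le> card {x \<in> U. {r, x} \<in> E}" by (rule card_mono) (use x \<open>y \<in> U\<close> ry fU in auto)
  then show ?thesis using \<open>y \<noteq> x\<close> by simp
qed

text \<open>The roots to which the stronger bound applies; by \<open>root_deg2\<close> each has two
  neighbours in \<open>U\<close>.\<close>

abbreviation "J \<equiv> R - {a, b1}"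

lemma card_J: "card J = h - 2"
proof -
  have "a \<noteq> b1" using aA by blast
  then show ?thesis using aA b12 fR cR by (simp add: card_Diff_subset)
qed

text \<open>
  With \<open>d(r)\<close> the number of neighbours of \<open>r\<close> in \<open>U\<close>, the total weight is \<open>2 (\<alpha> - 1) rho U\<close> minus
  \<open>(\<alpha> - 1) d(b1)\<close> and minus \<open>d(r)\<close> for \<open>r \<in> J\<close>, where \<open>d(b1) \<ge> 1\<close> and \<open>d(r) \<ge> 2\<close>.
\<close>

lemma light_vertex:
  "\<exists>x\<in>U. (\<alpha> - 1) * card (N x) + (if a \<in> N x then \<alpha> - 1 else 0) + (\<alpha> - 2) * card (N x \<inter> J) < 2 * \<alpha> * (\<alpha> - 1)"
proof (rule ccontr)
  obtain m where m: "\<alpha> = m + 1" "2 \<le> m" using h4 h by (intro that[of "\<alpha> - 1"]) auto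
  let ?w = "\<lambda>x. m * card (N x) + (if a \<in> N x then m else 0) + (m - 1) * card (N x \<inter> J)"
  assume "\<not> ?thesis"
  then have "\<And>x. x \<in> U \<Longrightarrow> 2 * \<alpha> * m \<le> ?w x" using m by (fastforce simp: not_less split: if_splits)
  then have "(\<Sum>x\<in>U. 2 * \<alpha> * m) \<le> (\<Sum>x\<in>U. ?w x)" by (rule sum_mono)
  then have 1: "2 * \<alpha> * m * card U \<le> m * (\<Sum>x\<in>U. card (N x)) + (\<Sum>x\<in>U. if a \<in> N x then m else 0) + (m - 1) * (\<Sum>x\<in>U. card (N x \<inter> J))"
    by (simp add: sum.distrib sum_distrib_left mult.commute)
  let ?D = "\<lambda>r. card {x \<in> U. {r, x} \<in> E}"
  have 2: "(\<Sum>x\<in>U. if a \<in> N x then m else 0) = m * ?D a"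
  proof -
    have "(\<Sum>x\<in>U. if a \<in> N x then m else 0) = (\<Sum>x\<in>{x \<in> U. a \<in> N x}. m)" using fU by (rule sum.inter_filter[symmetric])
    moreover have "{x \<in> U. a \<in> N x} = {x \<in> U. {a, x} \<in> E}" using in_N sym by blast
    ultimately show ?thesis by simp
  qed
  have 3: "(\<Sum>x\<in>U. card (N x \<inter> J)) = (\<Sum>r\<in>J. ?D r)"
  proof -
    have fJ: "finite J" using fR by simp
    have "(\<Sum>x\<in>U. card (N x \<inter> J)) = (\<Sum>x\<in>U. \<Sum>r\<in>J. if r \<in> N x then 1 else 0)"
    proof (rule sum.cong[OF refl])
      fix x
      have "N x \<inter> J = {r \<in> J. r \<in> N x}" by blast
      then show "card (N x \<inter> J) = (\<Sum>r\<in>J. if r \<in> N x then 1 else 0)"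
        using sum.inter_filter[OF fJ, of "\<lambda>_. 1 :: nat" "\<lambda>r. r \<in> N x"] by simp
    qed
    also have "\<dots> = (\<Sum>r\<in>J. \<Sum>x\<in>U. if r \<in> N x then 1 else 0)" by (rule sum.swap)
    also have "\<dots> = (\<Sum>r\<in>J. ?D r)"
    proof (rule sum.cong[OF refl])
      fix r
      have "{x \<in> U. {r, x} \<in> E} = {x \<in> U. r \<in> N x}" using in_N sym by blast
      then show "(\<Sum>x\<in>U. if r \<in> N x then 1 else 0) = ?D r"
        using sum.inter_filter[OF fU, of "\<lambda>_. 1 :: nat" "\<lambda>x. r \<in> N x"] by simp
    qed
    finally show ?thesis .
  qed
  have "R = insert a (insert b1 J)" using aA b12 by blast
  then have 4: "(\<Sum>r\<in>R. ?D r) = ?D a + ?D b1 + (\<Sum>r\<in>J. ?D r)"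
  proof -
    have "(\<Sum>r\<in>insert a (insert b1 J). ?D r) = ?D a + (?D b1 + (\<Sum>r\<in>J. ?D r))"
      using fR aA by (subst sum.insert, simp, blast, subst sum.insert) auto
    then show ?thesis using \<open>R = insert a (insert b1 J)\<close> by simp
  qed
  have 5: "(\<Sum>x\<in>U. card (N x)) + (?D a + ?D b1 + (\<Sum>r\<in>J. ?D r)) = 2 * \<alpha> * card U + 2"
    using sum_degrees[OF g fU fR UR nbU] rho1 4 by simp
  have "b1 \<in> nb E U" using b12 nbU_eq by simp
  then obtain x where "x \<in> U" "{b1, x} \<in> E" unfolding in_nb using sym by blast
  then have "{x \<in> U. {b1, x} \<in> E} \<noteq> {}" by blast
  then have 6: "1 \<le> ?D b1" using fU by (simp add: Suc_le_eq card_gt_0_iff)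
  have "(\<Sum>r\<in>J. 2) \<le> (\<Sum>r\<in>J. ?D r)" by (rule sum_mono, rule root_deg2) auto
  then have 7: "2 * m \<le> (\<Sum>r\<in>J. ?D r)" using card_J h m by simp
  define d where "d = (\<Sum>x\<in>U. card (N x))"
  define j where "j = (\<Sum>r\<in>J. ?D r)"
  define p where "p = ?D a"
  define q where "q = ?D b1"
  have e5: "d + (p + q + j) = 2 * \<alpha> * card U + 2" using 5 unfolding d_def j_def p_def q_def .
  have e1: "2 * \<alpha> * m * card U \<le> m * d + m * p + (m - 1) * j" using 1 unfolding 2 3 d_def j_def p_def .
  \<comment> \<open>Subtracting \<open>e1\<close> from this multiple of the degree equation leaves m
    q + j \<le> 2 m, whereas q \<ge> 1 and j \<ge> 2 m.\<close>
  have "m * (d + (p + q + j)) = m * (2 * \<alpha> * card U + 2)" using e5 by simp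
  then have "m * d + m * p + m * q + m * j = 2 * \<alpha> * m * card U + 2 * m" by (simp add: algebra_simps)
  moreover have "m * j = (m - 1) * j + j" using m by (cases m) auto
  moreover have "m \<le> m * q" using 6 unfolding q_def by simp
  ultimately have "m + j \<le> 2 * m" using e1 by linarith
  then show False using 7 m unfolding j_def by linarith
qed

lemma far_False:
  assumes x: "x \<in> U" "a \<notin> N x" and d: "card (N x) \<le> 2 * \<alpha> - 1"
  shows False
proof (rule star_goodI[OF x(1)])
  fix x1 x2 W assume e: "x1 \<in> N x" "x2 \<in> N x" "x1 \<noteq> x2" "W \<subseteq> N x - {x1, x2}" "B \<inter> N x \<subseteq> {x1, x2}"
  show "feas E ({x} \<union> N x) W x1 x2"
  proof (rule star_link[OF x(1) d _ e(1,2,3,5,4)])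
    show "\<not> A \<subseteq> N x" using aA x(2) by blast
    show "\<alpha> - 2 \<le> card (N z \<inter> (N x - {x1, x2}))" if z: "z \<in> N x \<inter> U" "z \<notin> {x1, x2}" for z
    proof -
      have xz: "{x, z} \<in> E" "z \<in> U" using z in_N by auto
      have eq: "N z \<inter> (N x - {x1, x2}) = common E z x - {x1, x2}" unfolding common_N by blast
      show ?thesis
      proof (cases "a \<in> N z \<and> b1 \<in> N x")
        \<comment> \<open>The weaker bound on common neighbours suffices here: \<open>b1\<close>
          must be one of the ends and is not adjacent to \<open>z\<close>, so removing the ends
          costs at most one common neighbour.\<close>
        case True
        then have "b1 \<notin> N z" using nocom[OF xz(2)] by blast
        then have b: "b1 \<notin> common E z x" unfolding common_N by blast
        have "b1 \<in> {x1, x2}" using e(5) True by blast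
        then obtain w where w: "{x1, x2} = {b1, w}" by blast
        then have "common E z x - {x1, x2} = common E z x - {w}" using b by auto
        moreover have "card (common E z x) - card {w} \<le> card (common E z x - {w})" by (rule diff_card_le_card_Diff) simp
        ultimately show ?thesis using eq common_ge1[OF xz(1) x(1) xz(2)] by simp
      next
        case False
        then have "\<not> ((a \<in> N z \<or> a \<in> N x) \<and> (b1 \<in> N z \<or> b1 \<in> N x))" using nocom[OF xz(2)] x(2) by blast
        then have "\<alpha> \<le> card (common E z x)" by (rule common_ge2[OF xz(1) x(1) xz(2)])
        moreover have "card (common E z x) - card {x1, x2} \<le> card (common E z x - {x1, x2})" by (rule diff_card_le_card_Diff) simp
        ultimately show ?thesis using eq e(3) by simp
      qed
    qed
    show "h \<le> card (common E r x - R) + card (N x \<inter> R)" if "r \<in> A \<inter> N x" for r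
      using root_common2[of r x] that in_N sym x by blast
  qed
qed

text \<open>\<open>z\<close> and \<open>x\<close> have at least \<alpha> - 1 common neighbours
  besides \<open>a\<close>. If \<open>b1\<close> is adjacent to \<open>z\<close>, then
  \<open>a\<close> is not, and the weak bound counts none but others; if it is not, the strong bound
  gives \<alpha> and leaving out \<open>a\<close> costs one.\<close>

lemma near_missing_le:
  assumes x: "x \<in> U" "a \<in> N x" and z: "z \<in> N x" "z \<in> U"
  shows "card ((N x - {z, a}) - N z) + \<alpha> + 1 \<le> card (N x)"
proof -
  have za: "z \<noteq> a" using z(2) aA UR by blast
  have b1x: "b1 \<notin> N x" using nocom[OF x] by blast
  have xz: "{x, z} \<in> E" using z(1) in_N by blast
  have zz: "z \<notin> N z" using nb_disj[of E "{z}"] by blast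
  have sub: "N z \<inter> (N x - {z, a}) = common E z x - {a}" unfolding common_N using zz by blast
  have "\<alpha> - 1 \<le> card (common E z x - {a})"
  proof (cases "b1 \<in> N z")
    case True
    then have "a \<notin> N z" using nocom[OF z(2)] by blast
    then have "common E z x - {a} = common E z x" unfolding common_N by blast
    then show ?thesis using common_ge1[OF xz x(1) z(2)] by simp
  next
    case False
    then have "\<alpha> \<le> card (common E z x)" using common_ge2[OF xz x(1) z(2)] b1x by blast
    moreover have "card (common E z x) - card {a} \<le> card (common E z x - {a})" by (rule diff_card_le_card_Diff) simp
    ultimately show ?thesis by simp
  qed
  then have 1: "\<alpha> \<le> card (N z \<inter> (N x - {z, a})) + 1" using sub by simp
  have "N x - {z, a} = (N z \<inter> (N x - {z, a})) \<union> ((N x - {z, a}) - N z)"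
    "(N z \<inter> (N x - {z, a})) \<inter> ((N x - {z, a}) - N z) = {}" by blast+
  then have "card (N x - {z, a}) = card (N z \<inter> (N x - {z, a})) + card ((N x - {z, a}) - N z)"
    using card_Un_disjoint[of "N z \<inter> (N x - {z, a})" "(N x - {z, a}) - N z"] finite_N by (metis finite_Diff finite_Int)
  moreover have "card (N x - {z, a}) + 2 = card (N x)"
  proof -
    have "card (N x - {z, a}) = card (N x) - 2" using z x(2) za finite_N by (simp add: card_Diff_subset)
    moreover have "card {z, a} \<le> card (N x)" using z x(2) finite_N by (intro card_mono) auto
    ultimately show ?thesis using za by simp
  qed
  ultimately show ?thesis using 1 by linarith
qed

text \<open>\<open>x\<close> gathers \<open>W\<close>, and the ends are joined inside
  \<open>N x\<close>. If the degree is at most h = \<alpha> + 1, a nonroot end misses nothing but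
  possibly \<open>a\<close>, so the ends are adjacent; one of them is a nonroot because
  \<open>b1\<close> is absent. At degree h + 1 both ends are nonroots and each misses at most one
  further vertex; if they miss each other, a third vertex joins them.\<close>

lemma near_few_False:
  assumes x: "x \<in> U" "a \<in> N x"
    and d: "card (N x) \<le> h \<or> card (N x) \<le> h + 1 \<and> B \<inter> N x = {}"
  shows False
proof (rule star_goodI[OF x(1)])
  fix x1 x2 W assume e: "x1 \<in> N x" "x2 \<in> N x" "x1 \<noteq> x2" "W \<subseteq> N x - {x1, x2}" "card W \<le> h - 2" "A \<inter> N x \<subseteq> W" "B \<inter> N x \<subseteq> {x1, x2}"
  have aW: "a \<in> W" using e(6) aA x(2) by blast
  have b1x: "b1 \<notin> N x" using nocom[OF x] by blast
  have ends: "p \<in> U \<or> p \<in> B \<inter> N x" if "p \<in> {x1, x2}" for p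
  proof -
    have "p \<notin> A" using that e(4,6,1,2) by blast
    then show ?thesis using that e(1,2) N_UR[OF x(1)] by blast
  qed
  have miss: "p = q \<or> q = a \<or> q \<in> N p" if "p \<in> N x" "p \<in> U" "q \<in> N x" "card (N x) \<le> h" for p q
  proof (rule ccontr)
    assume "\<not> ?thesis"
    then have "q \<in> (N x - {p, a}) - N p" using that by blast
    then have "1 \<le> card ((N x - {p, a}) - N p)" using finite_N card_gt_0_iff[of "(N x - {p, a}) - N p"] by (auto simp: Suc_le_eq)
    then show False using near_missing_le[OF x that(1,2)] that(4) h by linarith
  qed
  show "feas E ({x} \<union> N x) W x1 x2"
  proof (cases "{x1, x2} \<in> E")
    case True
    show ?thesis by (rule star_T[OF _ conn_edge[OF True]]) (use e in auto)
  next
    case False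
    then have n12: "x2 \<notin> N x1" "x1 \<notin> N x2" using in_N sym by blast+
    have a12: "x1 \<noteq> a" "x2 \<noteq> a" using aW e(4) by blast+
    have big: "\<not> card (N x) \<le> h"
    proof
      assume c: "card (N x) \<le> h"
      have "x1 \<in> U \<or> x2 \<in> U"
      proof (rule ccontr)
        assume "\<not> (x1 \<in> U \<or> x2 \<in> U)"
        then have "x1 = b2" "x2 = b2" using ends[of x1] ends[of x2] b1x by blast+
        then show False using e(3) by simp
      qed
      then show False using miss[of x1 x2] miss[of x2 x1] c n12 a12 e(1,2,3) by blast
    qed
    then have c: "card (N x) \<le> h + 1" "B \<inter> N x = {}" using d by blast+
    then have U12: "x1 \<in> U" "x2 \<in> U" using ends by blast+
    have adj: "r \<in> N p" if "p \<in> N x" "p \<in> U" "q \<in> N x" "q \<notin> N p" "q \<noteq> p" "q \<noteq> a" "r \<in> N x - {p, q, a}" for p q r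
    proof (rule ccontr)
      assume "r \<notin> N p"
      then have "{q, r} \<subseteq> (N x - {p, a}) - N p" using that by blast
      then have "card {q, r} \<le> card ((N x - {p, a}) - N p)" using finite_N by (intro card_mono) auto
      moreover have "q \<noteq> r" using that by blast
      ultimately have "2 \<le> card ((N x - {p, a}) - N p)" by simp
      then show False using near_missing_le[OF x that(1,2)] c(1) h by linarith
    qed
    \<comment> \<open>\<open>N x\<close> has h + 1 vertices, two of them are ends, and
      \<open>W\<close> has at most h - 2, so one vertex is free.\<close>
    have "\<not> N x - {x1, x2} \<subseteq> W"
    proof
      assume "N x - {x1, x2} \<subseteq> W"
      moreover have "finite W" using e(4) finite_N finite_subset by blast
      ultimately have "card (N x - {x1, x2}) \<le> card W" by (rule card_mono[rotated])
      moreover have "card (N x - {x1, x2}) = card (N x) - 2" using e(1,2,3) finite_N by (simp add: card_Diff_subset)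
      ultimately show False using e(5) big h4 by linarith
    qed
    then obtain w where w: "w \<in> N x" "w \<noteq> x1" "w \<noteq> x2" "w \<notin> W" by blast
    then have wa: "w \<noteq> a" using aW by blast
    have "w \<in> N x1" using adj[OF e(1) U12(1) e(2) n12(1)] e(3) a12 w wa by blast
    moreover have "w \<in> N x2" using adj[OF e(2) U12(2) e(1) n12(2)] e(3) a12 w wa by blast
    ultimately have "conn E ({w} \<union> {x1, x2})" using in_N sym w by (intro conn_attach) (auto simp: in_nb)
    then show ?thesis by (rule star_T[rotated]) (use e w in auto)
  qed
qed

text \<open>\<open>N x\<close> without the ends has at most 2 \<alpha> - 4 vertices. If it were
  disconnected, each part would have at least \<alpha> - 2, and the part with a nonroot neighbour of
  \<open>a\<close> at least \<alpha> - 1, because such a vertex is not adjacent to \<open>b1\<close>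
  and enjoys the strong bound. The second missing vertex of \<open>A\<close> makes up for the weaker
  bound at the roots.\<close>

lemma near_many_False:
  assumes x: "x \<in> U" "a \<in> N x" and d: "card (N x) \<le> 2 * \<alpha> - 2" and p: "card (A \<inter> N x) + 2 \<le> card A"
  shows False
proof (rule star_goodI[OF x(1)])
  fix x1 x2 W assume e: "x1 \<in> N x" "x2 \<in> N x" "x1 \<noteq> x2" "W \<subseteq> N x - {x1, x2}" "card W \<le> h - 2" "A \<inter> N x \<subseteq> W" "B \<inter> N x \<subseteq> {x1, x2}"
  let ?T = "N x - {x1, x2}"
  have b1x: "b1 \<notin> N x" using nocom[OF x] by blast
  have cT: "card ?T = card (N x) - 2" using e(1,2,3) finite_N by (simp add: card_Diff_subset)
  have aT: "a \<in> ?T" using e(4,6) aA x(2) by blast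
  have rn: "\<exists>z\<in>?T \<inter> U. {r, z} \<in> E" if r: "r \<in> ?T - U" for r
  proof (rule root_nbr[OF x(1) e(3,7)])
    have "r \<in> R" using r N_UR[OF x(1)] by blast
    moreover have "{r, x} \<in> E" using r in_N sym by blast
    ultimately have "h \<le> card (common E r x - R) + card (N x \<inter> R) + 1" using root_common1 x(1) by blast
    then show "3 \<le> card (common E r x - R) + card (B \<inter> N x)"
      using card_root_nbrs[of x] cardA p h4 card_mono[of "{b2}" "B \<inter> N x"] b1x by fastforce
  qed
  have dg: "\<alpha> - 3 \<le> card (N z \<inter> ?T) \<and> (b1 \<notin> N z \<longrightarrow> \<alpha> - 2 \<le> card (N z \<inter> ?T))" if z: "z \<in> ?T \<inter> U" for z
  proof -
    have xz: "{x, z} \<in> E" "z \<in> U" using z in_N by auto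
    have eq: "N z \<inter> ?T = common E z x - {x1, x2}" unfolding common_N by blast
    have "card (common E z x) - card {x1, x2} \<le> card (common E z x - {x1, x2})" by (rule diff_card_le_card_Diff) simp
    then have "card (common E z x) - 2 \<le> card (N z \<inter> ?T)" using eq e(3) by simp
    moreover have "\<alpha> \<le> card (common E z x) + 1" by (rule common_ge1[OF xz(1) x(1) xz(2)])
    moreover have "b1 \<notin> N z \<longrightarrow> \<alpha> \<le> card (common E z x)" using common_ge2[OF xz(1) x(1) xz(2)] b1x by blast
    ultimately show ?thesis by linarith
  qed
  have fT: "finite ?T" using finite_N by simp
  have "conn E ?T"
  proof (rule connI)
    fix D assume D: "D \<subseteq> ?T" "D \<noteq> {}" "D \<noteq> ?T" and no: "\<And>d s. d \<in> D \<Longrightarrow> s \<in> ?T - D \<Longrightarrow> {d, s} \<notin> E"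
    have no': "{d, s} \<notin> E" if "d \<in> ?T - D" "s \<in> ?T - (?T - D)" for d s
      using no[of s d] that sym[of s d] by blast
    have size: "q + 1 \<le> card X" if X: "X \<subseteq> ?T" "\<And>d s. d \<in> X \<Longrightarrow> s \<in> ?T - X \<Longrightarrow> {d, s} \<notin> E" "z \<in> X" "q \<le> card (N z \<inter> ?T)" for X z q
    proof -
      have "insert z (N z \<inter> ?T) \<subseteq> X" using X in_N by blast
      moreover have "finite X" using X(1) fT finite_subset by blast
      ultimately have "card (insert z (N z \<inter> ?T)) \<le> card X" by (rule card_mono[rotated])
      moreover have "z \<notin> N z \<inter> ?T" using nb_disj[of E "{z}"] by blast
      ultimately show ?thesis using X(4) finite_N by simp
    qed
    have nonroot: "\<exists>z. z \<in> X \<and> z \<in> U" if X: "X \<subseteq> ?T" "X \<noteq> {}" "\<And>d s. d \<in> X \<Longrightarrow> s \<in> ?T - X \<Longrightarrow> {d, s} \<notin> E" for X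
    proof -
      obtain y where y: "y \<in> X" using X(2) by blast
      show ?thesis
      proof (cases "y \<in> U")
        case True then show ?thesis using y by blast
      next
        case False
        then obtain z where "z \<in> ?T \<inter> U" "{y, z} \<in> E" using rn[of y] y X(1) by blast
        then show ?thesis using X(3)[OF y, of z] by blast
      qed
    qed
    have TD: "?T - D \<subseteq> ?T" "?T - D \<noteq> {}" using D by blast+
    obtain z1 where z1: "z1 \<in> D" "z1 \<in> U" using nonroot[OF D(1,2) no] by blast
    obtain z2 where z2: "z2 \<in> ?T - D" "z2 \<in> U" using nonroot[OF TD no'] by blast
    have s1: "\<alpha> - 3 + 1 \<le> card D" by (rule size[OF D(1) no z1(1)]) (use dg[of z1] z1 D(1) in auto)
    have s2: "\<alpha> - 3 + 1 \<le> card (?T - D)" by (rule size[OF TD(1) no' z2(1)]) (use dg[of z2] z2 in auto)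
    have "a \<notin> U" using aA UR by blast
    then obtain z0 where z0: "z0 \<in> ?T \<inter> U" "{a, z0} \<in> E" using rn[of a] aT by blast
    then have "b1 \<notin> N z0" using nocom[of z0] in_N sym by blast
    then have dz: "\<alpha> - 2 \<le> card (N z0 \<inter> ?T)" using dg[OF z0(1)] by blast
    have s0: "\<alpha> - 2 + 1 \<le> card D \<or> \<alpha> - 2 + 1 \<le> card (?T - D)"
    proof (cases "z0 \<in> D")
      case True then show ?thesis using size[OF D(1) no True dz] by blast
    next
      case False then show ?thesis using size[OF TD(1) no' _ dz] z0 by blast
    qed
    have "card (?T - D) = card ?T - card D" "card D \<le> card ?T"
      using card_Diff_subset[OF finite_subset[OF D(1) fT] D(1)] card_mono[OF fT D(1)] by auto
    then show False using s0 s1 s2 cT d h h4 by linarith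
  qed
  then show "feas E ({x} \<union> N x) W x1 x2" by (rule star_S[OF e(1,2,4)])
qed

text \<open>A light vertex has degree at most 2 \<alpha> - 1, and at most 2 \<alpha> - 2 if it is
  adjacent to \<open>a\<close>. If in the latter case at most one vertex of \<open>A\<close> is
  missing, the weight of \<open>J\<close> lowers the degree to \<open>h\<close>, or to h + 1 when
  one is missing and no end is adjacent. Each combination is refuted by one of the three preceding
  lemmas on degrees.\<close>

lemma exact_False: False
proof -
  obtain m where m: "\<alpha> = m + 1" "2 \<le> m" using h4 h by (intro that[of "\<alpha> - 1"]) auto
  obtain x where x: "x \<in> U" and w: "(\<alpha> - 1) * card (N x) + (if a \<in> N x then \<alpha> - 1 else 0) + (\<alpha> - 2) * card (N x \<inter> J) < 2 * \<alpha> * (\<alpha> - 1)"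
    using light_vertex by blast
  let ?d = "card (N x)"
  have w': "m * ?d + (if a \<in> N x then m else 0) + (m - 1) * card (N x \<inter> J) < 2 * m * (m + 1)"
  proof -
    have "\<alpha> - 1 = m" "\<alpha> - 2 = m - 1" "2 * \<alpha> * m = 2 * m * (m + 1)" using m by simp_all
    with w show ?thesis by (simp split: if_splits)
  qed
  show False
  proof (cases "a \<in> N x")
    case False
    then have "m * ?d < m * (2 * (m + 1))" using w' by (simp add: algebra_simps)
    then have "?d < 2 * (m + 1)" by (simp only: mult_less_cancel1)
    then show False using far_False[OF x False] m by simp
  next
    case True
    have b1x: "b1 \<notin> N x" using nocom[OF x True] by blast
    let ?p = "card (A \<inter> N x)" and ?b = "card (B \<inter> N x)"
    have "N x \<inter> R = insert a (N x \<inter> J)" using True aA b1x by blast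
    moreover have "finite (N x \<inter> J)" using finite_N by simp
    ultimately have kJ: "card (N x \<inter> R) = card (N x \<inter> J) + 1" by simp
    have cA: "card A = m" using cardA h m by simp
    have pm: "?p \<le> m" using card_mono[of A "A \<inter> N x"] fR cA by simp
    have w2: "m * ?d + m + (m - 1) * card (N x \<inter> J) < 2 * m * (m + 1)" using w' True by simp
    show False
    proof (cases "?p + 2 \<le> m")
      case True
      have "m * ?d + m < 2 * m * (m + 1)" using w2 by linarith
      then have "m * ?d < m * (2 * m + 1)" by (simp add: algebra_simps)
      then have "?d < 2 * m + 1" by (simp only: mult_less_cancel1)
      then show False using near_many_False[OF x \<open>a \<in> N x\<close>] m True cA by simp
    next
      case big: False
      obtain l where l: "m = l + 1" "1 \<le> l" using m(2) by (intro that[of "m - 1"]) auto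
      have ml: "m - 1 = l" using l by simp
      have w3: "m * ?d + m + l * card (N x \<inter> J) < 2 * m * (m + 1)" using w2 unfolding ml .
      show False
      proof (cases "?p = m \<or> 1 \<le> ?b")
        case True
        then have "l \<le> card (N x \<inter> J)" using kJ card_root_nbrs[of x] big pm l by linarith
        then have "l * l \<le> l * card (N x \<inter> J)" by simp
        then have "m * ?d + m + l * l < 2 * m * (m + 1)" using w3 by linarith
        \<comment> \<open>With l = m - 1 one has 2 m (m + 1) - m - l * l = m (m + 3) - 1.\<close>
        then have "m * ?d < m * (m + 3)" using l by (simp add: algebra_simps)
        then have "?d < m + 3" by (simp only: mult_less_cancel1)
        then show False using near_few_False[OF x \<open>a \<in> N x\<close>] h m by simp
      next
        case False
        then have "B \<inter> N x = {}" using finite_N by (simp add: not_le)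
        moreover have "l \<le> card (N x \<inter> J) + 1" using kJ card_root_nbrs[of x] big pm l False by linarith
        then have "l * l \<le> l * (card (N x \<inter> J) + 1)" by (rule mult_le_mono2)
        then have "l * l \<le> l * card (N x \<inter> J) + l" by simp
        then have "m * ?d + m + l * l < 2 * m * (m + 1) + l" using w3 by linarith
        then have "m * ?d < m * (m + 4)" using l by (simp add: algebra_simps)
        then have "?d < m + 4" by (simp only: mult_less_cancel1)
        ultimately show False using near_few_False[OF x \<open>a \<in> N x\<close>] h m by simp
      qed
    qed
  qed
qed

end

section \<open>Combining the cases\<close>

lemma dense_swap: "dense E U R b1 b2 h \<alpha> \<longleftrightarrow> dense E U R b2 b1 h \<alpha>"
  unfolding dense_def by (simp only: insert_commute[of b1 b2])

lemma linked_swap: "linked E U R b1 b2 \<longleftrightarrow> linked E U R b2 b1"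
  unfolding linked_def by (subst feas_sym) (simp only: insert_commute[of b1 b2])

lemma rooted_swap: "rooted E U R b1 b2 h \<longleftrightarrow> rooted E U R b2 b1 h"
  unfolding rooted_def by auto

text \<open>Two nested inductions: on |U|, and at h = \<alpha> + 1 for fixed \<open>U\<close> also
  on the number of edges, because the edge deletion in \<open>surplus_False\<close> leaves
  \<open>U\<close> unchanged.\<close>

lemma dense_linked:
  assumes "rooted E U R b1 b2 h" "sparse E U h \<alpha>" "dense E U R b1 b2 h \<alpha>"
  shows "linked E U R b1 b2"
  using assms
proof (induction "card U" arbitrary: E U R b1 b2 h \<alpha> rule: less_induct)
  case less
  note IH = less.hyps
  have exact: "linked F U R b1 b2" if "rooted F U R b1 b2 h" "sparse F U h \<beta>" "dense F U R b1 b2 h \<beta>" "h = \<beta> + 1" for F \<beta>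
    using that
  proof (induction "card F" arbitrary: F rule: less_induct)
    case (less F)
    show ?case
    proof (rule ccontr)
      assume nl: "\<not> linked F U R b1 b2"
      have cr: "critical F U R b1 b2 h \<beta>"
        by (rule critical.intro[OF less.prems(1-3) nl]) (rule IH)
      interpret critical_tight F U R b1 b2 h \<beta>
        by (intro critical_tight.intro critical_tight_axioms.intro cr less.prems(4))
      show False
      proof (cases "\<beta> * card U + 2 \<le> rho F U")
        case True
        interpret critical_surplus F U R b1 b2 h \<beta> by unfold_locales (rule True)
        show False
        proof (rule surplus_False)
          fix E' assume a: "E' \<subset> F" "rooted E' U R b1 b2 h" "sparse E' U h \<beta>" "dense E' U R b1 b2 h \<beta>"
          have "finite F" using less.prems(1) unfolding rooted_def graph_def by blast
          then have "card E' < card F" using a(1) by (intro psubset_card_mono)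
          then show "linked E' U R b1 b2" using less.hyps a less.prems(4) by blast
        qed
      next
        case False
        then obtain a b where ab: "a \<in> R - {b1, b2}" "b \<in> {b1, b2}" "\<beta> * card U + 1 + card (U \<inter> common F a b) \<le> rho F U"
          using less.prems(3,4) unfolding dense_def by auto
        \<comment> \<open>Without a surplus of two, the last alternative of \<open>dense\<close>
          must hold, and it leaves no room for a common neighbour.\<close>
        have "card (U \<inter> common F a b) = 0" using ab(3) False by linarith
        then have e: "U \<inter> common F a b = {}" using fU by simp
        have r: "rho F U = \<beta> * card U + 1" using ab(3) False by linarith
        show False
        proof (cases "b = b1")
          case True
          have "critical_exact F U R b1 b2 h \<beta> a"
            by (intro critical_exact.intro critical_exact_axioms.intro critical_tight.intro critical_tight_axioms.intro cr less.prems(4) r)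
              (use ab e True in auto)
          then show False by (rule critical_exact.exact_False)
        next
          case nb: False
          then have "b = b2" using ab(2) by blast
          have sw: "rooted F U R b2 b1 h" "dense F U R b2 b1 h \<beta>" "\<not> linked F U R b2 b1"
            using less.prems(1,3) nl rooted_swap dense_swap linked_swap by metis+
          have "critical F U R b2 b1 h \<beta>"
            by (rule critical.intro[OF sw(1) less.prems(2) sw(2,3)]) (rule IH)
          moreover have "a \<in> R - {b2, b1}" "U \<inter> common F a b2 = {}" using ab(1) e \<open>b = b2\<close> by auto
          ultimately have "critical_exact F U R b2 b1 h \<beta> a"
            by (intro critical_exact.intro critical_exact_axioms.intro critical_tight.intro critical_tight_axioms.intro less.prems(4) r)
          then show False by (rule critical_exact.exact_False)
        qed
      qed
    qed
  qed
  show ?case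
  proof (cases "h = \<alpha> + 1")
    case True then show ?thesis using exact[OF less.prems] by blast
  next
    case False
    then have ha: "h \<le> \<alpha>" using less.prems(3) unfolding dense_def by blast
    show ?thesis
    proof (rule ccontr)
      assume nl: "\<not> linked E U R b1 b2"
      interpret critical E U R b1 b2 h \<alpha>
        by (rule critical.intro[OF less.prems nl]) (rule IH)
      show False
      proof (rule reduce_dense[OF ha])
        assume "sparse E U h (h - 1)" "dense E U R b1 b2 h (h - 1)"
        moreover have "h = h - 1 + 1" using b12 fR cR by (cases h) auto
        ultimately show "linked E U R b1 b2" using exact[OF less.prems(1)] by blast
      qed
    qed
  qed
qed

section \<open>Quotients\<close>

definition quot :: "'a set set \<Rightarrow> 'a set set \<Rightarrow> 'a set set" where
  "quot E \<X> = {e \<in> E. e \<inter> \<Union>\<X> = {}} \<union> (\<Union>X\<in>\<X>. all_pairs (nb E X))"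

definition separated :: "'a set set \<Rightarrow> 'a set set \<Rightarrow> bool" where
  "separated E \<X> \<longleftrightarrow> (\<forall>X\<in>\<X>. \<forall>Y\<in>\<X>. X \<noteq> Y \<longrightarrow> (nb E X \<union> X) \<inter> Y = {})"

lemma all_pairs_mono: "K \<subseteq> L \<Longrightarrow> all_pairs K \<subseteq> all_pairs L"
  unfolding all_pairs_def by blast

lemma all_pairs_avoid:
  assumes "e \<in> all_pairs K" "e \<inter> Y = {}" shows "e \<in> all_pairs (K - Y)"
proof -
  obtain u v where "e = {u, v}" "u \<in> K" "v \<in> K" "u \<noteq> v" using assms(1) unfolding all_pairs_def by blast
  then show ?thesis using assms(2) by (simp add: all_pairs_iff)
qed

lemma all_pairs_sub: "e \<in> all_pairs K \<Longrightarrow> e \<subseteq> K"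
  unfolding all_pairs_def by blast

text \<open>A good violator \<open>D\<close> is collapsed, which preserves infeasibility, and the
  induction supplies a family for the result. As \<open>nb E D\<close> has become a clique, at most
  one member of that family meets it. If there is one, it absorbs \<open>D\<close>; otherwise
  \<open>D\<close> joins the family. Either way collapsing in two stages equals collapsing at
  once.\<close>

lemma exists_sparse_quotient:
  assumes "rooted E U R b1 b2 h" "\<not> linked E U R b1 b2" "2 \<le> h"
  shows "\<exists>\<X>. (\<forall>X\<in>\<X>. X \<subseteq> U \<and> card (nb E X) < h) \<and> separated E \<X> \<and>
    rooted (quot E \<X>) (U - \<Union>\<X>) R b1 b2 h \<and> \<not> linked (quot E \<X>) (U - \<Union>\<X>) R b1 b2 \<and> sparse (quot E \<X>) (U - \<Union>\<X>) h (h - 1)"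
  using assms
proof (induction "card U" arbitrary: E U rule: less_induct)
  case less
  note ins = less.prems(1)
  have g: "graph E" and fU: "finite U" using ins unfolding rooted_def by auto
  show ?case
  proof (cases "sparse E U h (h - 1)")
    case True
    have "quot E {} = E" unfolding quot_def by simp
    then show ?thesis using less.prems True by (intro exI[of _ "{}"]) (simp add: separated_def)
  next
    case False
    let ?A = "R - {b1, b2}" and ?B = "{b1, b2}"
    \<comment> \<open>\<open>dense_linked\<close> holds for all sizes by now, so any number above
      |U| can serve as the size bound in \<open>good_violator\<close>.\<close>
    have small: "card D < Suc (card U)" if "D \<subseteq> U" "D \<noteq> {}" "card (nb E D) < h" "(h - 1) * card D + 1 \<le> rho E D" for D
      using card_mono[OF fU that(1)] by simp
    have h: "h \<le> h - 1 + 1" by simp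
    have IH: "linked E' U' R' b1' b2'" if "card U' < Suc (card U)" "rooted E' U' R' b1' b2' h'" "sparse E' U' h' (h - 1)" "dense E' U' R' b1' b2' h' (h - 1)"
      for E' :: "'a set set" and U' R' b1' b2' h'
      by (rule dense_linked[OF that(2-4)])
    obtain D where D: "D \<subseteq> U" "D \<noteq> {}" "conn E D" "card (nb E D) < h" "(h - 1) * card D + 1 \<le> rho E D" "good h E ?A ?B D"
      by (rule good_violator[OF IH g fU small False h, where k = h and A = ?A and B = ?B])
    let ?E = "collapse E D" and ?U = "U - D" and ?K = "nb E D"
    have "card ?U < card U" using D(1,2) fU by (intro psubset_card_mono) auto
    moreover have "rooted ?E ?U R b1 b2 h" by (rule rooted_collapse[OF ins D(1)])
    moreover have "\<not> linked ?E ?U R b1 b2"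
      using linked_collapse[OF ins D(1) less_imp_le[OF D(4)] D(6)] less.prems(2) by blast
    ultimately have "\<exists>\<X>. (\<forall>X\<in>\<X>. X \<subseteq> ?U \<and> card (nb ?E X) < h) \<and> separated ?E \<X> \<and>
      rooted (quot ?E \<X>) (?U - \<Union>\<X>) R b1 b2 h \<and> \<not> linked (quot ?E \<X>) (?U - \<Union>\<X>) R b1 b2 \<and> sparse (quot ?E \<X>) (?U - \<Union>\<X>) h (h - 1)"
      by (rule less.hyps[OF _ _ _ less.prems(3)])
    then obtain \<X> where XX: "\<forall>X\<in>\<X>. X \<subseteq> ?U \<and> card (nb ?E X) < h" and sep: "separated ?E \<X>"
      and q: "rooted (quot ?E \<X>) (?U - \<Union>\<X>) R b1 b2 h" "\<not> linked (quot ?E \<X>) (?U - \<Union>\<X>) R b1 b2" "sparse (quot ?E \<X>) (?U - \<Union>\<X>) h (h - 1)"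
      by (elim exE conjE) (rule that)
    have X: "X \<subseteq> ?U \<and> card (nb ?E X) < h" if "X \<in> \<X>" for X using XX that by (rule bspec)
    have XD: "X \<inter> D = {}" if "X \<in> \<X>" for X using X[OF that] by blast
    have far: "nb ?E X = nb E X" "nb E X \<inter> D = {}" if "X \<in> \<X>" "X \<inter> ?K = {}" for X
    proof -
      show "nb ?E X = nb E X" by (rule nb_collapse_far[OF XD[OF that(1)] that(2)])
      show "nb E X \<inter> D = {}"
      proof (rule ccontr)
        assume "nb E X \<inter> D \<noteq> {}"
        then obtain d u where "d \<in> D" "u \<in> X" "{u, d} \<in> E" unfolding nb_def by blast
        then have "u \<in> ?K" using XD[OF that(1)] unfolding in_nb by (auto simp: insert_commute)
        then show False using that(2) \<open>u \<in> X\<close> by blast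
      qed
    qed
    have sepD: "(nb ?E X \<union> X) \<inter> Y = {}" if "X \<in> \<X>" "Y \<in> \<X>" "X \<noteq> Y" for X Y
      using sep that unfolding separated_def by blast
    show ?thesis
    proof (cases "\<exists>Y\<in>\<X>. Y \<inter> ?K \<noteq> {}")
      case True
      then obtain Y where Y: "Y \<in> \<X>" "Y \<inter> ?K \<noteq> {}" by blast
      have cl: "?K \<subseteq> Y \<union> nb ?E Y" by (rule nb_collapse_clique[OF Y(2)])
      have nbY: "nb E (Y \<union> D) = nb ?E Y" by (rule nb_collapse_near[OF XD[OF Y(1)] Y(2) g])
      have oth: "X \<inter> ?K = {}" if "X \<in> \<X>" "X \<noteq> Y" for X
        using sepD[OF Y(1) that(1) that(2)[symmetric]] cl by blast
      let ?\<Y> = "insert (Y \<union> D) (\<X> - {Y})"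
      have un: "\<Union>?\<Y> = D \<union> \<Union>\<X>" using Y(1) by blast
      have nbs: "(\<Union>X\<in>?\<Y>. all_pairs (nb E X)) = (\<Union>X\<in>\<X>. all_pairs (nb ?E X))"
      proof -
        have "(\<Union>X\<in>?\<Y>. all_pairs (nb E X)) = all_pairs (nb ?E Y) \<union> (\<Union>X\<in>\<X> - {Y}. all_pairs (nb E X))"
          using nbY by simp
        also have "(\<Union>X\<in>\<X> - {Y}. all_pairs (nb E X)) = (\<Union>X\<in>\<X> - {Y}. all_pairs (nb ?E X))"
          using far(1) oth by (intro SUP_cong) auto
        finally show ?thesis using Y(1) by blast
      qed
      have "quot E ?\<Y> = quot ?E \<X>"
      proof -
        have "{e \<in> ?E. e \<inter> \<Union>\<X> = {}} \<subseteq> {e \<in> E. e \<inter> (D \<union> \<Union>\<X>) = {}} \<union> all_pairs (nb ?E Y)"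
        proof
          fix e assume e: "e \<in> {e \<in> ?E. e \<inter> \<Union>\<X> = {}}"
          show "e \<in> {e \<in> E. e \<inter> (D \<union> \<Union>\<X>) = {}} \<union> all_pairs (nb ?E Y)"
          proof (cases "e \<in> all_pairs ?K")
            case True
            have "e \<inter> Y = {}" using e Y(1) by blast
            then have "e \<in> all_pairs (?K - Y)" using all_pairs_avoid[OF True] by blast
            then show ?thesis using all_pairs_mono[of "?K - Y" "nb ?E Y"] cl by blast
          next
            case False then show ?thesis using e unfolding collapse_def by blast
          qed
        qed
        moreover have "{e \<in> E. e \<inter> (D \<union> \<Union>\<X>) = {}} \<subseteq> {e \<in> ?E. e \<inter> \<Union>\<X> = {}}" unfolding collapse_def by blast
        ultimately show ?thesis unfolding quot_def un nbs using Y(1) by blast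
      qed
      moreover have "separated E ?\<Y>"
        unfolding separated_def
      proof (intro ballI impI)
        fix P Q assume P: "P \<in> ?\<Y>" and Q: "Q \<in> ?\<Y>" and ne: "P \<noteq> Q"
        consider "P = Y \<union> D" "Q \<in> \<X>" "Q \<noteq> Y" | "Q = Y \<union> D" "P \<in> \<X>" "P \<noteq> Y" | "P \<in> \<X>" "P \<noteq> Y" "Q \<in> \<X>" "Q \<noteq> Y"
          using P Q ne by blast
        then show "(nb E P \<union> P) \<inter> Q = {}"
        proof cases
          case 1
          have "(nb ?E Y \<union> Y) \<inter> Q = {}" by (rule sepD[OF Y(1) 1(2) 1(3)[symmetric]])
          then show ?thesis unfolding 1(1) nbY using XD[OF 1(2)] by blast
        next
          case 2
          have "(nb ?E P \<union> P) \<inter> Y = {}" by (rule sepD[OF 2(2) Y(1) 2(3)])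
          then show ?thesis unfolding 2(1) using far[OF 2(2) oth[OF 2(2,3)]] XD[OF 2(2)] by blast
        next
          case 3
          have "(nb ?E P \<union> P) \<inter> Q = {}" by (rule sepD[OF 3(1,3) ne])
          then show ?thesis using far(1)[OF 3(1) oth[OF 3(1,2)]] by simp
        qed
      qed
      moreover have "P \<subseteq> U \<and> card (nb E P) < h" if "P \<in> ?\<Y>" for P
      proof (cases "P = Y \<union> D")
        case True then show ?thesis using X[OF Y(1)] nbY D(1) by auto
      next
        case False
        then have "P \<in> \<X>" "P \<noteq> Y" using that by auto
        then show ?thesis using X[of P] far(1)[of P] oth[of P] by auto
      qed
      moreover have "U - \<Union>?\<Y> = ?U - \<Union>\<X>" unfolding un by blast
      ultimately show ?thesis using q by (intro exI[of _ ?\<Y>]) simp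
    next
      case False
      then have oth: "X \<inter> ?K = {}" if "X \<in> \<X>" for X using that by blast
      let ?\<Y> = "insert D \<X>"
      have nbs: "(\<Union>X\<in>?\<Y>. all_pairs (nb E X)) = all_pairs ?K \<union> (\<Union>X\<in>\<X>. all_pairs (nb ?E X))"
      proof -
        have "(\<Union>X\<in>\<X>. all_pairs (nb E X)) = (\<Union>X\<in>\<X>. all_pairs (nb ?E X))"
          using far(1) oth by (intro SUP_cong) auto
        then show ?thesis by simp
      qed
      have "quot E ?\<Y> = quot ?E \<X>"
      proof -
        have "{e \<in> ?E. e \<inter> \<Union>\<X> = {}} = {e \<in> E. e \<inter> \<Union>?\<Y> = {}} \<union> all_pairs ?K"
        proof -
          have "e \<inter> \<Union>\<X> = {}" if "e \<in> all_pairs ?K" for e using all_pairs_sub[OF that] oth by blast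
          then have "{e \<in> ?E. e \<inter> \<Union>\<X> = {}} = {e \<in> E. e \<inter> D = {} \<and> e \<inter> \<Union>\<X> = {}} \<union> all_pairs ?K" unfolding collapse_def by auto
          moreover have "e \<inter> \<Union>?\<Y> = {} \<longleftrightarrow> e \<inter> D = {} \<and> e \<inter> \<Union>\<X> = {}" for e by auto
          ultimately show ?thesis by simp
        qed
        then show ?thesis unfolding quot_def nbs by (simp only: Un_assoc)
      qed
      moreover have "separated E ?\<Y>"
        unfolding separated_def
      proof (intro ballI impI)
        fix P Q assume P: "P \<in> ?\<Y>" and Q: "Q \<in> ?\<Y>" and ne: "P \<noteq> Q"
        consider "P = D" "Q \<in> \<X>" | "Q = D" "P \<in> \<X>" | "P \<in> \<X>" "Q \<in> \<X>" using P Q ne by blast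
        then show "(nb E P \<union> P) \<inter> Q = {}"
        proof cases
          case 1 then show ?thesis using oth[of Q] XD[of Q] by blast
        next
          case 2 then show ?thesis using far(2)[of P] oth[of P] XD[of P] by blast
        next
          case 3
          have "(nb ?E P \<union> P) \<inter> Q = {}" by (rule sepD[OF 3 ne])
          then show ?thesis using far(1)[OF 3(1) oth[OF 3(1)]] by simp
        qed
      qed
      moreover have "P \<subseteq> U \<and> card (nb E P) < h" if "P \<in> ?\<Y>" for P
        using that D(1,4) X[of P] far(1)[of P] oth[of P] by auto
      moreover have "U - \<Union>?\<Y> = ?U - \<Union>\<X>" by blast
      ultimately show ?thesis using q by (intro exI[of _ ?\<Y>]) simp
    qed
  qed
qed

lemma card_all_pairs: "finite K \<Longrightarrow> card (all_pairs K) = card K choose 2"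
proof -
  assume f: "finite K"
  have "all_pairs K = {X. X \<subseteq> K \<and> card X = 2}"
  proof
    show "all_pairs K \<subseteq> {X. X \<subseteq> K \<and> card X = 2}" using all_pairs_sub card_all_pairs_elem by blast
    show "{X. X \<subseteq> K \<and> card X = 2} \<subseteq> all_pairs K"
    proof
      fix X assume X: "X \<in> {X. X \<subseteq> K \<and> card X = 2}"
      then obtain u v where "X = {u, v}" "u \<noteq> v" by (metis (mono_tags, lifting) card_2_iff mem_Collect_eq)
      then show "X \<in> all_pairs K" using X by (simp add: all_pairs_iff)
    qed
  qed
  then show ?thesis using n_subsets[OF f, of 2] by simp
qed

text \<open>Failure of density allows a surplus of one at \<open>U\<close>, which the missing pair
  \<open>{b1, b2}\<close> offsets among the roots. If that pair is an edge after all, there can be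
  no surplus: the edge would join the ends while a core of \<open>U\<close> gathers the other
  roots.\<close>

lemma count_edges:
  assumes ins: "rooted Q U R b1 b2 h" and nl: "\<not> linked Q U R b1 b2" and sp: "sparse Q U h (h - 1)" and h: "2 \<le> h"
    and Q: "\<And>e. e \<in> Q \<Longrightarrow> e \<subseteq> U \<union> R"
  shows "card (Q \<union> (all_pairs R - {{b1, b2}})) \<le> (h - 1) * card U + (h choose 2)"
proof -
  have g: "graph Q" and fU: "finite U" and fR: "finite R" and UR: "U \<inter> R = {}" and nbU: "nb Q U \<subseteq> R" and cR: "card R = h"
    and b: "b1 \<in> R" "b2 \<in> R" "b1 \<noteq> b2"
    using ins unfolding rooted_def by auto
  let ?F = "{e \<in> Q. e \<inter> U \<noteq> {}}" and ?b = "{b1, b2}"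
  have finQ: "finite Q" and finP: "finite (all_pairs R)" using g finite_all_pairs[OF fR] unfolding graph_def by auto
  have bR: "?b \<in> all_pairs R" using b by (simp add: all_pairs_iff)
  have cP: "card (all_pairs R - {?b}) + 1 = h choose 2"
    using card_all_pairs[OF fR] cR card_Suc_Diff1[OF finP bR] by simp
  have "\<not> dense Q U R b1 b2 h (h - 1)" using dense_linked[OF ins sp] nl by blast
  then have r1: "rho Q U \<le> (h - 1) * card U + 1" unfolding dense_def using h by auto
  have inR: "e \<in> all_pairs R" if "e \<in> Q" "e \<inter> U = {}" for e
  proof -
    have eR: "e \<subseteq> R" and ek: "e \<in> Q" using Q[OF that(1)] that by blast+
    obtain u v where "e = {u, v}" "u \<noteq> v" using graph_edgeE[OF g ek] by metis
    then show ?thesis using eR by (simp add: all_pairs_iff)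
  qed
  show ?thesis
  proof (cases "?b \<in> Q")
    case False
    have "Q \<union> (all_pairs R - {?b}) \<subseteq> ?F \<union> (all_pairs R - {?b})" using inR False by blast
    then have "card (Q \<union> (all_pairs R - {?b})) \<le> card (?F \<union> (all_pairs R - {?b}))" using finQ finP by (intro card_mono) auto
    also have "\<dots> \<le> rho Q U + card (all_pairs R - {?b})" unfolding rho_def by (rule card_Un_le)
    finally show ?thesis using cP r1 by linarith
  next
    case True
    have "rho Q U \<le> (h - 1) * card U"
    proof (rule ccontr)
      assume n: "\<not> rho Q U \<le> (h - 1) * card U"
      then have ne: "U \<noteq> {}" by auto
      have "\<not> card (nb Q U) < h" using sparseD[OF sp order_refl ne] n by blast
      then have "card (nb Q U) = h" "nb Q U = R" using card_seteq[OF fR nbU] cR by auto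
      moreover have "(h - 1) * card U + 1 + card (U \<inter> {}) \<le> rho Q U" using n by simp
      ultimately obtain D where D: "D \<subseteq> U" "D \<noteq> {}" "conn Q D" "nb Q D = R"
        using conn_dense_part[OF g fU _ sp, of "{}"] by auto
      have "feas Q (U \<union> R) (R - ?b) b1 b2"
      proof (rule feasI[OF _ _ _ conn_edge[OF True]])
        show "conn Q (D \<union> (R - ?b))" by (rule conn_attach[OF D(3,2)]) (use D(4) in blast)
      qed (use D(1) b UR in auto)
      then show False using nl unfolding linked_def by blast
    qed
    moreover have "Q \<union> (all_pairs R - {?b}) \<subseteq> ?F \<union> all_pairs R" using inR by blast
    then have "card (Q \<union> (all_pairs R - {?b})) \<le> card (?F \<union> all_pairs R)" using finQ finP by (intro card_mono) auto
    moreover have "card (?F \<union> all_pairs R) \<le> rho Q U + card (all_pairs R)" unfolding rho_def by (rule card_Un_le)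
    ultimately show ?thesis using card_all_pairs[OF fR] unfolding cR by linarith
  qed
qed

section \<open>Translation to graphs with vertex sets\<close>

lemma simple_graph_graph: "simple_graph G \<Longrightarrow> graph (edges G)"
proof -
  assume s: "simple_graph G"
  then have "edges G \<subseteq> Pow (verts G)" "finite (Pow (verts G))" unfolding simple_graph_def by auto
  then have "finite (edges G)" by (rule finite_subset)
  then show ?thesis using s unfolding simple_graph_def graph_def by blast
qed

lemma nbhd_eq_nb: "simple_graph G \<Longrightarrow> nbhd G X = nb (edges G) X"
  unfolding nbhd_def nb_def simple_graph_def by blast

lemma edges_quotient_graph: "simple_graph G \<Longrightarrow> edges (quotient_graph G \<X>) = quot (edges G) \<X>"
  by (simp add: quotient_graph_def add_edges_def delete_verts_def quot_def nbhd_eq_nb)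

lemma verts_quotient_graph: "verts (quotient_graph G \<X>) = verts G - \<Union>\<X>"
  by (simp add: quotient_graph_def add_edges_def delete_verts_def)

lemma edges_rooted_quotient:
  "simple_graph G \<Longrightarrow> edges (rooted_quotient G A b1 b2 \<X>) = quot (edges G) \<X> \<union> (all_pairs (A \<union> {b1, b2}) - {{b1, b2}})"
  by (simp add: rooted_quotient_def add_edges_def edges_quotient_graph[unfolded add_edges_def])

lemma is_collectionI:
  assumes "simple_graph G" "\<And>X. X \<in> \<X> \<Longrightarrow> X \<subseteq> verts G - S" "separated (edges G) \<X>"
  shows "is_collection G S \<X>"
  using assms unfolding is_collection_def closed_nbhd_def nbhd_eq_nb[OF assms(1)] separated_def by blast

lemma component_contains:
  assumes T: "conn (edges G) T" "T \<subseteq> verts G - P" "a \<in> T"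
  shows "\<exists>C\<in>components (delete_verts G P). T \<subseteq> C"
proof -
  let ?C = "{v. \<exists>p. is_path (delete_verts G P) p a v}"
  have "?C \<in> components (delete_verts G P)" using T(2,3) unfolding components_def delete_verts_def by auto
  moreover have "T \<subseteq> ?C"
  proof
    fix v assume v: "v \<in> T"
    obtain p where p: "p \<noteq> []" "hd p = a" "last p = v" "distinct p" "set p \<subseteq> T"
      and e: "\<forall>i. Suc i < length p \<longrightarrow> {p ! i, p ! Suc i} \<in> edges G"
      using conn_path[OF T(1,3) v] by metis
    have "{p ! i, p ! Suc i} \<inter> P = {}" if "Suc i < length p" for i
    proof -
      have "p ! i \<in> set p" "p ! Suc i \<in> set p" using that by auto
      then have "p ! i \<in> T" "p ! Suc i \<in> T" using p(5) by auto
      then have "p ! i \<notin> P" "p ! Suc i \<notin> P" using T(2) by auto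
      then show ?thesis by simp
    qed
    then have "is_path (delete_verts G P) p a v" using p e T(2) unfolding is_path_def delete_verts_def by auto
    then show "v \<in> ?C" by blast
  qed
  ultimately show ?thesis by blast
qed

lemma linked_feasible:
  assumes l: "linked (edges G) (verts G - (A \<union> {b1, b2})) (A \<union> {b1, b2}) b1 b2"
    and G: "A \<subseteq> verts G" "b1 \<in> verts G - A" "b2 \<in> verts G - A" and ne: "A \<noteq> {}"
  shows "feasible G A b1 b2"
proof -
  have V: "verts G - (A \<union> {b1, b2}) \<union> (A \<union> {b1, b2}) = verts G" and W: "A \<union> {b1, b2} - {b1, b2} = A" using G by blast+
  obtain S T where ST: "S \<subseteq> verts G" "T \<subseteq> verts G" "S \<inter> T = {}" "conn (edges G) S" "conn (edges G) T" "b1 \<in> S" "b2 \<in> S" "A \<subseteq> T"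
    using l unfolding linked_def V W feas_def by metis
  obtain p where p: "p \<noteq> []" "hd p = b1" "last p = b2" "distinct p" "set p \<subseteq> S"
      "\<forall>i. Suc i < length p \<longrightarrow> {p ! i, p ! Suc i} \<in> edges G"
    using conn_path[OF ST(4,6,7)] by metis
  have "is_path G p b1 b2" using p ST(1) unfolding is_path_def by auto
  moreover obtain a where a: "a \<in> T" using ne ST(8) by blast
  have "T \<subseteq> verts G - set p" using ST(2,3) p(5) by blast
  from component_contains[OF ST(5) this a] obtain C where "C \<in> components (delete_verts G (set p))" "T \<subseteq> C" by blast
  ultimately show ?thesis using ST(8) unfolding feasible_def by (metis subset_trans)
qed

lemma path_shortcut:
  assumes p: "is_path G p x y" and ij: "i < j" "j < length p" and e: "{p ! i, p ! j} \<in> edges G"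
  shows "is_path G (take (Suc i) p @ drop j p) x y"
  unfolding is_path_def
proof (intro conjI allI impI)
  let ?q = "take (Suc i) p @ drop j p"
  have P: "p \<noteq> []" "hd p = x" "last p = y" "distinct p" "set p \<subseteq> verts G" "\<And>k. Suc k < length p \<Longrightarrow> {p ! k, p ! Suc k} \<in> edges G"
    using p unfolding is_path_def by auto
  show "?q \<noteq> []" using ij by simp
  show "hd ?q = x" using P(1,2) by simp
  show "last ?q = y" using P(3) ij by simp
  have "set (take (Suc i) p) \<inter> set (drop j p) = {}"
    by (rule set_take_disj_set_drop_if_distinct[OF P(4)]) (use ij in simp)
  then show "distinct ?q" using P(4) by simp
  show "set ?q \<subseteq> verts G" using P(5) set_take_subset[of "Suc i" p] set_drop_subset[of j p] by (simp, blast)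
  fix k assume k: "Suc k < length ?q"
  consider "k < i" | "k = i" | "i < k" by linarith
  then show "{?q ! k, ?q ! Suc k} \<in> edges G"
  proof cases
    case 1 then show ?thesis using P(6)[of k] ij by (simp add: nth_append)
  next
    case 2 then show ?thesis using e ij by (simp add: nth_append)
  next
    case 3
    then obtain l where l: "k = Suc i + l" by (metis less_iff_Suc_add add_Suc)
    have "?q ! k = p ! (j + l)" "?q ! Suc k = p ! Suc (j + l)" using l ij by (simp_all add: nth_append)
    moreover have "Suc (j + l) < length p" using k l ij by simp
    ultimately show ?thesis using P(6) by simp
  qed
qed

text \<open>A shortest path has no chords, so if it spans, it contains all edges.\<close>

lemma spanning_paths_card_edges:
  assumes G: "simple_graph G" and p0: "is_path G p0 x y" and span: "\<And>p. is_path G p x y \<Longrightarrow> set p = verts G"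
  shows "card (edges G) + 1 \<le> card (verts G)"
proof -
  obtain p where p: "is_path G p x y" and min: "\<And>q. is_path G q x y \<Longrightarrow> length p \<le> length q"
    by (rule least_obtain[of "\<lambda>p. is_path G p x y" p0 length, OF p0]) (rule that)
  have V: "set p = verts G" by (rule span[OF p])
  have "distinct p" "p \<noteq> []" using p unfolding is_path_def by auto
  then have c: "card (verts G) = length p" "0 < length p" using distinct_card[of p] V by auto
  have consec: "j = Suc i" if "i < j" "j < length p" "{p ! i, p ! j} \<in> edges G" for i j
  proof -
    have "length p \<le> length (take (Suc i) p @ drop j p)" by (rule min[OF path_shortcut[OF p that]])
    then show ?thesis using that(1,2) by simp
  qed
  have "edges G \<subseteq> (\<lambda>i. {p ! i, p ! Suc i}) ` {..<length p - 1}"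
  proof
    fix e assume e: "e \<in> edges G"
    obtain u v where uv: "e = {u, v}" "u \<noteq> v" using graph_edgeE[OF simple_graph_graph[OF G] e] by metis
    have "u \<in> set p" "v \<in> set p" using G e uv V unfolding simple_graph_def by auto
    then obtain i j where ij: "i < length p" "j < length p" "u = p ! i" "v = p ! j" by (metis in_set_conv_nth)
    have "i \<noteq> j" using ij uv by auto
    then consider "i < j" | "j < i" by linarith
    then show "e \<in> (\<lambda>i. {p ! i, p ! Suc i}) ` {..<length p - 1}"
    proof cases
      case 1
      then have "j = Suc i" using consec[of i j] e uv ij by simp
      then show ?thesis using uv ij by (intro image_eqI[of _ _ i]) auto
    next
      case 2
      then have "i = Suc j" using consec[of j i] e uv ij by (simp add: insert_commute)
      then show ?thesis using uv ij by (intro image_eqI[of _ _ j]) auto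
    qed
  qed
  then have "card (edges G) \<le> card {..<length p - 1}" by (rule surj_card_le[rotated]) simp
  then have "card (edges G) \<le> length p - 1" by simp
  then show ?thesis using c by linarith
qed

text \<open>
  Without roots \<open>a\<^sub>i\<close>, feasibility asks for more than \<open>linked\<close>: a vertex must remain off the path.
\<close>

lemma linked_no_roots:
  assumes G: "simple_graph G" "b1 \<in> verts G" "b2 \<in> verts G" and l: "linked (edges G) (verts G - {b1, b2}) {b1, b2} b1 b2"
    and nf: "\<not> feasible G {} b1 b2"
  shows "card (edges G) + 1 \<le> card (verts G)"
proof -
  have V: "verts G - {b1, b2} \<union> {b1, b2} = verts G" using G by blast
  obtain S where S: "S \<subseteq> verts G" "conn (edges G) S" "b1 \<in> S" "b2 \<in> S"
    using l unfolding linked_def V feas_def by metis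
  obtain p0 where "p0 \<noteq> []" "hd p0 = b1" "last p0 = b2" "distinct p0" "set p0 \<subseteq> S"
      "\<forall>i. Suc i < length p0 \<longrightarrow> {p0 ! i, p0 ! Suc i} \<in> edges G"
    using conn_path[OF S(2,3,4)] by metis
  then have p0: "is_path G p0 b1 b2" using S(1) unfolding is_path_def by auto
  show ?thesis
  proof (rule spanning_paths_card_edges[OF G(1) p0])
    fix p assume p: "is_path G p b1 b2"
    show "set p = verts G"
    proof (rule ccontr)
      assume "set p \<noteq> verts G"
      then obtain a where "a \<in> verts G - set p" using p unfolding is_path_def by blast
      then have "\<exists>C\<in>components (delete_verts G (set p)). {a} \<subseteq> C" by (intro component_contains[of _ "{a}" _ a]) auto
      then show False using nf p unfolding feasible_def by blast
    qed
  qed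
qed

theorem theorem1p2:
  fixes m :: nat and G :: "'a ugraph" and A :: "'a set" and b1 b2 :: 'a
  assumes "rooted_graph m G A b1 b2"
  shows "feasible G A b1 b2 \<or>
    (\<exists>\<X>. is_collection G (A \<union> {b1, b2}) \<X> \<and>
         (\<forall>X\<in>\<X>. card (nbhd G X) \<le> m + 1) \<and>
         real (num_edges (rooted_quotient G A b1 b2 \<X>))
           \<le> (real m + 1) * real (num_verts (quotient_graph G \<X>))
             - (real m)\<^sup>2 / 2 - 3 * real m / 2 - 1)"
proof -
  let ?E = "edges G" and ?R = "A \<union> {b1, b2}" and ?h = "m + 2"
  let ?U = "verts G - ?R"
  have s: "simple_graph G" and A: "A \<subseteq> verts G" "card A = m" and b: "b1 \<in> verts G - A" "b2 \<in> verts G - A" "b1 \<noteq> b2"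
    using assms unfolding rooted_graph_def by auto
  have fV: "finite (verts G)" and eV: "\<And>e. e \<in> ?E \<Longrightarrow> e \<subseteq> verts G" using s unfolding simple_graph_def by auto
  have fA: "finite A" using A fV finite_subset by metis
  have cR: "card ?R = ?h" using A(2) b fA by (simp add: card_insert_if)
  have RV: "?R \<subseteq> verts G" using A b by blast
  have "nb ?E ?U \<subseteq> ?R"
  proof
    fix v assume "v \<in> nb ?E ?U"
    then obtain u where "v \<notin> ?U" "{u, v} \<in> ?E" unfolding in_nb by metis
    then show "v \<in> ?R" using eV[of "{u, v}"] by blast
  qed
  then have ins: "rooted ?E ?U ?R b1 b2 ?h"
    unfolding rooted_def using simple_graph_graph[OF s] fV fA cR b(3) by auto
  show ?thesis
  proof (cases "linked ?E ?U ?R b1 b2")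
    case False
    have "2 \<le> ?h" by simp
    obtain \<X> where X: "\<forall>X\<in>\<X>. X \<subseteq> ?U \<and> card (nb ?E X) < ?h" and sep: "separated ?E \<X>"
      and q: "rooted (quot ?E \<X>) (?U - \<Union>\<X>) ?R b1 b2 ?h" "\<not> linked (quot ?E \<X>) (?U - \<Union>\<X>) ?R b1 b2" "sparse (quot ?E \<X>) (?U - \<Union>\<X>) ?h (?h - 1)"
      using exists_sparse_quotient[OF ins False \<open>2 \<le> ?h\<close>] by metis
    have XU: "\<Union>\<X> \<subseteq> ?U" using X by blast
    have V: "?U - \<Union>\<X> \<union> ?R = verts G - \<Union>\<X>" using RV XU by blast
    have "e \<subseteq> ?U - \<Union>\<X> \<union> ?R" if e: "e \<in> quot ?E \<X>" for e
    proof -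
      have "nb ?E X \<subseteq> verts G - \<Union>\<X>" if X: "X \<in> \<X>" for X
      proof
        fix v assume v: "v \<in> nb ?E X"
        then have "v \<in> nbhd G X" by (simp add: nbhd_eq_nb[OF s])
        then have "v \<in> verts G" "v \<notin> X" unfolding nbhd_def by auto
        moreover have "v \<notin> Y" if "Y \<in> \<X>" "Y \<noteq> X" for Y using sep X that v unfolding separated_def by blast
        ultimately show "v \<in> verts G - \<Union>\<X>" by blast
      qed
      then show ?thesis using e eV unfolding V quot_def by (blast dest: all_pairs_sub)
    qed
    from count_edges[OF q \<open>2 \<le> ?h\<close> this]
    have le: "num_edges (rooted_quotient G A b1 b2 \<X>) \<le> (m + 1) * card (?U - \<Union>\<X>) + (?h choose 2)"
      by (simp add: num_edges_def edges_rooted_quotient[OF s])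
    have n: "num_verts (quotient_graph G \<X>) = card (?U - \<Union>\<X>) + ?h"
    proof -
      have "card (?U - \<Union>\<X> \<union> ?R) = card (?U - \<Union>\<X>) + card ?R" using fV fA by (intro card_Un_disjoint) auto
      then show ?thesis unfolding V cR by (simp add: num_verts_def verts_quotient_graph)
    qed
    have "real (?h choose 2) = (real m + 2) * (real m + 1) / 2"
    proof -
      have "even (?h * (?h - 1))" by simp
      then have "2 * (?h choose 2) = ?h * (?h - 1)" unfolding choose_two by (rule dvd_mult_div_cancel)
      then have "real (2 * (?h choose 2)) = real (?h * (?h - 1))" by (rule arg_cong)
      then show ?thesis by (simp add: algebra_simps)
    qed
    \<comment> \<open>Replacing \<open>card (?U - \<Union>\<X>)\<close> by v - (m + 2) subtracts (m
      + 1) (m + 2), of which the binomial coefficient gives back half; the other half is m^2 / 2 + 3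
      m / 2 + 1.\<close>
    then have "real ((m + 1) * card (?U - \<Union>\<X>) + (?h choose 2))
        = (real m + 1) * real (num_verts (quotient_graph G \<X>)) - (real m)\<^sup>2 / 2 - 3 * real m / 2 - 1"
      unfolding n by (simp add: field_simps power2_eq_square)
    with le have "real (num_edges (rooted_quotient G A b1 b2 \<X>))
        \<le> (real m + 1) * real (num_verts (quotient_graph G \<X>)) - (real m)\<^sup>2 / 2 - 3 * real m / 2 - 1"
      by (metis of_nat_le_iff)
    moreover have "is_collection G ?R \<X>" by (rule is_collectionI[OF s _ sep]) (use X in blast)
    moreover have "\<forall>X\<in>\<X>. card (nbhd G X) \<le> m + 1" using X by (auto simp: nbhd_eq_nb[OF s])
    ultimately show ?thesis by blast
  next
    case True
    show ?thesis
    proof (cases "A = {}")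
      case False
      then show ?thesis using linked_feasible[OF True A(1) b(1,2)] by blast
    next
      case e: True
      then have m: "m = 0" using A(2) by simp
      show ?thesis
      proof (cases "feasible G A b1 b2")
        case nf: False
        \<comment> \<open>For m = 0 the bound reads e \<le> v - 1. Being linked but infeasible means
          that all paths between the ends are spanning, and then the empty collection meets the
          bound.\<close>
        have "card ?E + 1 \<le> card (verts G)"
          by (rule linked_no_roots[OF s, of b1 b2]) (use True nf b e in auto)
        moreover have "edges (rooted_quotient G A b1 b2 {}) = ?E"
        proof -
          have "all_pairs ({} \<union> {b1, b2}) - {{b1, b2}} = {}" unfolding all_pairs_def by auto
          moreover have "quot ?E {} = ?E" unfolding quot_def by simp
          ultimately show ?thesis unfolding edges_rooted_quotient[OF s] e by (simp only: Un_empty_right)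
        qed
        ultimately have "num_edges (rooted_quotient G A b1 b2 {}) + 1 \<le> num_verts (quotient_graph G {})"
          by (simp add: num_edges_def num_verts_def verts_quotient_graph)
        then have "real (num_edges (rooted_quotient G A b1 b2 {})) \<le> real (num_verts (quotient_graph G {})) - 1" by linarith
        then show ?thesis using m by (intro disjI2 exI[of _ "{}"]) (simp add: is_collection_def)
      qed simp
    qed
  qed
qed

end
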